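(* Let $F\subseteq\overline{\mathbb{Q}}$ be the compositum of all $D_4$-extensions of $\mathbb{Q}$, i.e. of all Galois extensions of $\mathbb{Q}$ with Galois group isomorphic to $D_4$. Then $F=\mathbb{Q}(D_4^\infty)$.
   Context: Fix an algebraic closure $\overline{\mathbb{Q}}$ of $\mathbb{Q}$. $D_4$ denotes the dihedral group of order $8$, viewed as a transitive subgroup of $S_4$. A finite group $H$ is of generalized $D_4$-type if it is isomorphic to a quotient of a subdirect product of finitely many groups, each of which is a transitive (as a subgroup of $S_4$) subgroup of $D_4$. A number field $K$ with Galois closure $\widehat{K}$ over $\mathbb{Q}$ is of generalized $D_4$-type if $\mathrm{Gal}(\widehat{K}/\mathbb{Q})$ is a group of generalized $D_4$-type. $\mathbb{Q}(D_4^\infty)\subseteq\overline{\mathbb{Q}}$ is the compositum of all number fields of generalized $D_4$-type. *)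

theory Defs
  imports
    "HOL-Algebra.Algebra"
    "HOL-Algebra.Algebraic_Closure_Type"
begin

section \<open>Groups of generalized \<open>D\<^sub>4\<close>-type\<close>

text \<open>The symmetries of a square whose vertices are labelled cyclically by 1, 2, 3, 4.\<close>

definition D4 :: "(nat \<Rightarrow> nat) set" where
  "D4 = generate (sym_group 4) {cycle_of_list [1, 2, 3, 4], cycle_of_list [1, 3]}"

definition D4_group :: "(nat \<Rightarrow> nat) monoid" where
  "D4_group = sym_group 4 \<lparr>carrier := D4\<rparr>"

definition transitive_subgroup_of_D4 :: "(nat \<Rightarrow> nat) set \<Rightarrow> bool" where
  "transitive_subgroup_of_D4 T \<longleftrightarrow>
     subgroup T D4_group \<and> (\<forall>x\<in>{1..4}. \<forall>y\<in>{1..4}. \<exists>p\<in>T. p x = y)"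

definition subdirect_product ::
    "'i set \<Rightarrow> ('i \<Rightarrow> ('g, 'm) monoid_scheme) \<Rightarrow> ('i \<Rightarrow> 'g) set \<Rightarrow> bool" where
  "subdirect_product I G S \<longleftrightarrow>
     subgroup S (product_group I G) \<and> (\<forall>i\<in>I. (\<lambda>x. x i) ` S = carrier (G i))"

definition generalized_D4_type_group :: "('h, 'm) monoid_scheme \<Rightarrow> bool" where
  "generalized_D4_type_group H \<longleftrightarrow>
     group H \<and> finite (carrier H) \<and>
     (\<exists>(n::nat) T S N.
        let G = (\<lambda>i. sym_group 4 \<lparr>carrier := T i\<rparr>);
            P = product_group {..<n} G \<lparr>carrier := S\<rparr>
        in (\<forall>i<n. transitive_subgroup_of_D4 (T i)) \<and>
           subdirect_product {..<n} G S \<and>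
           N \<lhd> P \<and> H \<cong> P Mod N)"


section \<open>Field extensions inside an ambient field\<close>

definition galois_group :: "('a, 'b) ring_scheme \<Rightarrow> 'a set \<Rightarrow> 'a set \<Rightarrow> ('a \<Rightarrow> 'a) monoid" where
  "galois_group R k K = BijGroup K
     \<lparr>carrier := {\<sigma> \<in> Bij K.
        \<sigma> \<in> ring_hom (R \<lparr>carrier := K\<rparr>) (R \<lparr>carrier := K\<rparr>) \<and> (\<forall>x\<in>k. \<sigma> x = x)}\<rparr>"

text \<open>Extensions need not be finite: \<open>K\<close> is Galois over \<open>k\<close> if it is algebraic over \<open>k\<close> and
  the field fixed by all automorphisms of \<open>K\<close> over \<open>k\<close> is \<open>k\<close> itself.\<close>

definition galois_extension :: "('a, 'b) ring_scheme \<Rightarrow> 'a set \<Rightarrow> 'a set \<Rightarrow> bool" where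
  "galois_extension R k K \<longleftrightarrow>
     subfield k R \<and> subfield K R \<and> k \<subseteq> K \<and>
     (\<forall>x\<in>K. ring.algebraic R k x) \<and>
     {x \<in> K. \<forall>\<sigma>\<in>carrier (galois_group R k K). \<sigma> x = x} = k"

text \<open>The smallest subfield of the ambient field that contains \<open>K\<close> and is Galois over \<open>k\<close>.
  For this to be the Galois closure, the ambient field has to be large enough; below it is an
  algebraic closure of \<open>k\<close>.\<close>

definition galois_closure :: "('a, 'b) ring_scheme \<Rightarrow> 'a set \<Rightarrow> 'a set \<Rightarrow> 'a set" where
  "galois_closure R k K = \<Inter> {E. galois_extension R k E \<and> K \<subseteq> E}"

definition compositum :: "('a, 'b) ring_scheme \<Rightarrow> 'a set set \<Rightarrow> 'a set" where
  "compositum R F = generate_field R (\<Union> F)"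


section \<open>Number fields inside an algebraic closure of the rationals\<close>

text \<open>The type \<open>'a\<close> plays the role of the fixed algebraic closure of the rationals
  (and \<open>\<rat>\<close> is its prime field).  That it is algebraically closed and algebraic over
  the rationals is only required in the theorem.\<close>

abbreviation Qbar :: "'a::field_char_0 ring" where
  "Qbar \<equiv> ring_of_type_algebra"

definition number_field :: "'a::field_char_0 set \<Rightarrow> bool" where
  "number_field K \<longleftrightarrow> subfield K Qbar \<and> ring.finite_dimension Qbar \<rat> K"

definition D4_extension :: "'a::field_char_0 set \<Rightarrow> bool" where
  "D4_extension K \<longleftrightarrow> galois_extension Qbar \<rat> K \<and> galois_group Qbar \<rat> K \<cong> D4_group"

definition generalized_D4_type_field :: "'a::field_char_0 set \<Rightarrow> bool" where
  "generalized_D4_type_field K \<longleftrightarrow>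
     number_field K \<and>
     generalized_D4_type_group (galois_group Qbar \<rat> (galois_closure Qbar \<rat> K))"

definition Q_D4_infinity :: "'a::field_char_0 set" where
  "Q_D4_infinity = compositum Qbar {K. generalized_D4_type_field K}"

end

theory Submission
  imports Defs "HOL-Number_Theory.Euler_Criterion"
begin

text \<open>A group of generalized \<open>D\<^sub>4\<close>-type satisfies the identities \<open>x\<^sup>4 = 1\<close> and \<open>x\<^sup>2 y = y x\<^sup>2\<close> of \<open>D\<^sub>4\<close>.
  Decomposing the Galois closure of a field of generalized \<open>D\<^sub>4\<close>-type into simultaneous eigenspaces of
  the central squares, one sees that it is generated by elements \<open>s\<close> such that \<open>\<sigma>\<^sup>2\<close> acts on the conjugates
  of \<open>s\<close> by a sign \<open>q\<^sub>s(\<sigma>)\<close>.  Here \<open>q\<^sub>s\<close> is a quadratic form on the Galois group of the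
  maximal multiquadratic field, \<open>q\<close> is multiplicative in \<open>s\<close>, and \<open>q\<^sub>s\<close> is trivial only if \<open>s\<close> is
  multiquadratic.  If \<open>a x\<^sup>2 + b y\<^sup>2 = 1\<close> has a rational solution, the square root of \<open>1 + x \<surd>a\<close> has the
  form \<open>\<chi>\<^sub>a \<chi>\<^sub>b\<close> and generates a \<open>D\<^sub>4\<close>-extension (unless \<open>a\<close>, \<open>b\<close> or \<open>a b\<close> is a square), so it remains
  to write every \<open>q\<^sub>s\<close> as a product of such split symbols.

  As in Tate's computation of \<open>K\<^sub>2\<close> of the rationals, the primes are removed from \<open>q\<^sub>s\<close> one by one, the
  largest first.  The terms of \<open>q\<^sub>s\<close> that involve \<open>p\<close> can be brought to the form \<open>\<chi>\<^sub>p \<chi>\<^sub>u\<close> where \<open>u\<close> is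
  a product of \<open>-1\<close> and smaller primes.  A Frobenius automorphism of a multiquadratic field unramified
  at \<open>p\<close> shows that \<open>u\<close> is a quadratic residue modulo \<open>p\<close>, and then \<open>\<chi>\<^sub>p \<chi>\<^sub>u\<close> is a product of split symbols
  and of terms without \<open>p\<close>.  In the end \<open>q\<^sub>s\<close> only depends on the action on \<open>\<surd>-1\<close>, and it is trivial
  because \<open>-1\<close> is not a sum of two squares in a real multiquadratic field.\<close>

hide_const (open) Divisibility.prime UnivPoly.coeff UnivPoly.monom Module.smult Polynomials.degree

section \<open>Extension of automorphisms\<close>

text \<open>Every Galois group is handled through the single group \<open>auts\<close> of the
  ambient field; \<open>depends_on\<close> says that a function on it factors through a smaller
  field. The primes go largest first because Tate's relation x y = z + p r with 0 < x, y < p leaves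
  only z and r below p, so each error term has a lower level. The Frobenius automorphism is built by
  hand: the square roots of -1 and of the primes are independent, so its signs can be prescribed,
  and Legendre symbols are prescribed. Euler's criterion then yields \<phi> x = x ^ p modulo p on
  the order generated by these roots. For odd p, a nonresidue u would produce an element b of a
  field unramified at p such that b \<phi>(b) is 1/p or -1/p, which the parity of the power of p
  forbids. The dihedral construction degenerates to a cyclic extension if a b is a square; then a is
  a sum of two squares and (a, b) = (a, -1) (a, -a) has factors to which the construction applies
  unless a or b is itself a square.\<close>

inductive_set adj :: "'a::field_char_0 set \<Rightarrow> 'a set" for A where
  rat: "q \<in> \<rat> \<Longrightarrow> q \<in> adj A"
| base: "x \<in> A \<Longrightarrow> x \<in> adj A"
| add: "x \<in> adj A \<Longrightarrow> y \<in> adj A \<Longrightarrow> x + y \<in> adj A"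
| mult: "x \<in> adj A \<Longrightarrow> y \<in> adj A \<Longrightarrow> x * y \<in> adj A"

text \<open>Negatives come from the rational -1 and inverses of algebraic elements from
  \<open>ratring_inverse\<close>, so closure under sums and products encodes a subfield of an
  algebraic field.\<close>

definition ratring :: "'a::field_char_0 set \<Rightarrow> bool" where
  "ratring L \<longleftrightarrow> \<rat> \<subseteq> L \<and> (\<forall>x\<in>L. \<forall>y\<in>L. x + y \<in> L \<and> x * y \<in> L)"

lemma ratring_adj: "ratring (adj A)"
  by (auto simp: ratring_def intro: adj.intros)

lemma adj_least:
  assumes "ratring L" "A \<subseteq> L"
  shows "adj A \<subseteq> L"
proof
  fix x assume "x \<in> adj A"
  thus "x \<in> L" by induction (use assms in \<open>auto simp: ratring_def\<close>)
qed

lemma adj_mono: "A \<subseteq> B \<Longrightarrow> adj A \<subseteq> adj B"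
  by (rule adj_least[OF ratring_adj]) (auto intro: adj.base)

context
  fixes L :: "'a::field_char_0 set"
  assumes L: "ratring L"
begin

lemma ratring_rat: "x \<in> \<rat> \<Longrightarrow> x \<in> L"
  and ratring_add: "x \<in> L \<Longrightarrow> y \<in> L \<Longrightarrow> x + y \<in> L"
  and ratring_mult: "x \<in> L \<Longrightarrow> y \<in> L \<Longrightarrow> x * y \<in> L"
  using L by (auto simp: ratring_def)

lemma ratring_0: "0 \<in> L" and ratring_1: "1 \<in> L"
  by (auto intro: ratring_rat)

lemma ratring_minus: "x \<in> L \<Longrightarrow> - x \<in> L"
  using ratring_mult[of "-1" x] ratring_rat[of "-1"] by simp

lemma ratring_diff: "x \<in> L \<Longrightarrow> y \<in> L \<Longrightarrow> x - y \<in> L"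
  using ratring_add[of x "-y"] ratring_minus[of y] by simp

lemma ratring_power: "x \<in> L \<Longrightarrow> x ^ n \<in> L"
  by (induction n) (auto intro: ratring_1 ratring_mult)

lemma ratring_sum: "(\<And>i. i \<in> I \<Longrightarrow> f i \<in> L) \<Longrightarrow> sum f I \<in> L"
  by (induction I rule: infinite_finite_induct) (auto intro: ratring_0 ratring_add)

end

text \<open>Graphs of ring homomorphisms on subrings that contain the rationals.  In an algebraic field
  these subrings are subfields, so the homomorphisms are embeddings.\<close>

definition pgraph :: "('a::field_char_0 \<times> 'a) set \<Rightarrow> bool" where
  "pgraph G \<longleftrightarrow> (\<forall>q\<in>\<rat>. (q, q) \<in> G) \<and>
     (\<forall>x y x' y'. (x, y) \<in> G \<longrightarrow> (x', y') \<in> G \<longrightarrow> (x + x', y + y') \<in> G \<and> (x * x', y * y') \<in> G) \<and>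
     (\<forall>y. (0, y) \<in> G \<longrightarrow> y = 0)"

definition auts :: "('a::field_char_0 \<Rightarrow> 'a) set" where
  "auts = {\<sigma>. bij \<sigma> \<and> (\<forall>x y. \<sigma> (x + y) = \<sigma> x + \<sigma> y) \<and> (\<forall>x y. \<sigma> (x * y) = \<sigma> x * \<sigma> y)}"

text \<open>Strip factors of x from an integer polynomial that vanishes at x until its constant term
  c is nonzero. The relation then reads 1/x = -p(x)/c, so inverses are polynomial
  expressions.\<close>

lemma algebraic_inverse_relation:
  fixes x :: "'a::field_char_0"
  assumes "algebraic x" "x \<noteq> 0"
  shows "\<exists>p c. (\<forall>i. coeff p i \<in> \<rat>) \<and> c \<in> \<rat> \<and> c \<noteq> 0 \<and> c + x * poly p x = 0"
proof -
  from assms(1) obtain p where p: "\<And>i. coeff p i \<in> \<int>" "p \<noteq> 0" "poly p x = 0"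
    by (auto simp: algebraic_def)
  have "p \<noteq> 0 \<longrightarrow> (\<forall>i. coeff p i \<in> \<int>) \<longrightarrow> poly p x = 0 \<longrightarrow> ?thesis"
  proof (induction p)
    case (pCons c p)
    show ?case
    proof (intro impI)
      assume *: "\<forall>i. coeff (pCons c p) i \<in> \<int>" "poly (pCons c p) x = 0" "pCons c p \<noteq> 0"
      have c: "c \<in> \<int>" using *(1)[rule_format, of 0] by simp
      have p: "\<And>i. coeff p i \<in> \<int>" using *(1)[rule_format, of "Suc i" for i] by simp
      show "\<exists>p c. (\<forall>i. coeff p i \<in> \<rat>) \<and> c \<in> \<rat> \<and> c \<noteq> 0 \<and> c + x * poly p x = 0"
      proof (cases "c = 0")
        case True
        thus ?thesis using pCons.IH p * assms(2) by auto
      next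
        case False
        have "(\<forall>i. coeff p i \<in> \<rat>) \<and> c \<in> \<rat> \<and> c \<noteq> 0 \<and> c + x * poly p x = 0"
          using False c p *(2) Ints_subset_Rats by auto
        thus ?thesis by (intro exI)
      qed
    qed
  qed auto
  thus ?thesis using p by blast
qed

context
  fixes G :: "('a::field_char_0 \<times> 'a) set"
  assumes G: "pgraph G"
begin

lemma pgraph_rat: "q \<in> \<rat> \<Longrightarrow> (q, q) \<in> G"
  and pgraph_add: "(x, y) \<in> G \<Longrightarrow> (x', y') \<in> G \<Longrightarrow> (x + x', y + y') \<in> G"
  and pgraph_mult: "(x, y) \<in> G \<Longrightarrow> (x', y') \<in> G \<Longrightarrow> (x * x', y * y') \<in> G"
  and pgraph_zero: "(0, y) \<in> G \<Longrightarrow> y = 0"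
  using G unfolding pgraph_def by blast+

lemma pgraph_diff:
  assumes "(x, y) \<in> G" "(x', y') \<in> G" shows "(x - x', y - y') \<in> G"
  using pgraph_add[OF assms(1) pgraph_mult[OF pgraph_rat[of "-1"] assms(2)]] by simp

lemma pgraph_unique: "(x, y) \<in> G \<Longrightarrow> (x, y') \<in> G \<Longrightarrow> y = y'"
  using pgraph_diff[of x y x y'] pgraph_zero[of "y - y'"] by simp

lemma pgraph_sum: "(\<And>i. i \<in> I \<Longrightarrow> (f i, g i) \<in> G) \<Longrightarrow> (sum f I, sum g I) \<in> G"
  by (induction I rule: infinite_finite_induct) (auto intro: pgraph_rat pgraph_add)

lemma pgraph_power: "(x, y) \<in> G \<Longrightarrow> (x ^ n, y ^ n) \<in> G"
  by (induction n) (auto intro: pgraph_rat pgraph_mult)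

lemma pgraph_poly:
  assumes "\<And>i. coeff p i \<in> \<rat>" "(x, y) \<in> G"
  shows "(poly p x, poly p y) \<in> G"
  unfolding poly_altdef by (intro pgraph_sum pgraph_mult pgraph_power pgraph_rat assms)

text \<open>The relation c + x p(x) = 0 has rational coefficients, hence it holds for the image y
  with the same c and p. So y is nonzero, which is injectivity of the embedding, and both inverses
  are given by the same polynomial.\<close>

lemma pgraph_inverse:
  assumes "(x, y) \<in> G" "x \<noteq> 0" "algebraic x"
  shows "y \<noteq> 0" "(inverse x, inverse y) \<in> G"
proof -
  obtain p c where p: "\<And>i. coeff p i \<in> \<rat>" "c \<in> \<rat>" "c \<noteq> 0" "c + x * poly p x = 0"
    using algebraic_inverse_relation[OF assms(3,2)] by blast
  have "(c + x * poly p x, c + y * poly p y) \<in> G"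
    by (intro pgraph_add pgraph_mult pgraph_poly pgraph_rat p assms)
  hence y: "c + y * poly p y = 0" using p(4) pgraph_zero by simp
  thus y0: "y \<noteq> 0" using p(3) by auto
  have "inverse z = (- inverse c) * poly p z" if "c + z * poly p z = 0" for z
  proof -
    have "z * poly p z = - c" using that by (simp add: add_eq_0_iff)
    hence "z * ((- inverse c) * poly p z) = 1" using p(3) by (simp add: field_simps)
    thus ?thesis by (metis inverse_unique)
  qed
  hence "inverse x = (- inverse c) * poly p x" "inverse y = (- inverse c) * poly p y"
    using p(4) y by blast+
  thus "(inverse x, inverse y) \<in> G"
    using pgraph_mult[OF pgraph_rat[of "- inverse c"] pgraph_poly[OF p(1) assms(1)]] p(2) by simp
qed

end

lemma ratring_inverse:
  assumes "ratring L" "x \<in> L" "algebraic x" shows "inverse x \<in> L"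
proof (cases "x = 0")
  case False
  have "pgraph (Id_on L)" using assms(1) by (auto simp: pgraph_def ratring_def)
  from pgraph_inverse(2)[OF this, of x x] show ?thesis using False assms by auto
qed (use assms ratring_0 in auto)

lemma ratring_divide:
  assumes "ratring L" "x \<in> L" "y \<in> L" "algebraic y" shows "x / y \<in> L"
  using ratring_mult[OF assms(1,2) ratring_inverse[OF assms(1,3,4)]] by (simp add: divide_inverse)

section \<open>Adjoining one element to a partial embedding\<close>

definition polyrel :: "('a::field_char_0 \<times> 'a) set \<Rightarrow> ('a poly \<times> 'a poly) set" where
  "polyrel G = {(P, Q). \<forall>i. (coeff P i, coeff Q i) \<in> G}"

text \<open>The candidate extension that sends x to y, with \<open>polyrel\<close> as the action of
  the embedding on coefficients. It is a mere relation until y is known to be a root of the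
  transported minimal polynomial of x.\<close>

definition simple_graph :: "('a::field_char_0 \<times> 'a) set \<Rightarrow> 'a \<Rightarrow> 'a \<Rightarrow> ('a \<times> 'a) set" where
  "simple_graph G x y = (\<lambda>(P, Q). (poly P x, poly Q y)) ` polyrel G"

lemma simple_graph_closed:
  assumes "pgraph G"
  shows "G \<subseteq> simple_graph G x y" "(x, y) \<in> simple_graph G x y"
    "(u, v) \<in> simple_graph G x y \<Longrightarrow> (u', v') \<in> simple_graph G x y \<Longrightarrow> (u + u', v + v') \<in> simple_graph G x y"
    "(u, v) \<in> simple_graph G x y \<Longrightarrow> (u', v') \<in> simple_graph G x y \<Longrightarrow> (u * u', v * v') \<in> simple_graph G x y"
proof -
  note G = pgraph_rat[OF assms] pgraph_add[OF assms] pgraph_mult[OF assms] pgraph_sum[OF assms]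
  show "G \<subseteq> simple_graph G x y"
  proof
    fix z assume "z \<in> G"
    hence "([:fst z:], [:snd z:]) \<in> polyrel G"
      by (auto simp: polyrel_def coeff_pCons split: nat.split intro: G)
    thus "z \<in> simple_graph G x y" by (force simp: simple_graph_def)
  qed
  have "([:0,1:], [:0,1:]) \<in> polyrel G"
    by (auto simp: polyrel_def coeff_pCons split: nat.split intro: G)
  thus "(x, y) \<in> simple_graph G x y" by (force simp: simple_graph_def)
  assume "(u, v) \<in> simple_graph G x y" "(u', v') \<in> simple_graph G x y"
  then obtain P Q P' Q' where PQ: "(P, Q) \<in> polyrel G" "(P', Q') \<in> polyrel G"
    "u = poly P x" "v = poly Q y" "u' = poly P' x" "v' = poly Q' y"
    by (auto simp: simple_graph_def)
  have "(P + P', Q + Q') \<in> polyrel G" "(P * P', Q * Q') \<in> polyrel G"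
    using PQ(1,2) by (auto simp: polyrel_def coeff_mult intro: G)
  thus "(u + u', v + v') \<in> simple_graph G x y" "(u * u', v * v') \<in> simple_graph G x y"
    using PQ(3-6) by (force simp: simple_graph_def)+
qed

text \<open>Only well-definedness is at stake: P(x) = 0 must force Q(y) = 0 for related P and Q.
  Division by the monic \<open>P0\<close> of least degree, done in both components at once, reduces
  this to \<open>Q0\<close> vanishing at y.\<close>

lemma pgraph_simple_graph:
  fixes G :: "('a::field_char_0 \<times> 'a) set"
  assumes G: "pgraph G" and alg: "\<And>z::'a. algebraic z"
    and min: "(P0, Q0) \<in> polyrel G" "lead_coeff P0 = 1" "poly P0 x = 0" "poly Q0 y = 0"
      "\<And>P Q. (P, Q) \<in> polyrel G \<Longrightarrow> P \<noteq> 0 \<Longrightarrow> poly P x = 0 \<Longrightarrow> degree P0 \<le> degree P"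
  shows "pgraph (simple_graph G x y)"
proof -
  note Gr = pgraph_rat[OF G] pgraph_add[OF G] pgraph_mult[OF G] pgraph_diff[OF G]
  have root: "poly Q y = 0" if "(P, Q) \<in> polyrel G" "poly P x = 0" for P Q
    using that
  proof (induction "degree P" arbitrary: P Q rule: less_induct)
    case less
    have zero: "Q' = 0" if "(0, Q') \<in> polyrel G" for Q'
      using that pgraph_zero[OF G] by (auto simp: polyrel_def poly_eq_iff)
    show ?case
    proof (cases "P = 0")
      case True
      hence "Q = 0" using less.prems(1) zero by blast
      thus ?thesis by simp
    next
      case False
      \<comment> \<open>One division step: k and c cancel the leading term of P, and d is the
        coefficient of Q related to c, so the pair of remainders stays in
        \<open>polyrel\<close>.\<close>
      define k where "k = degree P - degree P0"
      define c where "c = coeff P (degree P)"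
      define d where "d = coeff Q (degree P)"
      have cd: "(c, d) \<in> G" using less.prems by (auto simp: polyrel_def c_def d_def)
      define P' where "P' = P - monom c k * P0"
      define Q' where "Q' = Q - monom d k * Q0"
      have deg: "degree P0 \<le> degree P" using min(5) less.prems False by blast
      have rel: "(P', Q') \<in> polyrel G"
        using less.prems(1) min(1) cd
        by (auto simp: polyrel_def P'_def Q'_def coeff_monom_mult intro!: Gr)
      have root': "poly P' x = 0" using less.prems min(3) by (simp add: P'_def)
      have c0: "c \<noteq> 0" using False by (simp add: c_def)
      have P00: "P0 \<noteq> 0" using min(2) by auto
      have "degree (monom c k * P0) = degree P"
        using c0 P00 deg by (subst degree_mult_eq) (auto simp: degree_monom_eq k_def)
      moreover have "coeff (monom c k * P0) (degree P) = c"
        using deg min(2) by (simp add: coeff_monom_mult k_def)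
      ultimately have "P' = 0 \<or> degree P' < degree P"
        unfolding P'_def c_def
        by (metis coeff_diff cancel_comm_monoid_add_class.diff_cancel eq_zero_or_degree_less
            degree_diff_le order_refl)
      hence "poly Q' y = 0"
      proof
        assume "P' = 0"
        hence "Q' = 0" using zero rel by blast
        thus ?thesis by simp
      next
        assume "degree P' < degree P"
        thus ?thesis using less.hyps rel root' by blast
      qed
      thus ?thesis using min(4) by (simp add: Q'_def)
    qed
  qed
  show ?thesis
    unfolding pgraph_def
  proof (intro conjI allI impI ballI)
    fix q :: 'a assume "q \<in> \<rat>"
    thus "(q, q) \<in> simple_graph G x y" using simple_graph_closed(1)[OF G] Gr(1) by blast
  next
    fix v assume "(0, v) \<in> simple_graph G x y"
    thus "v = 0" using root by (auto simp: simple_graph_def)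
  qed (use simple_graph_closed[OF G] in blast)+
qed

text \<open>The minimal polynomial of x and its image. The image has the same degree because a
  nonzero leading coefficient goes to a nonzero one; being nonconstant, it has a root in an
  algebraically closed field.\<close>

lemma minimal_pair:
  fixes G :: "('a::field_char_0 \<times> 'a) set"
  assumes G: "pgraph G" and alg: "\<And>z::'a. algebraic z"
  obtains P0 Q0 where "(P0, Q0) \<in> polyrel G" "lead_coeff P0 = 1" "poly P0 x = 0"
      "\<And>P Q. (P, Q) \<in> polyrel G \<Longrightarrow> P \<noteq> 0 \<Longrightarrow> poly P x = 0 \<Longrightarrow> degree P0 \<le> degree P"
      "degree Q0 = degree P0" "degree P0 > 0" "Q0 \<noteq> 0"
proof -
  define good where "good = (\<lambda>P. P \<noteq> 0 \<and> poly P x = 0 \<and> (\<exists>Q. (P, Q) \<in> polyrel G))"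
  obtain p where p: "\<And>i. coeff p i \<in> \<int>" "p \<noteq> 0" "poly p x = 0"
    using alg[of x] by (auto simp: algebraic_def)
  have "good p" using p Ints_subset_Rats pgraph_rat[OF G] by (auto simp: good_def polyrel_def)
  then obtain P where P: "good P" and least: "\<And>R. good R \<Longrightarrow> degree P \<le> degree R"
    using ex_has_least_nat[of good p degree] by blast
  then obtain Q where PQ: "(P, Q) \<in> polyrel G" by (auto simp: good_def)
  define c where "c = lead_coeff P"
  define d where "d = coeff Q (degree P)"
  have cd: "(c, d) \<in> G" using PQ by (auto simp: polyrel_def c_def d_def)
  have c0: "c \<noteq> 0" using P by (auto simp: c_def good_def)
  have inv: "d \<noteq> 0" "(inverse c, inverse d) \<in> G" using pgraph_inverse[OF G cd c0 alg] by auto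
  define P0 where "P0 = smult (inverse c) P"
  define Q0 where "Q0 = smult (inverse d) Q"
  have degQ: "degree Q = degree P"
  proof (rule antisym)
    show "degree Q \<le> degree P"
      by (rule degree_le) (metis (no_types, lifting) PQ case_prod_conv coeff_eq_0 mem_Collect_eq pgraph_zero[OF G] polyrel_def)
    show "degree P \<le> degree Q" by (rule le_degree) (use inv in \<open>simp add: d_def\<close>)
  qed
  have P0: "P \<noteq> 0" "poly P x = 0" using P by (auto simp: good_def)
  have deg0: "degree P0 > 0"
    using P0 c0 by (auto simp: P0_def elim!: degree_eq_zeroE intro!: Nat.gr0I)
  have d0: "degree Q0 = degree P0" using degQ c0 inv by (simp add: Q0_def P0_def)
  have "Q0 \<noteq> 0" using deg0 d0 by auto
  show ?thesis
  proof (rule that[of P0 Q0])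
    show "(P0, Q0) \<in> polyrel G"
      using PQ inv(2) by (auto simp: P0_def Q0_def polyrel_def intro: pgraph_mult[OF G])
    show "degree P0 \<le> degree R" if "(R, T) \<in> polyrel G" "R \<noteq> 0" "poly R x = 0" for R T
      using least[of R] that by (auto simp: P0_def good_def)
    show "lead_coeff P0 = 1" using c0 by (simp add: P0_def c_def)
    show "poly P0 x = 0" using P0 by (simp add: P0_def)
  qed (fact deg0 d0 \<open>Q0 \<noteq> 0\<close>)+
qed

text \<open>A maximal partial embedding exists by Zorn's lemma. It is total, since any x can be sent
  to a root of its transported minimal polynomial.\<close>

lemma extend_to_automorphism:
  fixes G :: "('a::{alg_closed_field, field_char_0} \<times> 'a) set"
  assumes G: "pgraph G" and alg: "\<And>z::'a. algebraic z"
  obtains \<sigma> where "\<sigma> \<in> auts" "\<And>x y. (x, y) \<in> G \<Longrightarrow> \<sigma> x = y"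
proof -
  define A where "A = {H. pgraph H \<and> G \<subseteq> H}"
  have "\<exists>M\<in>A. \<forall>H\<in>A. M \<subseteq> H \<longrightarrow> H = M"
  proof (rule subset_Zorn)
    fix C assume C: "subset.chain A C"
    show "\<exists>U\<in>A. \<forall>H\<in>C. H \<subseteq> U"
    proof (cases "C = {}")
      case True
      thus ?thesis using G by (auto simp: A_def)
    next
      case False
      have CA: "\<And>H. H \<in> C \<Longrightarrow> pgraph H \<and> G \<subseteq> H" using C by (auto simp: subset.chain_def A_def)
      have tot: "\<And>H K. H \<in> C \<Longrightarrow> K \<in> C \<Longrightarrow> H \<subseteq> K \<or> K \<subseteq> H"
        using C by (auto simp: subset.chain_def)
      have "pgraph (\<Union>C)"
        unfolding pgraph_def
      proof (intro conjI allI impI ballI)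
        fix q :: 'a assume "q \<in> \<rat>"
        thus "(q, q) \<in> \<Union>C" using CA False pgraph_rat by blast
      next
        fix y assume "(0, y) \<in> \<Union>C"
        thus "y = 0" using CA pgraph_zero by blast
      next
        fix x y x' y' assume "(x, y) \<in> \<Union>C" "(x', y') \<in> \<Union>C"
        then obtain H where H: "H \<in> C" "(x, y) \<in> H" "(x', y') \<in> H" using tot by blast
        show "(x + x', y + y') \<in> \<Union>C" using pgraph_add H CA by blast
        show "(x * x', y * y') \<in> \<Union>C" using pgraph_mult H CA by blast
      qed
      moreover have "G \<subseteq> \<Union>C" using CA False by blast
      ultimately have "\<Union>C \<in> A" by (simp add: A_def)
      thus ?thesis by blast
    qed
  qed
  then obtain M where MA: "M \<in> A" "\<And>H. H \<in> A \<Longrightarrow> M \<subseteq> H \<Longrightarrow> H = M" by blast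
  have M: "pgraph M" "G \<subseteq> M" using MA(1) by (auto simp: A_def)
  have max: "H = M" if "pgraph H" "M \<subseteq> H" for H
    using MA(2)[of H] that M(2) by (auto simp: A_def)
  have total: "\<exists>y. (x, y) \<in> M" for x
  proof -
    obtain P0 Q0 where PQ: "(P0, Q0) \<in> polyrel M" "lead_coeff P0 = 1" "poly P0 x = 0"
      "\<And>P Q. (P, Q) \<in> polyrel M \<Longrightarrow> P \<noteq> 0 \<Longrightarrow> poly P x = 0 \<Longrightarrow> degree P0 \<le> degree P"
      "degree Q0 = degree P0" "degree P0 > 0"
      using minimal_pair[OF M(1) alg] by metis
    obtain y where "poly Q0 y = 0" using alg_closed_imp_poly_has_root[of Q0] PQ by auto
    hence "pgraph (simple_graph M x y)"
      by (rule pgraph_simple_graph[OF M(1) alg PQ(1-3)]) (fact PQ(4))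
    with max simple_graph_closed(1,2)[OF M(1)] show ?thesis by blast
  qed
  define \<sigma> where "\<sigma> x = (THE y. (x, y) \<in> M)" for x
  have \<sigma>: "\<sigma> x = y" if "(x, y) \<in> M" for x y
    unfolding \<sigma>_def using that pgraph_unique[OF M(1)] by blast
  have M\<sigma>: "(x, \<sigma> x) \<in> M" for x using total \<sigma> by blast
  have hom: "\<sigma> (x + y) = \<sigma> x + \<sigma> y" "\<sigma> (x * y) = \<sigma> x * \<sigma> y" for x y
    by (rule \<sigma>, rule pgraph_add[OF M(1)] pgraph_mult[OF M(1)], rule M\<sigma>, rule M\<sigma>)+
  have inj: "inj \<sigma>"
  proof (rule injI, rule ccontr)
    fix x y assume *: "\<sigma> x = \<sigma> y" "x \<noteq> y"
    have "(x - y, \<sigma> x - \<sigma> y) \<in> M" by (intro pgraph_diff[OF M(1)] M\<sigma>)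
    with pgraph_inverse(1)[OF M(1) this _ alg] * show False by simp
  qed
  \<comment> \<open>Surjectivity: the injective \<sigma> permutes the finite set of roots of an
    integer polynomial that vanishes at z.\<close>
  have "\<exists>x. z = \<sigma> x" for z
  proof -
    obtain p where p: "\<And>i. coeff p i \<in> \<int>" "p \<noteq> 0" "poly p z = 0"
      using alg[of z] by (auto simp: algebraic_def)
    have "(poly p w, poly p (\<sigma> w)) \<in> M" for w
      using p(1) Ints_subset_Rats by (intro pgraph_poly[OF M(1)] M\<sigma>) auto
    hence "poly p (\<sigma> w) = 0" if "poly p w = 0" for w
      using pgraph_zero[OF M(1)] that by metis
    hence "\<sigma> ` {w. poly p w = 0} \<subseteq> {w. poly p w = 0}" by blast
    hence "\<sigma> ` {w. poly p w = 0} = {w. poly p w = 0}"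
      using poly_roots_finite[OF p(2)] inj by (simp add: endo_inj_surj inj_on_def)
    thus ?thesis using p(3) by blast
  qed
  hence "\<sigma> \<in> auts" using inj hom by (auto simp: auts_def bij_def surj_def)
  thus ?thesis using that \<sigma> M(2) by blast
qed

text \<open>The minimal polynomial of x over L is separable in characteristic 0 and not linear, so
  it has a root y other than x; the embedding over L that sends x to y extends to an
  automorphism.\<close>

lemma exists_automorphism_moving:
  fixes L :: "'a::{alg_closed_field, field_char_0} set"
  assumes L: "ratring L" and alg: "\<And>z::'a. algebraic z" and x: "x \<notin> L"
  obtains \<sigma> where "\<sigma> \<in> auts" "\<And>y. y \<in> L \<Longrightarrow> \<sigma> y = y" "\<sigma> x \<noteq> x"
proof -
  define G where "G = Id_on L"
  have G: "pgraph G" using L by (auto simp: pgraph_def ratring_def G_def)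
  obtain P0 Q0 where PQ: "(P0, Q0) \<in> polyrel G" "lead_coeff P0 = 1" "poly P0 x = 0"
      "\<And>P Q. (P, Q) \<in> polyrel G \<Longrightarrow> P \<noteq> 0 \<Longrightarrow> poly P x = 0 \<Longrightarrow> degree P0 \<le> degree P"
      "degree P0 > 0"
    using minimal_pair[OF G alg] by metis
  have "(coeff P0 i, coeff Q0 i) \<in> Id_on L" for i
    using PQ(1) by (auto simp: polyrel_def G_def)
  hence "P0 = Q0" by (intro poly_eqI) (auto simp: Id_on_iff)
  have coeffs: "\<And>i. coeff P0 i \<in> L" using PQ(1) by (auto simp: polyrel_def G_def)
  have "(pderiv P0, pderiv P0) \<in> polyrel G"
  proof -
    have "coeff (pderiv P0) i \<in> L" for i
      unfolding coeff_pderiv by (intro ratring_mult[OF L] ratring_rat[OF L] coeffs) simp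
    thus ?thesis by (simp add: polyrel_def G_def Id_on_iff)
  qed
  moreover have "pderiv P0 \<noteq> 0" using PQ(5) by (simp add: pderiv_eq_0_iff)
  moreover have "degree (pderiv P0) < degree P0" using PQ(5) by (simp add: degree_pderiv)
  ultimately have der: "poly (pderiv P0) x \<noteq> 0" using PQ(4) by fastforce
  obtain R where R: "P0 = [:-x, 1:] * R" using PQ(3) by (auto simp: poly_eq_0_iff_dvd elim!: dvdE)
  have "R \<noteq> 0" using R PQ(5) by auto
  have "degree R > 0"
  proof (rule Nat.gr0I)
    assume "degree R = 0"
    then obtain r where "R = [:r:]" by (rule degree_eq_zeroE)
    hence "P0 = [:- x * r, r:]" using R by simp
    moreover have "r \<noteq> 0" using \<open>R \<noteq> 0\<close> \<open>R = [:r:]\<close> by auto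
    ultimately have "- x * r \<in> L" "r = 1" using coeffs[of 0] PQ(2) by auto
    thus False using x ratring_minus[OF L, of "-x"] by simp
  qed
  then obtain y where y: "poly R y = 0" using alg_closed_imp_poly_has_root by blast
  \<comment> \<open>The product rule gives P0'(x) = R(x); as the derivative does not vanish at x, no
    root of R equals x.\<close>
  have "pderiv P0 = [:-x, 1:] * pderiv R + R * pderiv [:-x, 1:]" unfolding R by (rule pderiv_mult)
  hence "poly (pderiv P0) x = poly R x" by (simp add: pderiv_pCons)
  hence "y \<noteq> x" using der y by auto
  have "poly Q0 y = 0" using \<open>P0 = Q0\<close> R y by (metis mult_zero_right poly_mult)
  hence "pgraph (simple_graph G x y)"
    by (rule pgraph_simple_graph[OF G alg PQ(1-3)]) (fact PQ(4))
  from extend_to_automorphism[OF this alg] obtain \<sigma> where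
    \<sigma>: "\<sigma> \<in> auts" "\<And>u v. (u, v) \<in> simple_graph G x y \<Longrightarrow> \<sigma> u = v" by blast
  show ?thesis
  proof (rule that[of \<sigma>])
    show "\<sigma> \<in> auts" by fact
    show "\<sigma> x \<noteq> x" using \<sigma>(2)[OF simple_graph_closed(2)[OF G]] \<open>y \<noteq> x\<close> by simp
    show "\<sigma> z = z" if "z \<in> L" for z
      by (rule \<sigma>(2)) (use simple_graph_closed(1)[OF G] that in \<open>auto simp: G_def\<close>)
  qed
qed

section \<open>The Galois correspondence\<close>

lemma autsD:
  assumes "\<sigma> \<in> auts"
  shows "\<sigma> (x + y) = \<sigma> x + \<sigma> y" "\<sigma> (x * y) = \<sigma> x * \<sigma> y" "bij \<sigma>"
  using assms by (auto simp: auts_def)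

lemma aut_inj: "\<sigma> \<in> auts \<Longrightarrow> \<sigma> x = \<sigma> y \<longleftrightarrow> x = y"
  using autsD(3) by (metis bij_pointE)

lemma aut_0: "\<sigma> \<in> auts \<Longrightarrow> \<sigma> 0 = 0"
  using autsD(1)[of \<sigma> 0 0] by simp

lemma aut_eq_0: "\<sigma> \<in> auts \<Longrightarrow> \<sigma> x = 0 \<longleftrightarrow> x = 0"
  using aut_inj[of \<sigma> x 0] aut_0[of \<sigma>] by simp

lemma aut_1: "\<sigma> \<in> auts \<Longrightarrow> \<sigma> 1 = 1"
  using autsD(2)[of \<sigma> 1 1] aut_eq_0[of \<sigma> 1] by simp

lemma aut_minus: "\<sigma> \<in> auts \<Longrightarrow> \<sigma> (- x) = - \<sigma> x"
  using autsD(1)[of \<sigma> x "-x"] aut_0[of \<sigma>] by (simp add: eq_neg_iff_add_eq_0 add.commute)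

lemma aut_diff: "\<sigma> \<in> auts \<Longrightarrow> \<sigma> (x - y) = \<sigma> x - \<sigma> y"
  using autsD(1)[of \<sigma> x "-y"] aut_minus[of \<sigma> y] by simp

lemma aut_inverse: "\<sigma> \<in> auts \<Longrightarrow> \<sigma> (inverse x) = inverse (\<sigma> x)"
  using autsD(2)[of \<sigma> x "inverse x"] aut_0[of \<sigma>] aut_1[of \<sigma>]
  by (cases "x = 0") (auto intro: inverse_unique[symmetric])

lemma aut_divide: "\<sigma> \<in> auts \<Longrightarrow> \<sigma> (x / y) = \<sigma> x / \<sigma> y"
  by (simp add: divide_inverse autsD aut_inverse)

lemma aut_power: "\<sigma> \<in> auts \<Longrightarrow> \<sigma> (x ^ n) = \<sigma> x ^ n"
  by (induction n) (auto simp: autsD aut_1)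

lemma aut_of_nat: "\<sigma> \<in> auts \<Longrightarrow> \<sigma> (of_nat n) = of_nat n"
  by (induction n) (auto simp: autsD aut_0 aut_1)

lemma aut_of_int: "\<sigma> \<in> auts \<Longrightarrow> \<sigma> (of_int n) = of_int n"
  by (cases n rule: int_cases2) (auto simp: aut_of_nat aut_minus)

lemma aut_rat: "\<sigma> \<in> auts \<Longrightarrow> x \<in> \<rat> \<Longrightarrow> \<sigma> x = x"
  by (elim Rats_cases') (auto simp: aut_divide aut_of_int)

lemma aut_numeral: "\<sigma> \<in> auts \<Longrightarrow> \<sigma> (numeral n) = numeral n"
  by (simp add: aut_rat)

lemma aut_prod: "\<sigma> \<in> auts \<Longrightarrow> \<sigma> (prod f I) = (\<Prod>i\<in>I. \<sigma> (f i))"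
  by (induction I rule: infinite_finite_induct) (auto simp: autsD aut_1)

lemmas aut_simps = autsD(1,2) aut_inj aut_0 aut_eq_0 aut_1 aut_minus aut_diff aut_inverse
  aut_divide aut_power aut_of_nat aut_of_int aut_numeral

lemma aut_poly: "\<sigma> \<in> auts \<Longrightarrow> \<sigma> (poly P z) = poly (map_poly \<sigma> P) (\<sigma> z)"
  by (induction P) (auto simp: map_poly_pCons aut_simps)

lemma aut_id: "id \<in> auts" "(\<lambda>x. x) \<in> auts"
  by (auto simp: auts_def bij_def)

lemma aut_comp:
  assumes "\<sigma> \<in> auts" "\<tau> \<in> auts" shows "\<sigma> \<circ> \<tau> \<in> auts" "(\<lambda>x. \<sigma> (\<tau> x)) \<in> auts"
proof -
  show "\<sigma> \<circ> \<tau> \<in> auts" using assms by (auto simp: auts_def intro: bij_comp)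
  thus "(\<lambda>x. \<sigma> (\<tau> x)) \<in> auts" by (simp add: comp_def)
qed

lemma aut_inv:
  assumes "\<sigma> \<in> auts" shows "inv_into UNIV \<sigma> \<in> auts" "inv_into UNIV \<sigma> (\<sigma> x) = x" "\<sigma> (inv_into UNIV \<sigma> x) = x"
proof -
  have b: "bij \<sigma>" by (rule autsD(3)[OF assms])
  show 1: "inv_into UNIV \<sigma> (\<sigma> x) = x" for x using b by (simp add: bij_is_inj)
  show 2: "\<sigma> (inv_into UNIV \<sigma> x) = x" for x using b by (simp add: bij_is_surj surj_f_inv_f)
  have "inv_into UNIV \<sigma> (x + y) = inv_into UNIV \<sigma> x + inv_into UNIV \<sigma> y" "inv_into UNIV \<sigma> (x * y) = inv_into UNIV \<sigma> x * inv_into UNIV \<sigma> y" for x y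
    using 1[of "inv_into UNIV \<sigma> x + inv_into UNIV \<sigma> y"] 1[of "inv_into UNIV \<sigma> x * inv_into UNIV \<sigma> y"] by (simp_all add: autsD[OF assms] 2)
  thus "inv_into UNIV \<sigma> \<in> auts" using b by (auto simp: auts_def bij_imp_bij_inv)
qed

definition stable :: "'a::field_char_0 set \<Rightarrow> bool" where
  "stable L \<longleftrightarrow> (\<forall>\<sigma>\<in>auts. \<forall>x\<in>L. \<sigma> x \<in> L)"

lemma stableD: "stable L \<Longrightarrow> \<sigma> \<in> auts \<Longrightarrow> x \<in> L \<Longrightarrow> \<sigma> x \<in> L"
  by (auto simp: stable_def)

lemma stable_iff: "stable L \<Longrightarrow> \<sigma> \<in> auts \<Longrightarrow> \<sigma> x \<in> L \<longleftrightarrow> x \<in> L"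
  using stableD[of L \<sigma> x] stableD[of L "inv_into UNIV \<sigma>" "\<sigma> x"] aut_inv[of \<sigma>] by auto

lemma aut_adj_closed:
  assumes "\<sigma> \<in> auts" "x \<in> adj A" "\<And>x. x \<in> A \<Longrightarrow> \<sigma> x \<in> adj B"
  shows "\<sigma> x \<in> adj B"
  using assms(2) by induction (auto simp: autsD[OF assms(1)] aut_rat[OF assms(1)] intro: adj.intros assms(3))

lemma stable_adj:
  assumes "\<And>\<sigma> x. \<sigma> \<in> auts \<Longrightarrow> x \<in> A \<Longrightarrow> \<sigma> x \<in> adj A"
  shows "stable (adj A)"
  unfolding stable_def using aut_adj_closed assms by blast

lemma aut_adj_eq:
  assumes "\<sigma> \<in> auts" "\<tau> \<in> auts" "\<And>x. x \<in> A \<Longrightarrow> \<sigma> x = \<tau> x" "x \<in> adj A"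
  shows "\<sigma> x = \<tau> x"
  using assms(4)
  by induction (simp_all add: autsD[OF assms(1)] autsD[OF assms(2)] aut_rat[OF assms(1)] aut_rat[OF assms(2)] assms(3))

definition orbit :: "'a::field_char_0 \<Rightarrow> 'a set" where
  "orbit x = (\<lambda>\<sigma>. \<sigma> x) ` auts"

lemma orbit_self: "x \<in> orbit x"
  unfolding orbit_def using aut_id(2) by (intro image_eqI[of _ _ "\<lambda>x. x"]) auto

lemma aut_orbit: "\<sigma> \<in> auts \<Longrightarrow> y \<in> orbit x \<Longrightarrow> \<sigma> y \<in> orbit x"
  unfolding orbit_def using aut_comp(2)[of \<sigma>] by (force intro: image_eqI)

lemma finite_orbit:
  assumes "algebraic x" shows "finite (orbit x)"
proof -
  from assms obtain p where p: "\<And>i. coeff p i \<in> \<int>" "p \<noteq> 0" "poly p x = 0"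
    by (auto simp: algebraic_def)
  have "poly p (\<sigma> x) = 0" if "\<sigma> \<in> auts" for \<sigma>
  proof -
    have "coeff p i \<in> \<rat>" for i using p(1) Ints_subset_Rats by blast
    hence "map_poly \<sigma> p = p" by (intro poly_eqI) (simp add: coeff_map_poly aut_0 aut_rat that)
    thus ?thesis using aut_poly[OF that, of p x] p(3) aut_0[OF that] by simp
  qed
  hence "orbit x \<subseteq> {z. poly p z = 0}" by (auto simp: orbit_def)
  thus ?thesis using poly_roots_finite[OF p(2)] finite_subset by blast
qed

section \<open>The ring \<open>Qbar\<close> and the arithmetic of its type\<close>

lemma Qbar_simps:
  "carrier Qbar = UNIV" "\<zero>\<^bsub>Qbar\<^esub> = 0" "\<one>\<^bsub>Qbar\<^esub> = 1" "x \<oplus>\<^bsub>Qbar\<^esub> y = x + y" "x \<otimes>\<^bsub>Qbar\<^esub> y = x * y"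
  by (auto simp: ring_of_type_algebra_def)

lemma Qbar_minus: "\<ominus>\<^bsub>Qbar\<^esub> (x :: 'a::field_char_0) = - x"
proof -
  interpret Qbar: field "Qbar :: 'a::field_char_0 ring" by (rule field_from_type_algebra)
  show ?thesis
    by (rule sym, rule Qbar.sum_zero_eq_neg) (auto simp: Qbar_simps)
qed

lemma Qbar_inv:
  assumes "(x :: 'a::field_char_0) \<noteq> 0" shows "inv\<^bsub>Qbar\<^esub> x = inverse x"
proof -
  interpret Qbar: field "Qbar :: 'a::field_char_0 ring" by (rule field_from_type_algebra)
  show ?thesis
    by (rule Qbar.comm_inv_char) (use assms in \<open>auto simp: Qbar_simps\<close>)
qed

locale algebraic_numbers =
  fixes ty :: "'a::{alg_closed_field, field_char_0} itself"
  assumes alg: "algebraic (x::'a)"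
begin

lemma fixed_by_stabilizer:
  fixes L :: "'a set"
  assumes "ratring L" "\<And>\<sigma>. \<sigma> \<in> auts \<Longrightarrow> (\<And>y. y \<in> L \<Longrightarrow> \<sigma> y = y) \<Longrightarrow> \<sigma> x = x"
  shows "x \<in> L"
  using exists_automorphism_moving[OF assms(1) alg, of x] assms(2) by blast

lemma fixed_rat:
  assumes "\<And>\<sigma>. \<sigma> \<in> auts \<Longrightarrow> \<sigma> x = (x::'a)"
  shows "x \<in> \<rat>"
  by (rule fixed_by_stabilizer) (use assms in \<open>auto simp: ratring_def\<close>)

lemma ratring_subfield:
  fixes L :: "'a set"
  assumes "ratring L" shows "subfield L Qbar"
proof -
  interpret Qbar: field "Qbar :: 'a ring" by (rule field_from_type_algebra)
  show ?thesis
  proof (rule Qbar.subfieldI')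
  show "subring L Qbar"
    by (rule Qbar.subringI)
      (auto simp: Qbar_simps Qbar_minus intro: ratring_1 ratring_minus ratring_add ratring_mult assms)
  show "inv\<^bsub>Qbar\<^esub> k \<in> L" if "k \<in> L - {\<zero>\<^bsub>Qbar\<^esub>}" for k
    using that ratring_inverse[OF assms _ alg] by (simp add: Qbar_simps Qbar_inv)
  qed
qed

lemma subfield_ratring:
  fixes L :: "'a set"
  assumes "subfield L Qbar" shows "ratring L"
proof -
  interpret Qbar: field "Qbar :: 'a ring" by (rule field_from_type_algebra)
  note sr = subfieldE(1)[OF assms]
  have ops: "x + y \<in> L" "x * y \<in> L" if "x \<in> L" "y \<in> L" for x y
    using subringE(6,7)[OF sr] that by (auto simp: Qbar_simps)
  have one: "1 \<in> L" "0 \<in> L" using subringE(2,3)[OF sr] by (auto simp: Qbar_simps)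
  have neg: "- x \<in> L" if "x \<in> L" for x using subringE(5)[OF sr that] by (simp add: Qbar_minus)
  have inv: "inverse x \<in> L" if "x \<in> L" "x \<noteq> 0" for x
    using Qbar.subfield_m_inv(1)[OF assms, of x] that by (simp add: Qbar_simps Qbar_inv)
  have nat: "of_nat n \<in> L" for n by (induction n) (auto intro: ops one)
  have int: "of_int n \<in> L" for n by (cases n rule: int_cases2) (auto intro: nat neg)
  have "x \<in> L" if "x \<in> \<rat>" for x
    using that by (elim Rats_cases') (auto simp: divide_inverse intro!: ops int inv)
  thus ?thesis using ops by (auto simp: ratring_def)
qed

lemma generate_field_adj: "generate_field Qbar (A :: 'a set) = adj A"
proof
  interpret Qbar: field "Qbar :: 'a ring" by (rule field_from_type_algebra)
  have "subfield (adj A) Qbar" by (rule ratring_subfield[OF ratring_adj])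
  thus "generate_field Qbar A \<subseteq> adj A"
    by (intro Qbar.generate_field_min_subfield1) (auto simp: Qbar_simps intro: adj.base)
  have "ratring (generate_field Qbar A)"
    by (rule subfield_ratring[OF Qbar.generate_field_is_subfield]) (auto simp: Qbar_simps)
  thus "adj A \<subseteq> generate_field Qbar A"
    by (rule adj_least) (auto intro: generate_field.incl)
qed

section \<open>Galois groups as restrictions of \<open>auts\<close>\<close>

lemma galois_group_simps:
  "monoid.mult (galois_group R k K) = monoid.mult (BijGroup K)"
  "\<one>\<^bsub>galois_group R k K\<^esub> = \<one>\<^bsub>BijGroup K\<^esub>"
  by (simp_all add: galois_group_def)

lemma galois_group_carrier:
  "carrier (galois_group Qbar \<rat> (K :: 'a set)) =
     {\<phi> \<in> Bij K. (\<forall>x\<in>K. \<forall>y\<in>K. \<phi> (x + y) = \<phi> x + \<phi> y \<and> \<phi> (x * y) = \<phi> x * \<phi> y) \<and> (\<forall>x\<in>\<rat>. \<phi> x = x)}"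
  by (auto simp: galois_group_def ring_hom_def Qbar_simps dest: Bij_imp_funcset)

text \<open>An automorphism of K is a partial embedding of the ambient field, so it extends. This
  lets computations in all Galois groups take place in \<open>auts\<close>.\<close>

lemma galois_group_extend:
  fixes K :: "'a set"
  assumes "ratring K" "\<phi> \<in> carrier (galois_group Qbar \<rat> K)"
  obtains \<sigma> where "\<sigma> \<in> auts" "\<phi> = restrict \<sigma> K"
proof -
  have \<phi>: "\<phi> \<in> Bij K" "\<And>x y. x \<in> K \<Longrightarrow> y \<in> K \<Longrightarrow> \<phi> (x + y) = \<phi> x + \<phi> y \<and> \<phi> (x * y) = \<phi> x * \<phi> y"
    "\<And>x. x \<in> \<rat> \<Longrightarrow> \<phi> x = x"
    using assms(2) by (auto simp: galois_group_carrier)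
  have "pgraph ((\<lambda>x. (x, \<phi> x)) ` K)"
    unfolding pgraph_def
  proof (intro conjI allI impI ballI)
    fix q :: 'a assume "q \<in> \<rat>"
    thus "(q, q) \<in> (\<lambda>x. (x, \<phi> x)) ` K" using ratring_rat[OF assms(1)] \<phi>(3) by force
  next
    fix x y x' y'
    assume "(x, y) \<in> (\<lambda>x. (x, \<phi> x)) ` K" "(x', y') \<in> (\<lambda>x. (x, \<phi> x)) ` K"
    hence *: "x \<in> K" "x' \<in> K" "y = \<phi> x" "y' = \<phi> x'" by auto
    show "(x + x', y + y') \<in> (\<lambda>x. (x, \<phi> x)) ` K"
      by (rule image_eqI[of _ _ "x + x'"]) (use * \<phi>(2) ratring_add[OF assms(1)] in auto)
    show "(x * x', y * y') \<in> (\<lambda>x. (x, \<phi> x)) ` K"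
      by (rule image_eqI[of _ _ "x * x'"]) (use * \<phi>(2) ratring_mult[OF assms(1)] in auto)
  next
    fix y assume "(0, y) \<in> (\<lambda>x. (x, \<phi> x)) ` K"
    thus "y = 0" using \<phi>(3)[of 0] by auto
  qed
  from extend_to_automorphism[OF this alg] obtain \<sigma> where
    \<sigma>: "\<sigma> \<in> auts" "\<And>x y. (x, y) \<in> (\<lambda>x. (x, \<phi> x)) ` K \<Longrightarrow> \<sigma> x = y" by metis
  moreover have "\<sigma> x = \<phi> x" if "x \<in> K" for x by (rule \<sigma>(2)) (use that in blast)
  hence "\<phi> = restrict \<sigma> K"
    by (intro extensionalityI[OF Bij_imp_extensional[OF \<phi>(1)]]) auto
  ultimately show ?thesis using that by blast
qed

lemma restrict_galois_group:
  fixes K :: "'a set"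
  assumes "ratring K" "\<sigma> \<in> auts" "\<sigma> ` K = K"
  shows "restrict \<sigma> K \<in> carrier (galois_group Qbar \<rat> K)"
proof -
  have "bij_betw \<sigma> K K" using assms(2,3) by (auto simp: bij_betw_def inj_on_def aut_inj)
  thus ?thesis using assms
    by (auto simp: galois_group_carrier Bij_def autsD aut_rat ratring_rat ratring_add ratring_mult)
qed

lemma stable_image: "stable K \<Longrightarrow> \<sigma> \<in> auts \<Longrightarrow> \<sigma> ` K = (K :: 'a set)"
proof (intro equalityI subsetI)
  fix x assume "stable K" "\<sigma> \<in> auts" "x \<in> K"
  thus "x \<in> \<sigma> ` K" using stable_iff[of K \<sigma> "inv_into UNIV \<sigma> x"] aut_inv(3)[of \<sigma> x]
    by (intro image_eqI[of _ _ "inv_into UNIV \<sigma> x"]) auto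
qed (auto simp: stableD)

lemma galois_group_stable:
  fixes K :: "'a set"
  assumes "ratring K" "stable K"
  shows "carrier (galois_group Qbar \<rat> K) = (\<lambda>\<sigma>. restrict \<sigma> K) ` auts"
proof (intro equalityI subsetI)
  fix \<phi> assume "\<phi> \<in> carrier (galois_group Qbar \<rat> K)"
  thus "\<phi> \<in> (\<lambda>\<sigma>. restrict \<sigma> K) ` auts" using galois_group_extend[OF assms(1)] by blast
qed (use restrict_galois_group stable_image assms in blast)

lemma galois_group_mult:
  fixes K :: "'a set"
  assumes "ratring K" "stable K" "\<sigma> \<in> auts" "\<tau> \<in> auts"
  shows "restrict \<sigma> K \<otimes>\<^bsub>galois_group Qbar \<rat> K\<^esub> restrict \<tau> K = restrict (\<sigma> \<circ> \<tau>) K"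
proof -
  have "restrict \<sigma> K \<in> Bij K" "restrict \<tau> K \<in> Bij K"
    using galois_group_stable[OF assms(1,2)] assms(3,4) by (auto simp: galois_group_carrier)
  thus ?thesis using stableD[OF assms(2,4)]
    by (auto simp: galois_group_simps BijGroup_def compose_def restrict_def)
qed

lemma group_galois_group:
  fixes K :: "'a set"
  assumes "ratring K" "stable K"
  shows "group (galois_group Qbar \<rat> K)"
proof (rule groupI)
  let ?G = "galois_group Qbar \<rat> K"
  have one: "\<one>\<^bsub>?G\<^esub> = restrict id K" by (simp add: galois_group_simps BijGroup_def id_def)
  note c = galois_group_stable[OF assms] and m = galois_group_mult[OF assms]
  show "\<one>\<^bsub>?G\<^esub> \<in> carrier ?G" using one c aut_id by auto
  fix x y z assume "x \<in> carrier ?G" "y \<in> carrier ?G" "z \<in> carrier ?G"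
  thus "x \<otimes>\<^bsub>?G\<^esub> y \<in> carrier ?G" "x \<otimes>\<^bsub>?G\<^esub> y \<otimes>\<^bsub>?G\<^esub> z = x \<otimes>\<^bsub>?G\<^esub> (y \<otimes>\<^bsub>?G\<^esub> z)"
    unfolding c by (auto simp: m aut_comp o_assoc)
next
  let ?G = "galois_group Qbar \<rat> K"
  have one: "\<one>\<^bsub>?G\<^esub> = restrict id K" by (simp add: galois_group_simps BijGroup_def id_def)
  note c = galois_group_stable[OF assms] and m = galois_group_mult[OF assms]
  fix x assume "x \<in> carrier ?G"
  then obtain \<sigma> where \<sigma>: "\<sigma> \<in> auts" "x = restrict \<sigma> K" unfolding c by blast
  thus "\<one>\<^bsub>?G\<^esub> \<otimes>\<^bsub>?G\<^esub> x = x" unfolding one using m[OF aut_id(1), of \<sigma>] by simp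
  have "inv_into UNIV \<sigma> \<circ> \<sigma> = id" using aut_inv(2)[OF \<sigma>(1)] by auto
  hence "restrict (inv_into UNIV \<sigma>) K \<otimes>\<^bsub>?G\<^esub> x = \<one>\<^bsub>?G\<^esub>" unfolding \<sigma>(2) one using m[OF aut_inv(1)[OF \<sigma>(1)] \<sigma>(1)] by simp
  thus "\<exists>y\<in>carrier ?G. y \<otimes>\<^bsub>?G\<^esub> x = \<one>\<^bsub>?G\<^esub>" unfolding c using aut_inv(1)[OF \<sigma>(1)] by blast
qed

lemma algebraic_over_Rats: "ring.algebraic Qbar \<rat> (x :: 'a)"
proof -
  interpret Qbar: field "Qbar :: 'a ring" by (rule field_from_type_algebra)
  obtain p where p: "\<And>i. coeff p i \<in> \<int>" "p \<noteq> 0" "poly p x = 0"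
    using alg[of x] by (auto simp: algebraic_def)
  \<comment> \<open>Polynomials of HOL-Algebra are lists with the leading coefficient in
    front.\<close>
  define P where "P = rev (coeffs p)"
  have "P \<noteq> []" using p(2) by (simp add: P_def)
  have "set P \<subseteq> \<rat>" using p(1) Ints_subset_Rats by (auto simp: P_def coeffs_def)
  have "subring (\<rat>::'a set) Qbar" by (rule subfieldE(1)[OF ratring_subfield]) (auto simp: ratring_def)
  have carr: "P \<in> carrier (univ_poly Qbar \<rat>)"
    using \<open>set P \<subseteq> \<rat>\<close> p(2)
    by (auto simp: univ_poly_def polynomial_def P_def hd_rev last_coeffs_eq_coeff_degree Qbar_simps)
  have ev: "Qbar.eval (rev xs) x = poly (Poly xs) x" for xs
  proof (induction xs)
    case (Cons a xs)
    have "Qbar.eval (ys @ [a]) x = Qbar.eval ys x * x + a" for ys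
      using Qbar.eval_append_aux[of ys a x] by (simp add: Qbar_simps)
    thus ?case using Cons by (simp add: mult.commute)
  qed (simp add: Qbar_simps)
  have "Qbar.eval P x = \<zero>\<^bsub>Qbar\<^esub>" unfolding P_def ev using p(3) by (simp add: Qbar_simps)
  thus ?thesis using Qbar.algebraicI[OF carr \<open>P \<noteq> []\<close>] by (simp add: over_def)
qed

text \<open>If K is stable, elements fixed by its Galois group are fixed by \<open>auts\<close>,
  hence rational. Conversely, take the product of X - y over the orbit of x under the automorphisms
  preserving K. Its coefficients lie in K and are fixed by these automorphisms, so they are
  rational; every automorphism then permutes the roots, which lie in K.\<close>

lemma galois_extension_iff:
  fixes K :: "'a set"
  shows "galois_extension Qbar \<rat> K \<longleftrightarrow> ratring K \<and> stable K"
proof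
  assume K: "ratring K \<and> stable K"
  have "x \<in> \<rat>" if "x \<in> K" "\<forall>\<sigma>\<in>carrier (galois_group Qbar \<rat> K). \<sigma> x = x" for x
    using that galois_group_stable[of K] K by (intro fixed_rat) auto
  moreover have "\<sigma> x = x" if "x \<in> \<rat>" "\<sigma> \<in> carrier (galois_group Qbar \<rat> K)" for x \<sigma>
    using that by (simp add: galois_group_carrier)
  moreover have "\<rat> \<subseteq> K" using K by (simp add: ratring_def)
  ultimately have "{x \<in> K. \<forall>\<sigma>\<in>carrier (galois_group Qbar \<rat> K). \<sigma> x = x} = \<rat>" by blast
  moreover have "subfield K Qbar" using K by (simp add: ratring_subfield)
  moreover have "subfield (\<rat> :: 'a set) Qbar" by (rule ratring_subfield) (simp add: ratring_def)
  ultimately show "galois_extension Qbar \<rat> K"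
    using \<open>\<rat> \<subseteq> K\<close> algebraic_over_Rats by (simp add: galois_extension_def)
next
  assume gal: "galois_extension Qbar \<rat> K"
  have K: "ratring K" using gal by (simp add: galois_extension_def subfield_ratring)
  define H where "H = {\<sigma>\<in>auts. \<sigma> ` K = K}"
  have fixed: "x \<in> \<rat>" if "x \<in> K" and fx: "\<And>\<sigma>. \<sigma> \<in> H \<Longrightarrow> \<sigma> x = x" for x
  proof -
    have "\<phi> x = x" if \<phi>: "\<phi> \<in> carrier (galois_group Qbar \<rat> K)" for \<phi>
    proof -
      obtain \<sigma> where \<sigma>: "\<sigma> \<in> auts" "\<phi> = restrict \<sigma> K" using galois_group_extend[OF K \<phi>] .
      have "\<phi> \<in> Bij K" using \<phi> by (simp add: galois_group_carrier)
      hence "\<sigma> ` K = K" unfolding \<sigma>(2) by (auto simp: Bij_def bij_betw_def)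
      thus ?thesis using fx[of \<sigma>] \<open>x \<in> K\<close> \<sigma> by (simp add: H_def)
    qed
    thus ?thesis using gal \<open>x \<in> K\<close> by (auto simp: galois_extension_def)
  qed
  have comp: "\<sigma> \<circ> \<tau> \<in> H" if "\<sigma> \<in> H" "\<tau> \<in> H" for \<sigma> \<tau>
  proof -
    have "(\<sigma> \<circ> \<tau>) ` K = \<sigma> ` \<tau> ` K" by (rule image_comp[symmetric])
    thus ?thesis using that by (simp add: H_def aut_comp)
  qed
  have "\<tau> x \<in> K" if \<tau>: "\<tau> \<in> auts" and x: "x \<in> K" for \<tau> x
  proof -
    define Ob where "Ob = (\<lambda>\<sigma>. \<sigma> x) ` H"
    have fin: "finite Ob" by (rule finite_subset[OF _ finite_orbit[OF alg[of x]]]) (auto simp: Ob_def H_def orbit_def)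
    have ObK: "Ob \<subseteq> K" using x by (auto simp: Ob_def H_def)
    have xOb: "x \<in> Ob" unfolding Ob_def by (rule image_eqI[of _ _ id]) (auto simp: H_def aut_id)
    have perm: "\<sigma> ` Ob = Ob" if \<sigma>: "\<sigma> \<in> H" for \<sigma>
    proof -
      have sa: "\<sigma> \<in> auts" using \<sigma> by (simp add: H_def)
      have "\<sigma> y \<in> Ob" if "y \<in> Ob" for y
      proof -
        obtain \<tau> where "\<tau> \<in> H" "y = \<tau> x" using \<open>y \<in> Ob\<close> by (auto simp: Ob_def)
        thus ?thesis using comp[OF \<sigma>] unfolding Ob_def by (intro image_eqI[of _ _ "\<sigma> \<circ> \<tau>"]) auto
      qed
      hence "\<sigma> ` Ob \<subseteq> Ob" by blast
      moreover have "inj_on \<sigma> Ob" using sa by (simp add: inj_on_def aut_inj)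
      ultimately show ?thesis using endo_inj_surj[OF fin] by blast
    qed
    define P where "P = (\<Prod>y\<in>Ob. [:- y, 1:])"
    have root: "poly P z = 0 \<longleftrightarrow> z \<in> Ob" for z using fin by (simp add: P_def poly_prod)
    have "map_poly \<sigma> P = P" if \<sigma>: "\<sigma> \<in> H" for \<sigma>
    proof -
      have sa: "\<sigma> \<in> auts" using \<sigma> by (simp add: H_def)
      have "poly (map_poly \<sigma> P) z = poly P z" for z
      proof -
        have "poly (map_poly \<sigma> P) z = \<sigma> (poly P (inv_into UNIV \<sigma> z))"
          using aut_poly[OF sa, of P "inv_into UNIV \<sigma> z"] by (simp add: aut_inv(3)[OF sa])
        also have "\<dots> = (\<Prod>y\<in>Ob. z - \<sigma> y)"
          by (simp add: P_def poly_prod aut_prod[OF sa] aut_diff[OF sa] aut_inv(3)[OF sa])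
        also have "\<dots> = (\<Prod>y\<in>\<sigma> ` Ob. z - y)"
          by (rule sym, rule prod.reindex_cong[of \<sigma>]) (auto simp: inj_on_def aut_inj[OF sa])
        also have "\<dots> = poly P z" by (simp add: perm[OF \<sigma>] P_def poly_prod)
        finally show ?thesis .
      qed
      thus ?thesis by (intro poly_ext)
    qed
    hence "\<sigma> (coeff P i) = coeff P i" if "\<sigma> \<in> H" for \<sigma> i
      using that coeff_map_poly[of \<sigma> P i] by (simp add: H_def aut_0)
    moreover have "coeff P i \<in> K" for i
    proof -
      have "\<forall>i. coeff (\<Prod>y\<in>A. [:- y, 1:]) i \<in> K" if "A \<subseteq> K" "finite A" for A
        using that(2,1)
      proof (induction A)
        case (insert a A)
        thus ?case using ratring_0[OF K]
          by (auto simp: coeff_pCons split: nat.splits intro!: ratring_diff[OF K] ratring_mult[OF K] ratring_minus[OF K])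
      qed (use ratring_1[OF K] ratring_0[OF K] in \<open>auto simp: coeff_1\<close>)
      thus ?thesis using ObK fin by (auto simp: P_def)
    qed
    ultimately have "coeff P i \<in> \<rat>" for i
      by (intro fixed) auto
    hence "map_poly \<tau> P = P" by (intro poly_eqI) (simp add: coeff_map_poly aut_0 aut_rat \<tau>)
    hence "poly P (\<tau> x) = 0" using aut_poly[OF \<tau>, of P x] root[of x] xOb aut_0[OF \<tau>] by simp
    thus ?thesis using root ObK by blast
  qed
  thus "ratring K \<and> stable K" using K by (auto simp: stable_def)
qed

lemma galois_closure_props:
  fixes K :: "'a set"
  shows "ratring (galois_closure Qbar \<rat> K)" "stable (galois_closure Qbar \<rat> K)" "K \<subseteq> galois_closure Qbar \<rat> K"
    "galois_extension Qbar \<rat> K \<Longrightarrow> galois_closure Qbar \<rat> K = K"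
  by (auto simp: galois_closure_def galois_extension_iff ratring_def stable_def)

section \<open>Quadratic elements\<close>

text \<open>The square of each automorphism acts on all conjugates of an element \<open>s\<close> of \<open>qelts\<close> by a
  common sign \<open>qf s\<close>.  This sign is a quadratic form on the Galois group of \<open>multiquad\<close>, the field
  generated by all square roots of rationals.\<close>

definition qelts :: "'a set" where
  "qelts = {s. s \<noteq> 0 \<and> (\<forall>\<sigma>\<in>auts. \<exists>e\<in>{1, -1}. \<forall>\<tau>\<in>auts. \<sigma> (\<sigma> (\<tau> s)) = e * \<tau> s)}"

definition qf :: "'a \<Rightarrow> ('a \<Rightarrow> 'a) \<Rightarrow> 'a" where
  "qf s \<sigma> = \<sigma> (\<sigma> s) / s"

lemma qelts_nonzero: "s \<in> qelts \<Longrightarrow> s \<noteq> 0"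
  by (simp add: qelts_def)

lemma qf_act:
  assumes "s \<in> qelts" "\<sigma> \<in> auts"
  shows "qf s \<sigma> = 1 \<or> qf s \<sigma> = -1" "\<tau> \<in> auts \<Longrightarrow> \<sigma> (\<sigma> (\<tau> s)) = qf s \<sigma> * \<tau> s"
    "\<sigma> (\<sigma> s) = qf s \<sigma> * s"
proof -
  obtain e where e: "e \<in> {1, -1}" "\<And>\<tau>. \<tau> \<in> auts \<Longrightarrow> \<sigma> (\<sigma> (\<tau> s)) = e * \<tau> s" "s \<noteq> 0"
    using assms unfolding qelts_def by blast
  have "qf s \<sigma> = e" using e(2)[OF aut_id(2)] e(3) by (simp add: qf_def)
  thus "qf s \<sigma> = 1 \<or> qf s \<sigma> = -1" "\<tau> \<in> auts \<Longrightarrow> \<sigma> (\<sigma> (\<tau> s)) = qf s \<sigma> * \<tau> s"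
    "\<sigma> (\<sigma> s) = qf s \<sigma> * s" using e(1,2) e(2)[OF aut_id(2)] by auto
qed

lemma qf_fixed: "s \<in> qelts \<Longrightarrow> \<sigma> \<in> auts \<Longrightarrow> \<tau> \<in> auts \<Longrightarrow> \<tau> (qf s \<sigma>) = qf s \<sigma>"
  using qf_act(1)[of s \<sigma>] by (auto simp: aut_1 aut_minus)

lemma qeltsI:
  assumes "s \<noteq> 0" "\<And>\<sigma>. \<sigma> \<in> auts \<Longrightarrow> e \<sigma> = 1 \<or> e \<sigma> = -1"
    "\<And>\<sigma> \<tau>. \<sigma> \<in> auts \<Longrightarrow> \<tau> \<in> auts \<Longrightarrow> \<sigma> (\<sigma> (\<tau> s)) = e \<sigma> * \<tau> s"
  shows "s \<in> qelts" "\<sigma> \<in> auts \<Longrightarrow> qf s \<sigma> = e \<sigma>"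
proof -
  have "\<exists>e\<in>{1, -1}. \<forall>\<tau>\<in>auts. \<sigma> (\<sigma> (\<tau> s)) = e * \<tau> s" if "\<sigma> \<in> auts" for \<sigma>
    by (rule bexI[of _ "e \<sigma>"]) (use assms(2,3) that in auto)
  thus "s \<in> qelts" using assms(1) unfolding qelts_def by blast
  show "\<sigma> \<in> auts \<Longrightarrow> qf s \<sigma> = e \<sigma>" using assms(3)[OF _ aut_id(2), of \<sigma>] assms(1) by (simp add: qf_def)
qed

lemma qelts_mult:
  assumes "s \<in> qelts" "t \<in> qelts"
  shows "s * t \<in> qelts" "\<sigma> \<in> auts \<Longrightarrow> qf (s * t) \<sigma> = qf s \<sigma> * qf t \<sigma>"
proof -
  have *: "\<sigma> (\<sigma> (\<tau> (s * t))) = (qf s \<sigma> * qf t \<sigma>) * \<tau> (s * t)" if "\<sigma> \<in> auts" "\<tau> \<in> auts" for \<sigma> \<tau>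
    using qf_act(2)[OF assms(1) that] qf_act(2)[OF assms(2) that] that by (simp add: autsD)
  note I = qeltsI[of "s * t" "\<lambda>\<sigma>. qf s \<sigma> * qf t \<sigma>"]
  have "s * t \<noteq> 0" using qelts_nonzero assms by simp
  moreover have "qf s \<sigma> * qf t \<sigma> = 1 \<or> qf s \<sigma> * qf t \<sigma> = -1" if "\<sigma> \<in> auts" for \<sigma>
    using qf_act(1)[OF assms(1) that] qf_act(1)[OF assms(2) that] by auto
  ultimately show "s * t \<in> qelts" "\<sigma> \<in> auts \<Longrightarrow> qf (s * t) \<sigma> = qf s \<sigma> * qf t \<sigma>"
    using I * by blast+
qed

definition multiquad :: "'a set" where
  "multiquad = adj {t. t\<^sup>2 \<in> \<rat>}"

lemma aut_sqrt: "\<sigma> \<in> auts \<Longrightarrow> (t::'a)\<^sup>2 \<in> \<rat> \<Longrightarrow> \<sigma> t = t \<or> \<sigma> t = - t"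
  using aut_rat[of \<sigma> "t\<^sup>2"] by (simp add: aut_power power2_eq_iff)

lemma ratring_multiquad: "ratring multiquad"
  unfolding multiquad_def by (rule ratring_adj)

lemma stable_multiquad: "stable multiquad"
  unfolding multiquad_def
proof (rule stable_adj)
  fix \<sigma> :: "'a \<Rightarrow> 'a" and x :: 'a assume "\<sigma> \<in> auts" "x \<in> {t. t\<^sup>2 \<in> \<rat>}"
  hence "(\<sigma> x)\<^sup>2 \<in> \<rat>" using aut_rat[of \<sigma> "x\<^sup>2"] by (simp add: aut_power)
  thus "\<sigma> x \<in> adj {t. t\<^sup>2 \<in> \<rat>}" by (auto intro: adj.base)
qed

lemma multiquad_involution:
  assumes "x \<in> multiquad" "\<sigma> \<in> auts" shows "\<sigma> (\<sigma> x) = x"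
proof -
  have *: "\<sigma> (\<sigma> t) = id t" if "t \<in> {t. t\<^sup>2 \<in> \<rat>}" for t
    using aut_sqrt[of \<sigma> t] that assms(2) by (auto simp: aut_minus)
  have "\<sigma> (\<sigma> x) = id x"
    by (rule aut_adj_eq[OF aut_comp(2)[OF assms(2,2)] aut_id(1) _ assms(1)[unfolded multiquad_def]]) (rule *)
  thus ?thesis by simp
qed

lemma multiquad_qelts:
  assumes "x \<in> multiquad" "x \<noteq> 0"
  shows "x \<in> qelts" "\<sigma> \<in> auts \<Longrightarrow> qf x \<sigma> = 1"
proof -
  have "\<sigma> (\<sigma> (\<tau> x)) = 1 * \<tau> x" if "\<sigma> \<in> auts" "\<tau> \<in> auts" for \<sigma> \<tau>
    using multiquad_involution[OF stableD[OF stable_multiquad that(2) assms(1)] that(1)] by simp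
  thus "x \<in> qelts" "\<sigma> \<in> auts \<Longrightarrow> qf x \<sigma> = 1"
    using qeltsI[of x "\<lambda>_. 1"] assms(2) by blast+
qed

text \<open>Split y into (y + z y) / 2 and (y - z y) / 2. Since z commutes with the earlier
  involutions, they act on z y with the same signs as on y, hence on both halves.\<close>

lemma eigen_decomposition:
  fixes M :: "'a set"
  assumes M: "ratring M" "stable M" and "finite Z" "Z \<subseteq> auts"
    and inv: "\<And>z x. z \<in> Z \<Longrightarrow> x \<in> M \<Longrightarrow> z (z x) = x"
    and comm: "\<And>z w x. z \<in> Z \<Longrightarrow> w \<in> Z \<Longrightarrow> x \<in> M \<Longrightarrow> z (w x) = w (z x)"
  shows "M \<subseteq> adj {y\<in>M. \<forall>z\<in>Z. z y = y \<or> z y = - y}"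
  using assms(3,4) inv comm
proof (induction Z)
  case empty
  thus ?case by (auto intro: adj.base)
next
  case (insert z Z)
  have "y \<in> adj {y\<in>M. \<forall>w\<in>insert z Z. w y = y \<or> w y = - y}" (is "_ \<in> adj ?E")
    if y: "y \<in> M" "\<forall>w\<in>Z. w y = y \<or> w y = - y" for y
  proof -
    have z: "z \<in> auts" "z (z y) = y" "z y \<in> M"
      using insert.prems y M(2) by (auto simp: stableD)
    have e: "w (z y) = z y \<and> w y = y \<or> w (z y) = - z y \<and> w y = - y" if "w \<in> Z" for w
      using insert.prems(3)[of w z y] y that z(1) by (auto simp: aut_minus)
    have "y + z y \<in> ?E"
      using e insert.prems(1) z y ratring_add[OF M(1)] by (fastforce simp: autsD add.commute)
    moreover have "y - z y \<in> ?E"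
      using e insert.prems(1) z y ratring_diff[OF M(1)] by (fastforce simp: aut_diff)
    ultimately have "(1/2) * (y + z y) + (1/2) * (y - z y) \<in> adj ?E"
      by (intro adj.add adj.mult adj.rat[of "1/2"] adj.base) auto
    thus ?thesis by (simp add: field_simps)
  qed
  hence "adj {y\<in>M. \<forall>z\<in>Z. z y = y \<or> z y = - y} \<subseteq> adj {y\<in>M. \<forall>w\<in>insert z Z. w y = y \<or> w y = - y}"
    by (intro adj_least[OF ratring_adj]) auto
  moreover have "M \<subseteq> adj {y\<in>M. \<forall>z\<in>Z. z y = y \<or> z y = - y}"
    by (rule insert.IH) (use insert.prems in auto)
  ultimately show ?case by blast
qed

text \<open>Splitting into eigenspaces proceeds by induction over a finite set, so the automorphisms
  are replaced by representatives of their restrictions to M.\<close>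

lemma finite_representatives:
  assumes "finite ((\<lambda>\<sigma>. restrict \<sigma> M) ` auts)"
  obtains Z where "finite Z" "Z \<subseteq> auts" "\<And>\<sigma>. \<sigma> \<in> auts \<Longrightarrow> \<exists>z\<in>Z. \<forall>x\<in>M. \<sigma> x = z x"
proof -
  obtain Z where Z: "Z \<subseteq> auts" "finite Z" "(\<lambda>\<sigma>. restrict \<sigma> M) ` auts = (\<lambda>\<sigma>. restrict \<sigma> M) ` Z"
    using finite_subset_image[OF assms order_refl] by blast
  have "\<exists>z\<in>Z. \<forall>x\<in>M. \<sigma> x = z x" if "\<sigma> \<in> auts" for \<sigma>
  proof -
    have "restrict \<sigma> M \<in> (\<lambda>\<sigma>. restrict \<sigma> M) ` Z" using that Z(3) by blast
    then obtain z where "z \<in> Z" "restrict \<sigma> M = restrict z M" by blast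
    thus ?thesis by (metis restrict_apply')
  qed
  thus ?thesis using that Z by blast
qed

lemma finite_restrictions:
  assumes "finite A"
  shows "finite ((\<lambda>\<sigma>. restrict \<sigma> A) ` (auts :: ('a \<Rightarrow> 'a) set))"
proof (rule finite_subset)
  show "(\<lambda>\<sigma>. restrict \<sigma> A) ` auts \<subseteq> (\<Pi>\<^sub>E x\<in>A. orbit x)" by (auto simp: orbit_def)
  show "finite (\<Pi>\<^sub>E x\<in>A. orbit (x::'a))" by (intro finite_PiE assms finite_orbit alg)
qed

text \<open>The automorphisms induce commuting involutions on the normal field generated by x. Their
  common eigenvectors are changed at most by a sign by any automorphism, so their squares are
  rational.\<close>

lemma multiquadI:
  assumes "\<And>\<sigma> \<tau>. \<sigma> \<in> auts \<Longrightarrow> \<tau> \<in> auts \<Longrightarrow> \<sigma> (\<sigma> (\<tau> x)) = \<tau> x"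
  shows "x \<in> multiquad"
proof -
  define M where "M = adj (orbit x)"
  have M: "ratring M" "stable M" unfolding M_def
    by (rule ratring_adj, rule stable_adj, auto intro: aut_orbit adj.base)
  have inv: "\<sigma> (\<sigma> y) = y" if "\<sigma> \<in> auts" "y \<in> M" for \<sigma> y
    using aut_adj_eq[OF aut_comp(2)[OF that(1,1)] aut_id(2), of "orbit x" y] assms that
    by (auto simp: M_def orbit_def)
  have comm: "\<sigma> (\<tau> y) = \<tau> (\<sigma> y)" if "\<sigma> \<in> auts" "\<tau> \<in> auts" "y \<in> M" for \<sigma> \<tau> y
  proof -
    \<comment> \<open>In a group of exponent two, (\<sigma> \<tau>)^2 = 1 forces \<sigma> and \<tau>
      to commute.\<close>
    have "\<sigma> (\<tau> (\<sigma> (\<tau> y))) = y" using inv[OF aut_comp(2)[OF that(1,2)] that(3)] by simp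
    moreover have "\<tau> (\<sigma> (\<tau> y)) \<in> M" "\<sigma> (\<tau> y) \<in> M" using that by (auto intro: stableD[OF M(2)])
    ultimately show ?thesis using inv[of \<sigma>] inv[of \<tau>] that by metis
  qed
  obtain Z where Z: "finite Z" "Z \<subseteq> auts" "\<And>\<sigma>. \<sigma> \<in> auts \<Longrightarrow> \<exists>z\<in>Z. \<forall>y\<in>orbit x. \<sigma> y = z y"
    using finite_representatives[OF finite_restrictions[OF finite_orbit[OF alg]]] by blast
  have "y \<in> multiquad" if "y \<in> M" "\<forall>z\<in>Z. z y = y \<or> z y = - y" for y
  proof -
    have "\<sigma> (y\<^sup>2) = y\<^sup>2" if "\<sigma> \<in> auts" for \<sigma>
    proof -
      obtain z where z: "z \<in> Z" "\<forall>y\<in>orbit x. \<sigma> y = z y" using Z(3)[OF \<open>\<sigma> \<in> auts\<close>] by blast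
      have "\<sigma> y = z y" using aut_adj_eq[of \<sigma> z "orbit x" y] z Z(2) \<open>\<sigma> \<in> auts\<close> \<open>y \<in> M\<close> by (auto simp: M_def)
      hence "\<sigma> y = y \<or> \<sigma> y = - y" using z(1) \<open>\<forall>z\<in>Z. z y = y \<or> z y = - y\<close> by auto
      thus ?thesis using \<open>\<sigma> \<in> auts\<close> by (auto simp: aut_power)
    qed
    hence "y\<^sup>2 \<in> \<rat>" by (rule fixed_rat)
    thus ?thesis unfolding multiquad_def by (auto intro: adj.base)
  qed
  hence "adj {y\<in>M. \<forall>z\<in>Z. z y = y \<or> z y = - y} \<subseteq> multiquad"
    by (intro adj_least[OF ratring_multiquad]) auto
  moreover have "x \<in> M" by (auto simp: M_def intro: adj.base orbit_self)
  moreover have "M \<subseteq> adj {y\<in>M. \<forall>z\<in>Z. z y = y \<or> z y = - y}"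
  proof (rule eigen_decomposition[OF M Z(1,2)])
    show "z (z y) = y" if "z \<in> Z" "y \<in> M" for z y using inv that Z(2) by blast
    show "z (w y) = w (z y)" if "z \<in> Z" "w \<in> Z" "y \<in> M" for z w y
      by (rule comm) (use that Z(2) in auto)
  qed
  ultimately show ?thesis by blast
qed

lemma qf_trivial_multiquad:
  assumes "s \<in> qelts" "\<And>\<sigma>. \<sigma> \<in> auts \<Longrightarrow> qf s \<sigma> = 1"
  shows "s \<in> multiquad"
  by (rule multiquadI) (simp add: qf_act(2)[OF assms(1)] assms(2))

text \<open>Numerator and denominator are conjugates of s, so \<sigma>^2 multiplies both by the same
  sign.\<close>

lemma qelts_ratio_multiquad:
  assumes "s \<in> qelts" "\<tau> \<in> auts" shows "\<tau> s / s \<in> multiquad"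
proof (rule multiquadI)
  fix \<sigma> \<rho> :: "'a \<Rightarrow> 'a" assume *: "\<sigma> \<in> auts" "\<rho> \<in> auts"
  have "\<rho> s \<noteq> 0" using qelts_nonzero[OF assms(1)] * by (simp add: aut_eq_0)
  moreover have "qf s \<sigma> \<noteq> 0" using qf_act(1)[OF assms(1) *(1)] by auto
  ultimately show "\<sigma> (\<sigma> (\<rho> (\<tau> s / s))) = \<rho> (\<tau> s / s)"
    using * assms qf_act(2)[OF assms(1) *(1) *(2)] qf_act(2)[OF assms(1) *(1) aut_comp(2)[OF *(2) assms(2)]]
    by (simp add: aut_divide)
qed

lemma qelts_square_multiquad:
  assumes "s \<in> qelts" shows "s\<^sup>2 \<in> multiquad"
proof (rule multiquadI)
  fix \<sigma> \<tau> :: "'a \<Rightarrow> 'a" assume *: "\<sigma> \<in> auts" "\<tau> \<in> auts"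
  have "\<sigma> (\<sigma> (\<tau> (s\<^sup>2))) = (\<sigma> (\<sigma> (\<tau> s)))\<^sup>2" using * by (simp add: aut_power)
  also have "\<dots> = \<tau> (s\<^sup>2)"
    using qf_act(1)[OF assms *(1)] * by (auto simp: qf_act(2)[OF assms *] aut_power)
  finally show "\<sigma> (\<sigma> (\<tau> (s\<^sup>2))) = \<tau> (s\<^sup>2)" .
qed

text \<open>By \<open>four\<close> and \<open>central\<close> the squares of representatives are
  commuting involutions on M, so their common eigenvectors generate M. Centrality carries the sign
  from an eigenvector to all its conjugates, as \<open>qelts\<close> demands.\<close>

lemma generated_by_qelts:
  fixes M :: "'a set"
  assumes M: "ratring M" "stable M" and fin: "finite ((\<lambda>\<sigma>. restrict \<sigma> M) ` auts)"
    and four: "\<And>\<sigma> x. \<sigma> \<in> auts \<Longrightarrow> x \<in> M \<Longrightarrow> \<sigma> (\<sigma> (\<sigma> (\<sigma> x))) = x"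
    and central: "\<And>\<sigma> \<tau> x. \<sigma> \<in> auts \<Longrightarrow> \<tau> \<in> auts \<Longrightarrow> x \<in> M \<Longrightarrow> \<sigma> (\<sigma> (\<tau> x)) = \<tau> (\<sigma> (\<sigma> x))"
  shows "M \<subseteq> adj (qelts \<inter> M)"
proof -
  obtain Z where Z: "finite Z" "Z \<subseteq> auts" "\<And>\<sigma>. \<sigma> \<in> auts \<Longrightarrow> \<exists>z\<in>Z. \<forall>x\<in>M. \<sigma> x = z x"
    using finite_representatives[OF fin] by blast
  define W where "W = (\<lambda>z x. z (z x)) ` Z"
  have W: "finite W" "W \<subseteq> auts" using Z by (auto simp: W_def intro: aut_comp(2))
  have "M \<subseteq> adj {y\<in>M. \<forall>w\<in>W. w y = y \<or> w y = - y}"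
  proof (rule eigen_decomposition[OF M W])
    show "z (z x) = x" if "z \<in> W" "x \<in> M" for z x
      using that four Z(2) by (auto simp: W_def)
    show "z (w x) = w (z x)" if "z \<in> W" "w \<in> W" "x \<in> M" for z w x
    proof -
      obtain u where u: "u \<in> auts" "z = (\<lambda>x. u (u x))" using \<open>z \<in> W\<close> Z(2) by (auto simp: W_def)
      thus ?thesis using central[OF u(1) _ that(3), of w] W(2) that(2) by auto
    qed
  qed
  moreover have "y \<in> adj (qelts \<inter> M)" if y: "y \<in> M" "\<forall>w\<in>W. w y = y \<or> w y = - y" for y
  proof (cases "y = 0")
    case False
    have "\<exists>e\<in>{1, -1}. \<forall>\<tau>\<in>auts. \<sigma> (\<sigma> (\<tau> y)) = e * \<tau> y" if \<sigma>: "\<sigma> \<in> auts" for \<sigma>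
    proof -
      obtain z where z: "z \<in> Z" "\<forall>x\<in>M. \<sigma> x = z x" using Z(3)[OF \<sigma>] by blast
      have "\<sigma> (\<sigma> y) = z (z y)" using z(2) y(1) stableD[OF M(2)] \<sigma> by metis
      hence "\<sigma> (\<sigma> y) = 1 * y \<or> \<sigma> (\<sigma> y) = -1 * y" using y(2) z(1) by (auto simp: W_def)
      then obtain e where e: "e \<in> {1, -1}" "\<sigma> (\<sigma> y) = e * y" by blast
      have "\<sigma> (\<sigma> (\<tau> y)) = e * \<tau> y" if "\<tau> \<in> auts" for \<tau>
        using central[OF \<sigma> that y(1)] e that by (auto simp: aut_minus)
      thus ?thesis using e(1) by blast
    qed
    thus ?thesis using False y(1) by (intro adj.base) (simp add: qelts_def)
  qed (auto intro: adj.rat)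
  hence "adj {y\<in>M. \<forall>w\<in>W. w y = y \<or> w y = - y} \<subseteq> adj (qelts \<inter> M)"
    by (intro adj_least[OF ratring_adj]) auto
  ultimately show ?thesis by blast
qed

end

section \<open>Multiquadratic fields\<close>

lemma adj_insert_sqrt:
  assumes "r\<^sup>2 \<in> \<rat>" "x \<in> adj (insert r A)"
  obtains a b where "a \<in> adj A" "b \<in> adj A" "x = a + b * r"
proof -
  have "\<exists>a\<in>adj A. \<exists>b\<in>adj A. x = a + b * r"
    using assms(2)
  proof induction
    case (rat q)
    thus ?case by (intro bexI[of _ q] bexI[of _ 0]) (auto intro: adj.rat)
  next
    case (base x)
    show ?case
    proof (cases "x = r")
      case True
      thus ?thesis by (intro bexI[of _ 0] bexI[of _ 1]) (auto intro: adj.rat)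
    next
      case False
      thus ?thesis using base by (intro bexI[of _ x] bexI[of _ 0]) (auto intro: adj.base adj.rat)
    qed
  next
    case (add x y)
    then obtain a b c d where "a \<in> adj A" "b \<in> adj A" "c \<in> adj A" "d \<in> adj A"
      "x = a + b * r" "y = c + d * r" by blast
    thus ?case by (intro bexI[of _ "a + c"] bexI[of _ "b + d"]) (auto intro: adj.add simp: algebra_simps)
  next
    case (mult x y)
    then obtain a b c d where "a \<in> adj A" "b \<in> adj A" "c \<in> adj A" "d \<in> adj A"
      "x = a + b * r" "y = c + d * r" by blast
    moreover have "(a + b * r) * (c + d * r) = (a * c + b * d * r\<^sup>2) + (a * d + b * c) * r"
      by (simp add: algebra_simps power2_eq_square)
    ultimately show ?case by (intro bexI[of _ "a * c + b * d * r\<^sup>2"] bexI[of _ "a * d + b * c"])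
      (auto intro!: adj.add adj.mult adj.rat[OF assms(1)])
  qed
  thus ?thesis using that by blast
qed

text \<open>A prime q in I divides the product of I exactly once, so the q-adic valuations of the
  two sides differ in parity. Without a prime, I is {-1} and a^2 + b^2 = 0.\<close>

lemma prod_distinct_primes_not_square:
  fixes I :: "int set" and a b :: int
  assumes "finite I" "I \<noteq> {}" "\<And>d. d \<in> I \<Longrightarrow> d = -1 \<or> prime d" "b \<noteq> 0" "a\<^sup>2 = \<Prod>I * b\<^sup>2"
  shows False
proof (cases "\<exists>q\<in>I. prime q")
  case True
  then obtain q where q: "q \<in> I" "prime q" by blast
  have I0: "\<Prod>I \<noteq> 0" using assms(1) assms(3)[of 0] by (auto simp: prod_zero_iff)
  have split: "\<Prod>I = q * \<Prod>(I - {q})" using assms(1) q(1) by (simp add: prod.remove)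
  have "\<not> q dvd \<Prod>(I - {q})"
  proof
    assume "q dvd \<Prod>(I - {q})"
    then obtain d where d: "d \<in> I - {q}" "q dvd d" using prime_dvd_prod_iff[of "I - {q}" q id] q(2) assms(1) by auto
    hence "d = -1 \<or> prime d" using assms(3) by blast
    thus False using d q(2) by (auto dest: primes_dvd_imp_eq)
  qed
  hence "multiplicity q (\<Prod>(I - {q})) = 0" by (rule not_dvd_imp_multiplicity_0)
  hence m1: "multiplicity q (\<Prod>I) = 1"
    using q(2) I0 unfolding split by (subst prime_elem_multiplicity_mult_distrib) auto
  have a0: "a \<noteq> 0" using assms(4,5) I0 by auto
  have "2 * multiplicity q a = multiplicity q (a\<^sup>2)"
    using prime_elem_multiplicity_power_distrib[OF prime_imp_prime_elem[OF q(2)] a0, of 2] by simp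
  also have "\<dots> = 1 + 2 * multiplicity q b"
    unfolding assms(5) using I0 assms(4) m1 prime_imp_prime_elem[OF q(2)]
    by (simp add: prime_elem_multiplicity_mult_distrib prime_elem_multiplicity_power_distrib)
  finally show False by presburger
next
  case False
  hence "I = {-1}" using assms(2,3) by blast
  hence "a\<^sup>2 + b\<^sup>2 = 0" using assms(5) by simp
  thus False using assms(4) by (simp add: sum_power2_eq_zero_iff)
qed

text \<open>The bound is strict, so that removing the prime p is the step from
  \<open>gens (Suc p)\<close> to \<open>gens p\<close>. The generator -1 remains even at level 0,
  where the real place takes over.\<close>

definition gens :: "nat \<Rightarrow> int set" where
  "gens n = insert (-1) (int ` {p. prime p \<and> p < n})"

lemma finite_gens: "finite (gens n)"
  by (simp add: gens_def)

lemma gens_mono: "m \<le> n \<Longrightarrow> gens m \<subseteq> gens n"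
  by (auto simp: gens_def)

lemma gens_Suc: "gens (Suc n) = (if prime n then insert (int n) (gens n) else gens n)"
  by (auto simp: gens_def less_Suc_eq)

definition basic :: "int set \<Rightarrow> bool" where
  "basic D \<longleftrightarrow> finite D \<and> (\<forall>d\<in>D. d = -1 \<or> prime d)"

lemma basic_gens: "basic (gens n)"
  unfolding basic_def by (intro conjI finite_gens) (auto simp: gens_def)

lemma basic_subset: "basic D \<Longrightarrow> I \<subseteq> D \<Longrightarrow> basic I"
  unfolding basic_def using finite_subset[of I D] by blast

lemma basicD: "basic D \<Longrightarrow> d \<in> D \<Longrightarrow> d = -1 \<or> prime d"
  unfolding basic_def by blast

lemma basic_finite: "basic D \<Longrightarrow> finite D"
  unfolding basic_def by blast

lemma basic_nonzero: "basic D \<Longrightarrow> d \<in> D \<Longrightarrow> d \<noteq> 0"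
  using basicD[of D d] not_prime_0 by (metis neg_equal_0_iff_equal zero_neq_one)

lemma basic_prod_nonzero: "basic D \<Longrightarrow> \<Prod>D \<noteq> 0"
  using basic_nonzero[of D] basic_finite[of D] by (simp add: prod_zero_iff)

text \<open>Says that f factors through restriction to L, in place of a function on the Galois group
  of L.\<close>

definition depends_on :: "'a set \<Rightarrow> (('a \<Rightarrow> 'a) \<Rightarrow> 'b) \<Rightarrow> ('a \<Rightarrow> 'a) set \<Rightarrow> bool" where
  "depends_on L f A \<longleftrightarrow> (\<forall>\<sigma>\<in>A. \<forall>\<tau>\<in>A. (\<forall>x\<in>L. \<sigma> x = \<tau> x) \<longrightarrow> f \<sigma> = f \<tau>)"

lemma depends_onD:
  "depends_on L f A \<Longrightarrow> \<sigma> \<in> A \<Longrightarrow> \<tau> \<in> A \<Longrightarrow> (\<And>x. x \<in> L \<Longrightarrow> \<sigma> x = \<tau> x) \<Longrightarrow> f \<sigma> = f \<tau>"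
  unfolding depends_on_def by blast

lemma depends_on_mono: "depends_on L f A \<Longrightarrow> L \<subseteq> L' \<Longrightarrow> depends_on L' f A"
  unfolding depends_on_def by blast

lemma depends_on_mult:
  "depends_on L f A \<Longrightarrow> depends_on L g A \<Longrightarrow> depends_on L (\<lambda>\<sigma>. f \<sigma> * g \<sigma>) A"
  unfolding depends_on_def by metis

section \<open>Quadratic characters and independence of square roots\<close>

context algebraic_numbers
begin

definition rt :: "'a \<Rightarrow> 'a" where
  "rt a = (SOME r. r\<^sup>2 = a)"

lemma rt_square: "(rt a)\<^sup>2 = a"
proof -
  have "degree [:- a, 0, 1:] > 0" by simp
  then obtain r where "poly [:- a, 0, 1:] r = 0" using alg_closed_imp_poly_has_root by blast
  hence "r\<^sup>2 = a" by (simp add: power2_eq_square)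
  thus ?thesis unfolding rt_def by (rule someI)
qed

lemma rt_eq_0: "rt a = 0 \<longleftrightarrow> a = 0"
  by (metis rt_square power_zero_numeral zero_eq_power2)

definition chi :: "'a \<Rightarrow> ('a \<Rightarrow> 'a) \<Rightarrow> 'a" where
  "chi a \<sigma> = \<sigma> (rt a) / rt a"

lemma chi_act:
  assumes "\<sigma> \<in> auts" "a \<in> \<rat>" "a \<noteq> 0"
  shows "\<sigma> (rt a) = chi a \<sigma> * rt a" "chi a \<sigma> = 1 \<or> chi a \<sigma> = -1" "t\<^sup>2 = a \<Longrightarrow> \<sigma> t = chi a \<sigma> * t"
proof -
  show 1: "\<sigma> (rt a) = chi a \<sigma> * rt a" using assms(3) by (simp add: chi_def rt_eq_0)
  show "chi a \<sigma> = 1 \<or> chi a \<sigma> = -1"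
    using aut_sqrt[OF assms(1), of "rt a"] assms(2,3) by (auto simp: chi_def rt_square rt_eq_0)
  assume "t\<^sup>2 = a"
  hence "t = rt a \<or> t = - rt a" by (metis power2_eq_iff rt_square)
  thus "\<sigma> t = chi a \<sigma> * t" using 1 assms(1) by (auto simp: aut_minus)
qed

lemma chi_eqI: "\<sigma> \<in> auts \<Longrightarrow> a \<in> \<rat> \<Longrightarrow> t\<^sup>2 = a \<Longrightarrow> t \<noteq> 0 \<Longrightarrow> \<sigma> t = e * t \<Longrightarrow> chi a \<sigma> = e"
  using chi_act(3)[of \<sigma> a t] by auto

lemma chi_mult:
  assumes "\<sigma> \<in> auts" "a \<in> \<rat>" "b \<in> \<rat>" "a \<noteq> 0" "b \<noteq> 0"
  shows "chi (a * b) \<sigma> = chi a \<sigma> * chi b \<sigma>"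
  by (rule chi_eqI[of \<sigma> _ "rt a * rt b"])
    (use assms in \<open>auto simp: power_mult_distrib rt_square rt_eq_0 autsD chi_act(1)\<close>)

lemma chi_square:
  assumes "\<sigma> \<in> auts" "r \<in> \<rat>" "r \<noteq> 0" shows "chi (r\<^sup>2) \<sigma> = 1"
  by (rule chi_eqI[of \<sigma> _ r]) (use assms in \<open>auto simp: aut_rat\<close>)

lemma chi_1: "\<sigma> \<in> auts \<Longrightarrow> chi 1 \<sigma> = 1"
  using chi_square[of \<sigma> 1] by simp

lemma chi_self: "\<sigma> \<in> auts \<Longrightarrow> a \<in> \<rat> \<Longrightarrow> a \<noteq> 0 \<Longrightarrow> chi a \<sigma> * chi a \<sigma> = 1"
  using chi_act(2)[of \<sigma> a] by auto

lemma chi_comp: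
  assumes "\<sigma> \<in> auts" "\<tau> \<in> auts" "a \<in> \<rat>" "a \<noteq> 0"
  shows "chi a (\<sigma> \<circ> \<tau>) = chi a \<sigma> * chi a \<tau>"
proof (rule chi_eqI[of _ _ "rt a"])
  have "\<sigma> (chi a \<tau>) = chi a \<tau>" using chi_act(2)[OF assms(2-4)] assms(1) by (auto simp: aut_simps)
  thus "(\<sigma> \<circ> \<tau>) (rt a) = chi a \<sigma> * chi a \<tau> * rt a"
    using assms by (simp add: chi_act(1) autsD)
qed (use assms in \<open>auto simp: aut_comp rt_square rt_eq_0\<close>)

lemma chi_eq_1_iff: "a \<noteq> 0 \<Longrightarrow> chi a \<sigma> = 1 \<longleftrightarrow> \<sigma> (rt a) = rt a"
  by (simp add: chi_def rt_eq_0)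

lemma chi_eq_chi_iff: "a \<noteq> 0 \<Longrightarrow> chi a \<sigma> = chi a \<tau> \<longleftrightarrow> \<sigma> (rt a) = \<tau> (rt a)"
  by (simp add: chi_def rt_eq_0)

text \<open>The product of the quadratic characters of \<open>a\<close> and \<open>b\<close> (as a quadratic form over the field
  with two elements), written with values \<open>\<plusminus>1\<close>.\<close>

definition hilb :: "'a \<Rightarrow> 'a \<Rightarrow> ('a \<Rightarrow> 'a) \<Rightarrow> 'a" where
  "hilb a b \<sigma> = (if chi a \<sigma> = -1 \<and> chi b \<sigma> = -1 then -1 else 1)"

lemma hilb_commute: "hilb a b \<sigma> = hilb b a \<sigma>"
  by (simp add: hilb_def conj_commute)

lemma hilb_mult_right:
  assumes "\<sigma> \<in> auts" "b \<in> \<rat>" "c \<in> \<rat>" "b \<noteq> 0" "c \<noteq> 0"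
  shows "hilb a (b * c) \<sigma> = hilb a b \<sigma> * hilb a c \<sigma>"
  using chi_act(2)[of \<sigma> b] chi_act(2)[of \<sigma> c] chi_mult[OF assms] assms by (auto simp: hilb_def)

lemma hilb_square: "\<sigma> \<in> auts \<Longrightarrow> r \<in> \<rat> \<Longrightarrow> r \<noteq> 0 \<Longrightarrow> hilb a (r\<^sup>2) \<sigma> = 1"
  by (simp add: hilb_def chi_square)

lemma hilb_self_mult: "hilb a b \<sigma> * hilb a b \<sigma> = 1"
  by (simp add: hilb_def)

definition adjroots :: "int set \<Rightarrow> 'a set" where
  "adjroots D = adj ((\<lambda>d. rt (of_int d)) ` D)"

lemma ratring_adjroots: "ratring (adjroots D)"
  by (simp add: adjroots_def ratring_adj)

lemma adjroots_mono: "D \<subseteq> D' \<Longrightarrow> adjroots D \<subseteq> adjroots D'"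
  unfolding adjroots_def by (intro adj_mono image_mono)

lemma rt_adjroots: "d \<in> D \<Longrightarrow> rt (of_int d) \<in> adjroots D"
  unfolding adjroots_def by (intro adj.base) auto

lemma stable_adjroots: "stable (adjroots D)"
  unfolding adjroots_def
proof (rule stable_adj)
  fix \<sigma> :: "'a \<Rightarrow> 'a" and x :: 'a assume *: "\<sigma> \<in> auts" "x \<in> (\<lambda>d. rt (of_int d)) ` D"
  hence "\<sigma> x = x \<or> \<sigma> x = - x" by (intro aut_sqrt) (auto simp: rt_square)
  thus "\<sigma> x \<in> adj ((\<lambda>d. rt (of_int d)) ` D)"
    using * ratring_minus[OF ratring_adj, of x] adj.base[of x] by auto
qed

lemma adjroots_multiquad: "adjroots D \<subseteq> multiquad"
  unfolding adjroots_def multiquad_def by (rule adj_mono) (auto simp: rt_square)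

lemma agree_adjroots:
  assumes "\<sigma> \<in> auts" "\<tau> \<in> auts" "\<And>d. d \<in> D \<Longrightarrow> \<sigma> (rt (of_int d)) = \<tau> (rt (of_int d))" "x \<in> adjroots D"
  shows "\<sigma> x = \<tau> x"
  using aut_adj_eq[OF assms(1,2) _ assms(4)[unfolded adjroots_def]] assms(3) by blast

lemma adjroots_insert:
  assumes "x \<in> adjroots (insert d D)"
  obtains a b where "a \<in> adjroots D" "b \<in> adjroots D" "x = a + b * rt (of_int d)"
  using adj_insert_sqrt[of "rt (of_int d)" x "(\<lambda>d. rt (of_int d)) ` D"] assms
  by (auto simp: adjroots_def rt_square)

lemma adjroots_insert_absorb:
  assumes "rt (of_int d) \<in> adjroots D" shows "adjroots (insert d D) = adjroots D"
proof
  have "(\<lambda>d. rt (of_int d)) ` insert d D \<subseteq> adjroots D" using assms rt_adjroots[of _ D] by auto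
  thus "adjroots (insert d D) \<subseteq> adjroots D"
    unfolding adjroots_def[of "insert d D"] by (intro adj_least[OF ratring_adjroots])
qed (rule adjroots_mono[OF subset_insertI])

lemma adjroots_empty: "x \<in> adjroots {} \<Longrightarrow> x \<in> \<rat>"
  using subsetD[OF adj_least[of \<rat> "{}"], of x] by (simp add: adjroots_def ratring_def)

text \<open>Kummer theory of exponent two. Write t = a + b sqrt d: rationality of t^2 forces a b =
  0, for otherwise sqrt d would lie in the smaller field. Then t = a or t = b sqrt d, and the
  induction hypothesis applies to a or b.\<close>

lemma kummer_multiquadratic:
  assumes "finite D" "0 \<notin> D" "t \<in> adjroots D" "t\<^sup>2 \<in> \<rat>"
  shows "\<exists>I\<subseteq>D. \<exists>r\<in>\<rat>. t\<^sup>2 * of_int (\<Prod>I) = r\<^sup>2"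
  using assms
proof (induction D arbitrary: t)
  case empty
  hence "t \<in> \<rat>" by (intro adjroots_empty)
  thus ?case by (intro exI[of _ "{}"] conjI bexI[of _ t]) auto
next
  case (insert d D)
  show ?case
  proof (cases "rt (of_int d) \<in> adjroots D")
    case True
    hence "t \<in> adjroots D" using insert.prems adjroots_insert_absorb by simp
    thus ?thesis using insert.IH[of t] insert.prems by blast
  next
    case False
    let ?r = "rt (of_int d)"
    obtain a b where ab: "a \<in> adjroots D" "b \<in> adjroots D" "t = a + b * ?r"
      using adjroots_insert insert.prems(2) by blast
    have eq: "t\<^sup>2 = a\<^sup>2 + b\<^sup>2 * of_int d + 2 * a * b * ?r"
      using rt_square[of "of_int d"] unfolding ab(3) by (simp add: power2_eq_square algebra_simps)
    have "a * b = 0"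
    proof (rule ccontr)
      assume "a * b \<noteq> 0"
      hence "?r = (t\<^sup>2 - (a\<^sup>2 + b\<^sup>2 * of_int d)) / (2 * a * b)" using eq by (simp add: field_simps)
      also have "\<dots> \<in> adjroots D"
      proof -
        have "t\<^sup>2 \<in> adjroots D" "of_int d \<in> adjroots D" "2 \<in> adjroots D"
          using insert.prems(3) by (auto intro: ratring_rat[OF ratring_adjroots])
        moreover have "a\<^sup>2 \<in> adjroots D" "b\<^sup>2 \<in> adjroots D"
          using ab(1,2) ratring_power[OF ratring_adjroots] by auto
        ultimately show ?thesis using ab(1,2)
          by (intro ratring_divide ratring_diff ratring_add ratring_mult ratring_adjroots alg)
      qed
      finally show False using False by simp
    qed
    hence "a = 0 \<or> b = 0" by simp
    thus ?thesis
    proof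
      assume "b = 0"
      hence "t \<in> adjroots D" using ab by simp
      thus ?thesis using insert.IH[of t] insert.prems by blast
    next
      assume a0: "a = 0"
      have bd: "t\<^sup>2 = b\<^sup>2 * of_int d" using eq a0 by simp
      have d0: "d \<noteq> 0" using insert.prems(1) by auto
      have "b\<^sup>2 = t\<^sup>2 / of_int d" using bd d0 by simp
      hence "b\<^sup>2 \<in> \<rat>" using insert.prems(3) by (metis Rats_divide Rats_of_int)
      then obtain I r where I: "I \<subseteq> D" "r \<in> \<rat>" "b\<^sup>2 * of_int (\<Prod>I) = r\<^sup>2"
        using insert.IH[of b] ab(2) insert.prems(1) by auto
      have "\<Prod>(insert d I) = d * \<Prod>I"
        using I(1) insert.hyps finite_subset by (subst prod.insert) auto
      hence "t\<^sup>2 * of_int (\<Prod>(insert d I)) = (of_int d * r)\<^sup>2"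
        using bd I(3) by (simp add: power_mult_distrib power2_eq_square mult_ac)
      moreover have "of_int d * r \<in> \<rat>" using I(2) by simp
      ultimately show ?thesis using I(1) by (intro exI[of _ "insert d I"]) auto
    qed
  qed
qed

lemma rt_not_in_adjroots:
  assumes "basic (insert p D)" "p \<notin> D"
  shows "rt (of_int p) \<notin> adjroots D"
proof
  assume "rt (of_int p) \<in> adjroots D"
  moreover have "finite D" "0 \<notin> D"
    using basic_finite[OF assms(1)] basic_nonzero[OF assms(1), of 0] by auto
  ultimately obtain I r where I: "I \<subseteq> D" "r \<in> \<rat>" "(of_int p :: 'a) * of_int (\<Prod>I) = r\<^sup>2"
    using kummer_multiquadratic[of D "rt (of_int p)"] by (auto simp: rt_square)
  obtain a b where ab: "b \<noteq> 0" "r = of_int a / of_int b" using I(2) by (metis Rats_cases' less_irrefl)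
  have "\<Prod>(insert p I) = p * \<Prod>I"
    using I(1) assms \<open>finite D\<close> finite_subset by (subst prod.insert) auto
  hence "of_int (\<Prod>(insert p I) * b\<^sup>2) = (of_int (a\<^sup>2) :: 'a)"
    using I(3) ab by (simp add: field_simps)
  hence eq: "a\<^sup>2 = \<Prod>(insert p I) * b\<^sup>2" by (simp only: of_int_eq_iff)
  have B: "basic (insert p I)" by (rule basic_subset[OF assms(1)]) (use I(1) in blast)
  show False
    by (rule prod_distinct_primes_not_square[OF basic_finite[OF B] _ basicD[OF B] ab(1) eq]) auto
qed

lemma aut_flip:
  assumes "basic (insert p D)" "p \<notin> D"
  obtains \<tau> where "\<tau> \<in> auts" "\<And>x. x \<in> adjroots D \<Longrightarrow> \<tau> x = x" "\<tau> (rt (of_int p)) = - rt (of_int p)"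
proof -
  obtain \<tau> where \<tau>: "\<tau> \<in> auts" "\<And>x. x \<in> adjroots D \<Longrightarrow> \<tau> x = x" "\<tau> (rt (of_int p)) \<noteq> rt (of_int p)"
    using exists_automorphism_moving[OF ratring_adjroots alg rt_not_in_adjroots[OF assms]] by metis
  thus ?thesis using that aut_sqrt[OF \<tau>(1), of "rt (of_int p)"] by (auto simp: rt_square)
qed

text \<open>Each new square root can be flipped without disturbing the earlier ones. With Legendre
  symbols as signs this will supply the Frobenius automorphism.\<close>

lemma aut_with_signs:
  assumes "basic D" "\<And>d. d \<in> D \<Longrightarrow> e d = 1 \<or> e d = (-1 :: 'a)"
  shows "\<exists>\<phi>\<in>auts. \<forall>d\<in>D. \<phi> (rt (of_int d)) = e d * rt (of_int d)"
proof -
  have "finite D" using assms(1) by (rule basic_finite)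
  thus ?thesis using assms
  proof (induction D)
    case empty
    thus ?case using aut_id by blast
  next
    case (insert p D)
    obtain \<phi> where \<phi>: "\<phi> \<in> auts" "\<And>d. d \<in> D \<Longrightarrow> \<phi> (rt (of_int d)) = e d * rt (of_int d)"
      using insert.IH insert.prems basic_subset[of "insert p D" D] by blast
    show ?case
    proof (cases "\<phi> (rt (of_int p)) = e p * rt (of_int p)")
      case True
      thus ?thesis using \<phi> by blast
    next
      case False
      obtain \<tau> where \<tau>: "\<tau> \<in> auts" "\<And>x. x \<in> adjroots D \<Longrightarrow> \<tau> x = x" "\<tau> (rt (of_int p)) = - rt (of_int p)"
        using aut_flip insert.prems(1) insert.hyps(2) by blast
      have "\<phi> (rt (of_int p)) = rt (of_int p) \<or> \<phi> (rt (of_int p)) = - rt (of_int p)"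
        by (rule aut_sqrt[OF \<phi>(1)]) (simp add: rt_square)
      hence "\<phi> (rt (of_int p)) = - e p * rt (of_int p)"
        using insert.prems(2)[of p] False by auto
      hence "(\<phi> \<circ> \<tau>) (rt (of_int d)) = e d * rt (of_int d)" if "d \<in> insert p D" for d
        using that \<phi> \<tau> rt_adjroots[of _ D] by (auto simp: aut_minus)
      thus ?thesis using aut_comp(1)[OF \<phi>(1) \<tau>(1)] by blast
    qed
  qed
qed

text \<open>The extension of \<open>adjroots D\<close> by sqrt p is quadratic with nontrivial
  automorphism \<tau>, so two automorphisms that agree on \<open>adjroots D\<close> differ by 1 or
  by \<tau>.\<close>

lemma agree_insert_or_flip:
  assumes "basic (insert p D)" "p \<notin> D" "\<tau> \<in> auts" "\<And>x. x \<in> adjroots D \<Longrightarrow> \<tau> x = x"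
    "\<tau> (rt (of_int p)) = - rt (of_int p)"
    and "\<sigma> \<in> auts" "\<sigma>' \<in> auts" "\<And>x. x \<in> adjroots D \<Longrightarrow> \<sigma> x = \<sigma>' x"
  shows "(\<forall>x\<in>adjroots (insert p D). \<sigma>' x = \<sigma> x) \<and> chi (of_int p) \<sigma>' = chi (of_int p) \<sigma> \<or>
     (\<forall>x\<in>adjroots (insert p D). \<sigma>' x = (\<tau> \<circ> \<sigma>) x) \<and> chi (of_int p) \<sigma>' = - chi (of_int p) \<sigma>"
proof -
  let ?r = "rt (of_int p)"
  have p0: "(of_int p :: 'a) \<noteq> 0" using basic_nonzero[OF assms(1)] by auto
  have pq: "(of_int p :: 'a) \<in> \<rat>" by simp
  have "chi (of_int p) \<sigma>' = chi (of_int p) \<sigma> \<or> chi (of_int p) \<sigma>' = - chi (of_int p) \<sigma>"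
    using chi_act(2)[OF assms(6) pq p0] chi_act(2)[OF assms(7) pq p0] by auto
  thus ?thesis
  proof
    assume *: "chi (of_int p) \<sigma>' = chi (of_int p) \<sigma>"
    hence "\<sigma>' ?r = \<sigma> ?r" using chi_eq_chi_iff[OF p0] by blast
    hence "\<sigma>' x = \<sigma> x" if "x \<in> adjroots (insert p D)" for x
      using agree_adjroots[OF assms(7,6) _ that] assms(8) rt_adjroots[of _ D] by force
    thus ?thesis using * by blast
  next
    assume *: "chi (of_int p) \<sigma>' = - chi (of_int p) \<sigma>"
    have "\<sigma>' ?r = \<tau> (\<sigma> ?r)"
      using * chi_act(1)[OF assms(6) pq p0] chi_act(1)[OF assms(7) pq p0] chi_act(2)[OF assms(6) pq p0] assms(3,5)
      by (auto simp: aut_minus)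
    moreover have "\<tau> (\<sigma> x) = \<sigma>' x" if "x \<in> adjroots D" for x
      using assms(4)[OF stableD[OF stable_adjroots assms(6) that]] assms(8)[OF that] by simp
    ultimately have "\<sigma>' x = (\<tau> \<circ> \<sigma>) x" if "x \<in> adjroots (insert p D)" for x
      using agree_adjroots[OF assms(7) aut_comp(1)[OF assms(3,6)] _ that] rt_adjroots[of _ D] by force
    thus ?thesis using * by blast
  qed
qed

text \<open>Descent along this quadratic extension: the automorphisms with a given restriction to
  \<open>adjroots D\<close> act at the upper level as \<sigma> or \<tau> \<sigma>, where f takes the
  same value.\<close>

lemma depends_on_flip:
  assumes "basic (insert p D)" "p \<notin> D" "\<tau> \<in> auts" "\<And>x. x \<in> adjroots D \<Longrightarrow> \<tau> x = x"
    "\<tau> (rt (of_int p)) = - rt (of_int p)"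
    and f: "depends_on (adjroots (insert p D)) f auts" "\<And>\<sigma>. \<sigma> \<in> auts \<Longrightarrow> f (\<tau> \<circ> \<sigma>) = f \<sigma>"
  shows "depends_on (adjroots D) f auts"
  unfolding depends_on_def
proof (intro ballI impI)
  fix \<sigma> \<sigma>' :: "'a \<Rightarrow> 'a" assume *: "\<sigma> \<in> auts" "\<sigma>' \<in> auts" "\<forall>x\<in>adjroots D. \<sigma> x = \<sigma>' x"
  from agree_insert_or_flip[OF assms(1-5) *(1,2)] *(3)
  consider "\<forall>x\<in>adjroots (insert p D). \<sigma>' x = \<sigma> x" | "\<forall>x\<in>adjroots (insert p D). \<sigma>' x = (\<tau> \<circ> \<sigma>) x" by blast
  thus "f \<sigma> = f \<sigma>'"
  proof cases
    case 1
    thus ?thesis using depends_onD[OF f(1) *(2,1)] by simp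
  next
    case 2
    thus ?thesis using depends_onD[OF f(1) *(2) aut_comp(1)[OF assms(3) *(1)]] f(2)[OF *(1)] by simp
  qed
qed

lemma depends_on_chi:
  assumes "a \<noteq> 0" "rt a \<in> L" shows "depends_on L (chi a) auts"
  using assms by (auto simp: depends_on_def chi_eq_chi_iff)

lemma depends_on_hilb:
  assumes "a \<noteq> 0" "b \<noteq> 0" "rt a \<in> L" "rt b \<in> L" shows "depends_on L (hilb a b) auts"
  unfolding depends_on_def
proof (intro ballI impI)
  fix \<sigma> \<tau> :: "'a \<Rightarrow> 'a" assume "\<sigma> \<in> auts" "\<tau> \<in> auts" "\<forall>x\<in>L. \<sigma> x = \<tau> x"
  hence "chi a \<sigma> = chi a \<tau>" "chi b \<sigma> = chi b \<tau>" using assms by (simp_all add: chi_eq_chi_iff)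
  thus "hilb a b \<sigma> = hilb a b \<tau>" by (simp add: hilb_def)
qed

text \<open>Induction on D: a character trivial on the automorphism that flips sqrt p alone descends
  to the smaller field; otherwise its product with \<open>chi p\<close> does.\<close>

lemma quadratic_character:
  assumes "basic D" and hom: "\<And>\<sigma> \<tau>. \<sigma> \<in> auts \<Longrightarrow> \<tau> \<in> auts \<Longrightarrow> \<psi> (\<sigma> \<circ> \<tau>) = \<psi> \<sigma> * \<psi> \<tau>"
    and "\<And>\<sigma>. \<sigma> \<in> auts \<Longrightarrow> \<psi> \<sigma> = 1 \<or> \<psi> \<sigma> = (-1 :: 'a)"
    and "depends_on (adjroots D) \<psi> auts"
  shows "\<exists>I\<subseteq>D. \<forall>\<sigma>\<in>auts. \<psi> \<sigma> = chi (of_int (\<Prod>I)) \<sigma>"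
proof -
  have "finite D" using assms(1) by (rule basic_finite)
  thus ?thesis using assms
  proof (induction D arbitrary: \<psi>)
    case empty
    have "\<psi> \<sigma> = chi (of_int (\<Prod>{})) \<sigma>" if "\<sigma> \<in> auts" for \<sigma>
    proof -
      have "\<psi> \<sigma> = \<psi> id"
        by (rule depends_onD[OF empty.prems(4) that aut_id(1)]) (simp add: aut_rat[OF that] adjroots_empty)
      moreover have "\<psi> id = \<psi> id * \<psi> id" using empty.prems(2)[OF aut_id(1,1)] unfolding comp_id .
      moreover have "c = 1" if "c = c * c" "c = 1 \<or> c = -1" for c :: 'a using that by auto
      ultimately have "\<psi> id = 1" using empty.prems(3)[OF aut_id(1)] by blast
      thus ?thesis using chi_1[OF that] \<open>\<psi> \<sigma> = \<psi> id\<close> by simp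
    qed
    thus ?case by blast
  next
    case (insert p D)
    have p0: "(of_int p :: 'a) \<noteq> 0" "(of_int p :: 'a) \<in> \<rat>" using basic_nonzero[OF insert.prems(1)] by auto
    have D: "basic D" using basic_subset[OF insert.prems(1)] by blast
    obtain \<tau> where \<tau>: "\<tau> \<in> auts" "\<And>x. x \<in> adjroots D \<Longrightarrow> \<tau> x = x" "\<tau> (rt (of_int p)) = - rt (of_int p)"
      using aut_flip insert.prems(1) insert.hyps(2) by blast
    have chi\<tau>: "chi (of_int p) \<tau> = -1" using \<tau>(3) p0 by (simp add: chi_def rt_eq_0)
    show ?case
    proof (cases "\<psi> \<tau> = 1")
      case True
      have "depends_on (adjroots D) \<psi> auts"
        by (rule depends_on_flip[OF insert.prems(1) insert.hyps(2) \<tau> insert.prems(4)])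
          (use insert.prems(2)[OF \<tau>(1)] True in \<open>metis mult_1\<close>)+
      thus ?thesis using insert.IH[OF D insert.prems(2,3)] by blast
    next
      case False
      hence m: "\<psi> \<tau> = -1" using insert.prems(3) \<tau>(1) by blast
      define \<psi>' where "\<psi>' \<sigma> = \<psi> \<sigma> * chi (of_int p) \<sigma>" for \<sigma>
      have hom': "\<psi>' (\<sigma> \<circ> \<rho>) = \<psi>' \<sigma> * \<psi>' \<rho>" if "\<sigma> \<in> auts" "\<rho> \<in> auts" for \<sigma> \<rho>
        using that p0 by (simp add: \<psi>'_def insert.prems(2) chi_comp)
      have sign': "\<psi>' \<sigma> = 1 \<or> \<psi>' \<sigma> = -1" if "\<sigma> \<in> auts" for \<sigma>
        using insert.prems(3)[OF that] chi_act(2)[OF that p0(2,1)] by (auto simp: \<psi>'_def)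
      have dep: "depends_on (adjroots (insert p D)) \<psi>' auts"
        unfolding \<psi>'_def using p0(1) by (intro depends_on_mult insert.prems(4) depends_on_chi rt_adjroots) auto
      have "\<psi>' \<tau> = 1" using m chi\<tau> by (simp add: \<psi>'_def)
      hence "depends_on (adjroots D) \<psi>' auts"
        by (intro depends_on_flip[OF insert.prems(1) insert.hyps(2) \<tau> dep])
          (use hom'[OF \<tau>(1)] in \<open>metis mult_1\<close>)+
      then obtain I where I: "I \<subseteq> D" "\<And>\<sigma>. \<sigma> \<in> auts \<Longrightarrow> \<psi>' \<sigma> = chi (of_int (\<Prod>I)) \<sigma>"
        using insert.IH[OF D hom' sign'] by blast
      have "\<psi> \<sigma> = chi (of_int (\<Prod>(insert p I))) \<sigma>" if \<sigma>: "\<sigma> \<in> auts" for \<sigma>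
      proof -
        have fin: "finite I" "p \<notin> I" using I(1) insert.hyps finite_subset by auto
        have "\<Prod>I \<noteq> 0" using I(1) D basic_subset basic_prod_nonzero by blast
        hence "chi (of_int (\<Prod>(insert p I))) \<sigma> = chi (of_int p) \<sigma> * chi (of_int (\<Prod>I)) \<sigma>"
          using chi_mult[OF \<sigma> p0(2) Rats_of_int p0(1), of "\<Prod>I"] fin by simp
        also have "\<dots> = \<psi> \<sigma> * (chi (of_int p) \<sigma> * chi (of_int p) \<sigma>)"
          using I(2)[OF \<sigma>] by (simp add: \<psi>'_def mult_ac)
        also have "\<dots> = \<psi> \<sigma>" using chi_self[OF \<sigma> p0(2,1)] by simp
        finally show ?thesis by simp
      qed
      thus ?thesis using I(1) by (intro exI[of _ "insert p I"]) auto
    qed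
  qed
qed

section \<open>Levels of the multiquadratic field\<close>

lemma rt_mult_adjroots:
  assumes "rt a \<in> adjroots D" "rt b \<in> adjroots D" shows "rt (a * b) \<in> adjroots D"
proof -
  have "(rt (a * b))\<^sup>2 = (rt a * rt b)\<^sup>2" by (simp add: rt_square power_mult_distrib)
  hence "rt (a * b) = rt a * rt b \<or> rt (a * b) = - (rt a * rt b)" by (simp add: power2_eq_iff)
  thus ?thesis using assms ratring_mult[OF ratring_adjroots] ratring_minus[OF ratring_adjroots] by metis
qed

lemma rt_rat_adjroots:
  assumes "r \<in> \<rat>" shows "rt (r\<^sup>2) \<in> adjroots D"
proof -
  have "rt (r\<^sup>2) = r \<or> rt (r\<^sup>2) = - r" by (metis power2_eq_iff rt_square)
  thus ?thesis using assms ratring_rat[OF ratring_adjroots] by (metis Rats_minus_iff)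
qed

lemma rt_of_nat_adjroots: "0 < m \<Longrightarrow> m < n \<Longrightarrow> rt (of_nat m) \<in> adjroots (gens n)"
proof (induction m rule: less_induct)
  case (less m)
  show ?case
  proof (cases "m = 1")
    case True
    thus ?thesis using rt_rat_adjroots[of 1] by simp
  next
    case False
    then obtain p where p: "prime p" "p dvd m" using prime_factor_nat by blast
    then obtain k where k: "m = p * k" by blast
    have "p \<le> m" using less.prems by (intro dvd_imp_le[OF p(2)])
    moreover have "0 < k" using k less.prems by (intro Nat.gr0I) auto
    moreover have "k < m" using k \<open>0 < k\<close> prime_gt_1_nat[OF p(1)] by simp
    ultimately have "0 < k" "k < m" "p < n" using less.prems by auto
    hence "rt (of_nat k) \<in> adjroots (gens n)" "rt (of_int (int p)) \<in> adjroots (gens n)"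
      using less.IH[of k] less.prems p(1) rt_adjroots[of "int p" "gens n"] by (auto simp: gens_def)
    thus ?thesis using rt_mult_adjroots[of "of_nat p" _ "of_nat k"] by (simp add: k)
  qed
qed

lemma rt_of_int_adjroots:
  assumes "m \<noteq> 0" "\<bar>m\<bar> < int n" shows "rt (of_int m) \<in> adjroots (gens n)"
proof -
  have *: "rt (of_nat (nat \<bar>m\<bar>)) \<in> adjroots (gens n)"
    using assms by (intro rt_of_nat_adjroots) auto
  have "rt (of_int (-1)) \<in> adjroots (gens n)" by (rule rt_adjroots) (simp add: gens_def)
  from rt_mult_adjroots[OF this *] * show ?thesis
    by (cases "m < 0") (simp_all add: of_nat_nat)
qed

lemma rt_prod_adjroots:
  assumes "I \<subseteq> D" "finite D" shows "rt (of_int (\<Prod>I)) \<in> adjroots D"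
proof -
  have "finite I" using assms finite_subset by blast
  thus ?thesis using assms(1)
  proof (induction I)
    case empty
    thus ?case using rt_rat_adjroots[of 1] by simp
  next
    case (insert d I)
    thus ?case using rt_mult_adjroots[of "of_int d" D "of_int (\<Prod>I)"] rt_adjroots[of d D] by simp
  qed
qed

text \<open>The multiquadratic field is the increasing union of its levels. Quantifying over all
  larger n lets the bounds for two elements be merged by a maximum.\<close>

lemma multiquad_adjroots:
  assumes "x \<in> multiquad" shows "\<exists>n0. \<forall>n\<ge>n0. x \<in> adjroots (gens n)"
  using assms unfolding multiquad_def
proof induction
  case (rat q)
  thus ?case by (auto intro: ratring_rat[OF ratring_adjroots])
next
  case (base t)
  then obtain a b where ab: "b \<noteq> 0" "t\<^sup>2 = of_int a / of_int b" by (metis Rats_cases' less_irrefl mem_Collect_eq)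
  show ?case
  proof (cases "a = 0")
    case True
    thus ?thesis using ab by (auto intro: ratring_0[OF ratring_adjroots])
  next
    case False
    \<comment> \<open>Clearing the denominator makes t b a square root of the integer a b, whose
      prime factors are below any n exceeding its absolute value.\<close>
    have "(t * of_int b)\<^sup>2 = t\<^sup>2 * of_int b * of_int b" by (simp add: power2_eq_square mult_ac)
    also have "\<dots> = of_int (a * b)" using ab by simp
    finally have "(t * of_int b)\<^sup>2 = of_int (a * b)" .
    hence "t * of_int b = rt (of_int (a * b)) \<or> t * of_int b = - rt (of_int (a * b))"
      by (metis power2_eq_iff rt_square)
    hence t: "t = rt (of_int (a * b)) / of_int b \<or> t = - rt (of_int (a * b)) / of_int b"
      using ab(1) by (auto simp: field_simps)
    have "t \<in> adjroots (gens n)" if "n \<ge> nat \<bar>a * b\<bar> + 1" for n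
    proof -
      have "rt (of_int (a * b)) \<in> adjroots (gens n)"
        by (rule rt_of_int_adjroots) (use that False ab(1) in auto)
      moreover have "of_int b \<in> adjroots (gens n)" by (intro ratring_rat[OF ratring_adjroots]) simp
      ultimately have "rt (of_int (a * b)) / of_int b \<in> adjroots (gens n)" "- rt (of_int (a * b)) / of_int b \<in> adjroots (gens n)"
        by (auto intro!: ratring_divide ratring_minus simp: ratring_adjroots alg simp del: of_int_mult)
      thus ?thesis using t by metis
    qed
    thus ?thesis by blast
  qed
next
  case (add x y)
  then obtain n1 n2 where "\<forall>n\<ge>n1. x \<in> adjroots (gens n)" "\<forall>n\<ge>n2. y \<in> adjroots (gens n)" by blast
  thus ?case by (intro exI[of _ "max n1 n2"]) (auto intro: ratring_add[OF ratring_adjroots])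
next
  case (mult x y)
  then obtain n1 n2 where "\<forall>n\<ge>n1. x \<in> adjroots (gens n)" "\<forall>n\<ge>n2. y \<in> adjroots (gens n)" by blast
  thus ?case by (intro exI[of _ "max n1 n2"]) (auto intro: ratring_mult[OF ratring_adjroots])
qed

lemma qelts_ratio_adjroots:
  assumes "s \<in> qelts"
  shows "\<exists>n0. \<forall>n\<ge>n0. s\<^sup>2 \<in> adjroots (gens n) \<and> (\<forall>\<tau>\<in>auts. \<tau> s / s \<in> adjroots (gens n))"
proof -
  define C where "C = insert (s\<^sup>2) ((\<lambda>y. y / s) ` orbit s)"
  have "finite C" by (simp add: C_def finite_orbit[OF alg])
  moreover have "C \<subseteq> multiquad"
    using qelts_ratio_multiquad[OF assms] qelts_square_multiquad[OF assms] by (auto simp: C_def orbit_def)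
  ultimately have "\<exists>n0. \<forall>n\<ge>n0. C \<subseteq> adjroots (gens n)"
  proof (induction C)
    case (insert c C)
    then obtain n1 n2 where "\<forall>n\<ge>n1. c \<in> adjroots (gens n)" "\<forall>n\<ge>n2. C \<subseteq> adjroots (gens n)"
      using multiquad_adjroots[of c] by auto
    thus ?case by (intro exI[of _ "max n1 n2"]) auto
  qed auto
  then obtain n0 where n0: "\<And>n. n \<ge> n0 \<Longrightarrow> C \<subseteq> adjroots (gens n)" by blast
  have "s\<^sup>2 \<in> adjroots (gens n) \<and> (\<forall>\<tau>\<in>auts. \<tau> s / s \<in> adjroots (gens n))" if "n \<ge> n0" for n
    using n0[OF that] by (auto simp: C_def orbit_def)
  thus ?thesis by blast
qed

text \<open>With c = \<sigma> s / s one has \<sigma>^2 s / s = \<sigma>(c) c. Since s^2 lies in the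
  field, c^2 and hence c up to sign is determined by the restriction of \<sigma>; the sign cancels
  in \<sigma>(c) c.\<close>

lemma qf_depends_on:
  assumes "s \<in> qelts" "\<And>\<tau>. \<tau> \<in> auts \<Longrightarrow> \<tau> s / s \<in> adjroots D" "s\<^sup>2 \<in> adjroots D"
  shows "depends_on (adjroots D) (qf s) auts"
  unfolding depends_on_def
proof (intro ballI impI)
  fix \<sigma> \<tau> :: "'a \<Rightarrow> 'a" assume *: "\<sigma> \<in> auts" "\<tau> \<in> auts" "\<forall>x\<in>adjroots D. \<sigma> x = \<tau> x"
  have s0: "s \<noteq> 0" using assms(1) by (rule qelts_nonzero)
  define b where "b = \<tau> s / s"
  have b: "b \<in> adjroots D" "\<tau> s = b * s" using assms(2)[OF *(2)] s0 by (auto simp: b_def)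
  define c where "c = \<sigma> s / s"
  have c: "c \<in> adjroots D" "\<sigma> s = c * s" using assms(2)[OF *(1)] s0 by (auto simp: c_def)
  have "(\<sigma> s)\<^sup>2 = (\<tau> s)\<^sup>2" using bspec[OF *(3) assms(3)] *(1,2) by (simp add: aut_power)
  hence "c\<^sup>2 = b\<^sup>2" using b c s0 by (simp add: power_mult_distrib)
  hence cb: "c = b \<or> c = - b" by (simp add: power2_eq_iff)
  have "\<sigma> (\<sigma> s) = \<sigma> c * c * s" using c *(1) by (simp add: autsD)
  also have "\<sigma> c = \<tau> c" using bspec[OF *(3) c(1)] .
  also have "\<tau> c * c = \<tau> b * b" using cb *(2) by (auto simp: aut_minus)
  also have "\<tau> b * b * s = \<tau> (\<tau> s)" using b *(2) by (simp add: autsD)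
  finally show "qf s \<sigma> = qf s \<tau>" by (simp add: qf_def)
qed

end

section \<open>Splitting of quadratic forms at the primes\<close>

text \<open>The error term of the p-th power map is exhibited as p times an integer polynomial in x
  and y, so that it stays inside any subring containing them.\<close>

lemma prime_power_add:
  fixes x y :: "'a::comm_ring_1"
  assumes "prime p"
  shows "(x + y) ^ p = x ^ p + y ^ p + of_nat p * (\<Sum>k\<in>{1..<p}. of_nat ((p choose k) div p) * x ^ k * y ^ (p - k))"
proof -
  have p0: "0 < p" using assms by (simp add: prime_gt_0_nat)
  have "(x + y) ^ p = (\<Sum>k\<le>p. of_nat (p choose k) * x ^ k * y ^ (p - k))" by (rule binomial_ring)
  also have "{..p} = insert 0 (insert p {1..<p})" using p0 by auto
  also have "(\<Sum>k\<in>\<dots>. of_nat (p choose k) * x ^ k * y ^ (p - k)) =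
      x ^ p + y ^ p + (\<Sum>k\<in>{1..<p}. of_nat (p choose k) * x ^ k * y ^ (p - k))"
    using p0 by (subst sum.insert, auto)+
  also have "(\<Sum>k\<in>{1..<p}. of_nat (p choose k) * x ^ k * y ^ (p - k)) =
      of_nat p * (\<Sum>k\<in>{1..<p}. of_nat ((p choose k) div p) * x ^ k * y ^ (p - k))"
    unfolding sum_distrib_left
  proof (rule sum.cong[OF refl])
    fix k assume "k \<in> {1..<p}"
    hence "p dvd (p choose k)" using assms by (intro dvd_choose_prime) auto
    hence "p choose k = p * ((p choose k) div p)" by simp
    hence "(of_nat (p choose k) :: 'a) = of_nat p * of_nat ((p choose k) div p)"
      by (metis of_nat_mult)
    thus "of_nat (p choose k) * x ^ k * y ^ (p - k) =
        of_nat p * (of_nat ((p choose k) div p) * x ^ k * y ^ (p - k))" by (simp add: mult_ac)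
  qed
  finally show ?thesis .
qed

section \<open>Frobenius congruences in an order of a multiquadratic field\<close>

context algebraic_numbers
begin

text \<open>The order generated by the square roots of D, in the role of the ring of integers: for
  \<open>basic\<close> D its rational elements are integers, and every element of
  \<open>adjroots D\<close> is one of its elements divided by an integer.\<close>

inductive_set introots :: "int set \<Rightarrow> 'a set" for D where
  int: "of_int m \<in> introots D"
| root: "d \<in> D \<Longrightarrow> rt (of_int d) \<in> introots D"
| add: "x \<in> introots D \<Longrightarrow> y \<in> introots D \<Longrightarrow> x + y \<in> introots D"
| mult: "x \<in> introots D \<Longrightarrow> y \<in> introots D \<Longrightarrow> x * y \<in> introots D"

lemma introots_subset: "x \<in> introots D \<Longrightarrow> x \<in> adjroots D"
  by (induction rule: introots.induct)
    (auto intro: ratring_rat ratring_add ratring_mult rt_adjroots ratring_adjroots)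

lemma introots_1: "1 \<in> introots D" and introots_0: "0 \<in> introots D"
  using introots.int[of 1 D] introots.int[of 0 D] by simp_all

lemma introots_of_nat: "of_nat n \<in> introots D"
  using introots.int[of "int n" D] by simp

lemma introots_power: "x \<in> introots D \<Longrightarrow> x ^ n \<in> introots D"
  by (induction n) (auto intro: introots_1 introots.mult)

lemma introots_uminus: "x \<in> introots D \<Longrightarrow> - x \<in> introots D"
  using introots.mult[OF introots.int[of "-1"], of x D] by simp

lemma introots_sum: "(\<And>i. i \<in> I \<Longrightarrow> f i \<in> introots D) \<Longrightarrow> sum f I \<in> introots D"
  by (induction I rule: infinite_finite_induct) (auto intro: introots_0 introots.add)

lemma introots_insert:
  assumes "x \<in> introots (insert d D)"
  shows "\<exists>a\<in>introots D. \<exists>b\<in>introots D. x = a + b * rt (of_int d)"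
  using assms
proof induction
  case (int m)
  show ?case by (intro bexI[of _ "of_int m"] bexI[of _ 0]) (auto intro: introots.int introots_0)
next
  case (root e)
  show ?case
  proof (cases "e = d")
    case True
    thus ?thesis by (intro bexI[of _ 0] bexI[of _ 1]) (auto intro: introots_1 introots_0)
  next
    case False
    thus ?thesis using root
      by (intro bexI[of _ "rt (of_int e)"] bexI[of _ 0]) (auto intro: introots.root introots_0)
  qed
next
  case (add x y)
  then obtain a b a' b' where "a \<in> introots D" "b \<in> introots D" "a' \<in> introots D" "b' \<in> introots D"
    "x = a + b * rt (of_int d)" "y = a' + b' * rt (of_int d)" by blast
  thus ?case by (intro bexI[of _ "a + a'"] bexI[of _ "b + b'"]) (auto intro: introots.add simp: algebra_simps)
next
  case (mult x y)
  then obtain a b a' b' where *: "a \<in> introots D" "b \<in> introots D" "a' \<in> introots D" "b' \<in> introots D"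
    "x = a + b * rt (of_int d)" "y = a' + b' * rt (of_int d)" by blast
  have "x * y = a * a' + b * b' * (rt (of_int d))\<^sup>2 + (a * b' + b * a') * rt (of_int d)"
    unfolding *(5,6) by (simp add: algebra_simps power2_eq_square)
  thus ?case using * unfolding rt_square
    by (intro bexI[of _ "a * a' + b * b' * of_int d"] bexI[of _ "a * b' + b * a'"])
      (auto intro!: introots.add introots.mult introots.int)
qed

text \<open>If x = a + b sqrt d were rational with b nonzero, sqrt d would lie in the smaller field.
  So x = a belongs to the smaller order.\<close>

lemma introots_rational:
  assumes "basic D" "x \<in> introots D" "x \<in> \<rat>"
  shows "x \<in> \<int>"
proof -
  have "finite D" using assms(1) by (rule basic_finite)
  thus ?thesis using assms
  proof (induction D arbitrary: x)
    case empty
    have "y \<in> \<int>" if "y \<in> introots {}" for y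
      using that by induction auto
    thus ?case using empty by blast
  next
    case (insert d D)
    let ?r = "rt (of_int d)"
    obtain a b where ab: "a \<in> introots D" "b \<in> introots D" "x = a + b * ?r"
      using introots_insert insert.prems(2) by blast
    have "b = 0"
    proof (rule ccontr)
      assume "b \<noteq> 0"
      hence "?r = (x - a) / b" using ab(3) by simp
      moreover have "(x - a) / b \<in> adjroots D"
        by (intro ratring_divide ratring_diff ratring_adjroots alg introots_subset ab ratring_rat[OF ratring_adjroots]
            insert.prems(3))
      ultimately show False using rt_not_in_adjroots[OF insert.prems(1) insert.hyps(2)] by simp
    qed
    hence "x = a" using ab(3) by simp
    thus ?case using insert.IH[of a] ab(1) insert.prems(3) basic_subset[OF insert.prems(1)] by blast
  qed
qed

lemma adjroots_fraction:
  assumes "x \<in> adjroots D"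
  shows "\<exists>a\<in>introots D. \<exists>m. m \<noteq> 0 \<and> x = a / of_int m"
  using assms unfolding adjroots_def
proof induction
  case (rat q)
  then obtain a b where "b > 0" "q = of_int a / of_int b" by (metis Rats_cases')
  thus ?case by (intro bexI[of _ "of_int a"] exI[of _ b]) (auto intro: introots.int)
next
  case (base x)
  thus ?case by (intro bexI[of _ x] exI[of _ 1]) (auto intro: introots.root)
next
  case (add x y)
  then obtain a b m n where *: "a \<in> introots D" "b \<in> introots D" "m \<noteq> 0" "n \<noteq> 0"
    "x = a / of_int m" "y = b / of_int n" by blast
  have "x + y = (a * of_int n + b * of_int m) / of_int (m * n)" using * by (simp add: field_simps)
  moreover have "a * of_int n + b * of_int m \<in> introots D" by (intro introots.add introots.mult introots.int *)
  ultimately show ?case using *(3,4) by (metis mult_eq_0_iff)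
next
  case (mult x y)
  then obtain a b m n where *: "a \<in> introots D" "b \<in> introots D" "m \<noteq> 0" "n \<noteq> 0"
    "x = a / of_int m" "y = b / of_int n" by blast
  have "x * y = (a * b) / of_int (m * n)" using * by simp
  moreover have "a * b \<in> introots D" by (intro introots.mult *)
  ultimately show ?case using *(3,4) by (metis mult_eq_0_iff)
qed

text \<open>The congruence \<phi> x = x ^ p modulo p is preserved by products and, by
  \<open>prime_power_add\<close>, by sums. For integers it is Fermat's theorem; for r = sqrt d one
  has r ^ p = d ^ ((p - 1) / 2) r, and Euler's criterion applies.\<close>

lemma frobenius_congruence:
  assumes p: "prime p" "p > 2" and \<phi>: "\<phi> \<in> auts"
    and sgn: "\<And>d. d \<in> D \<Longrightarrow> \<phi> (rt (of_int d)) = of_int (Legendre d (int p)) * rt (of_int d)"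
    and "x \<in> introots D"
  shows "\<phi> x \<in> introots D \<and> (\<exists>c\<in>introots D. \<phi> x = x ^ p + of_nat p * c)"
  using assms(5)
proof induction
  case (int m)
  have "[m ^ p = m] (mod int p)"
  proof (cases "int p dvd m")
    case True
    moreover have "m dvd m ^ p" using p by (intro dvd_power) simp
    ultimately have "int p dvd m ^ p" by (rule dvd_trans)
    thus ?thesis using True by (simp add: cong_def)
  next
    case False
    \<comment> \<open>Fermat's theorem, obtained by squaring Euler's criterion.\<close>
    have "[(Legendre m (int p))\<^sup>2 = (m ^ ((p - 1) div 2))\<^sup>2] (mod int p)"
      using p by (intro cong_pow euler_criterion) simp_all
    moreover have "(Legendre m (int p))\<^sup>2 = 1" using False by (simp add: Legendre_def cong_0_iff)
    moreover have "(m ^ ((p - 1) div 2))\<^sup>2 = m ^ (p - 1)"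
      using prime_odd_nat[OF p] by (simp add: power_mult[symmetric])
    ultimately have "[m ^ (p - 1) = 1] (mod int p)" by (simp add: cong_sym)
    hence "[m * m ^ (p - 1) = m * 1] (mod int p)" by (rule cong_scalar_left)
    thus ?thesis using p(2) by (cases p) auto
  qed
  hence "int p dvd m - m ^ p" using cong_sym by (simp only: cong_iff_dvd_diff[symmetric])
  then obtain c where "m - m ^ p = int p * c" by blast
  hence "m = m ^ p + int p * c" by simp
  hence "(of_int m :: 'a) = of_int m ^ p + of_nat p * of_int c"
    by (metis of_int_add of_int_mult of_int_of_nat_eq of_int_power)
  thus ?case using introots.int aut_of_int[OF \<phi>] by metis
next
  case (root d)
  let ?r = "rt (of_int d)"
  have "[Legendre d (int p) = d ^ ((p - 1) div 2)] (mod int p)" using euler_criterion p by simp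
  then obtain c where c: "Legendre d (int p) - d ^ ((p - 1) div 2) = int p * c"
    by (auto simp: cong_iff_dvd_diff)
  have "odd p" using p prime_odd_nat by blast
  hence e: "Suc (2 * ((p - 1) div 2)) = p" using p(2) by simp
  have "?r ^ p = ?r ^ Suc (2 * ((p - 1) div 2))" unfolding e ..
  also have "\<dots> = ?r * (?r\<^sup>2) ^ ((p - 1) div 2)" by (simp only: power_Suc power_mult)
  finally have "?r ^ p = ?r * (?r\<^sup>2) ^ ((p - 1) div 2)" .
  hence "?r ^ p = of_int (d ^ ((p - 1) div 2)) * ?r" by (simp add: rt_square mult.commute)
  moreover have "of_int (Legendre d (int p)) * ?r = of_int (d ^ ((p - 1) div 2)) * ?r + of_nat p * (of_int c * ?r)"
  proof -
    have "Legendre d (int p) = d ^ ((p - 1) div 2) + int p * c" using c by simp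
    thus ?thesis by (simp add: algebra_simps)
  qed
  ultimately have "\<phi> ?r = ?r ^ p + of_nat p * (of_int c * ?r)" using sgn[OF root] by simp
  moreover have "of_int c * ?r \<in> introots D" "\<phi> ?r \<in> introots D"
    unfolding sgn[OF root] by (intro introots.mult introots.int introots.root root)+
  ultimately show ?case by blast
next
  case (add x y)
  then obtain c c' where c: "c \<in> introots D" "c' \<in> introots D" "\<phi> x = x ^ p + of_nat p * c" "\<phi> y = y ^ p + of_nat p * c'"
    by blast
  define e where "e = (\<Sum>k\<in>{1..<p}. of_nat ((p choose k) div p) * x ^ k * y ^ (p - k))"
  have e: "e \<in> introots D"
    unfolding e_def by (intro introots_sum introots.mult introots_of_nat introots_power add)
  have "\<phi> (x + y) = (x + y) ^ p + of_nat p * (c + c' + (- e))"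
    unfolding prime_power_add[OF p(1)] e_def[symmetric] using c by (simp add: autsD[OF \<phi>] algebra_simps)
  moreover have "c + c' + (- e) \<in> introots D" by (intro introots.add introots_uminus c e)
  moreover have "\<phi> (x + y) \<in> introots D" using add by (auto simp: autsD[OF \<phi>] intro: introots.add)
  ultimately show ?case by blast
next
  case (mult x y)
  then obtain c c' where c: "c \<in> introots D" "c' \<in> introots D" "\<phi> x = x ^ p + of_nat p * c" "\<phi> y = y ^ p + of_nat p * c'"
    by blast
  have "\<phi> (x * y) = (x * y) ^ p + of_nat p * (x ^ p * c' + c * y ^ p + of_nat p * c * c')"
    using c by (simp add: autsD[OF \<phi>] algebra_simps power_mult_distrib)
  moreover have "x ^ p * c' + c * y ^ p + of_nat p * c * c' \<in> introots D"
    by (intro introots.add introots.mult introots_power introots_of_nat mult c)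
  moreover have "\<phi> (x * y) \<in> introots D" using mult by (auto simp: autsD[OF \<phi>] intro: introots.mult)
  ultimately show ?case by blast
qed

text \<open>Since \<open>\<phi> x\<close> is congruent to \<open>x ^ p\<close>, divisibility of \<open>x * \<phi> x\<close> by \<open>p\<close> forces divisibility of
  \<open>\<phi> (\<phi> x) = x\<close> by \<open>p\<close>; so a norm from a field unramified at \<open>p\<close> is divisible by \<open>p\<close> an even
  number of times.\<close>

lemma frobenius_norm:
  assumes p: "prime p" "p > 2" and D: "basic D" and \<phi>: "\<phi> \<in> auts"
    and sgn: "\<And>d. d \<in> D \<Longrightarrow> \<phi> (rt (of_int d)) = of_int (Legendre d (int p)) * rt (of_int d)"
    and "x \<in> introots D" "m \<noteq> 0" "e = 1 \<or> e = -1"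
  shows "of_nat p * (x * \<phi> x) \<noteq> of_int (e * m\<^sup>2)"
  using assms(6,7)
proof (induction "nat \<bar>m\<bar>" arbitrary: x m rule: less_induct)
  case less
  let ?P = "of_nat p :: 'a"
  note fc = frobenius_congruence[OF p \<phi> sgn]
  have p0: "p > 0" using p by simp
  show ?case
  proof
    assume eq: "?P * (x * \<phi> x) = of_int (e * m\<^sup>2)"
    have \<phi>x: "\<phi> x \<in> introots D" using fc less.prems(1) by blast
    have "x * \<phi> x = of_int (e * m\<^sup>2) / ?P" using eq p0 by (simp add: field_simps)
    hence "x * \<phi> x \<in> \<rat>" by (metis Rats_divide Rats_of_int Rats_of_nat)
    \<comment> \<open>A rational element of the order is an integer, so p k = e m^2 holds in the
      integers; it gives first p | m and then p | k.\<close>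
    hence "x * \<phi> x \<in> \<int>" using introots_rational[OF D introots.mult[OF less.prems(1) \<phi>x]] by blast
    then obtain k where k: "x * \<phi> x = of_int k" by (auto elim: Ints_cases)
    have "of_int (int p * k) = (of_int (e * m\<^sup>2) :: 'a)" using eq k by simp
    hence ik: "int p * k = e * m\<^sup>2" by (simp only: of_int_eq_iff)
    hence "int p dvd m\<^sup>2" using assms(8) by (metis dvd_minus_iff dvd_triv_left mult_1 mult_minus1)
    hence "int p dvd m" using p(1) by (simp add: prime_dvd_power_iff)
    then obtain m1 where m1: "m = int p * m1" by blast
    have kk: "k = e * int p * m1\<^sup>2"
    proof -
      have "int p * k = int p * (e * int p * m1\<^sup>2)" using ik m1 by (simp add: power2_eq_square mult_ac)
      thus ?thesis using p0 by simp
    qed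
    obtain c where c: "c \<in> introots D" "\<phi> x = x ^ p + ?P * c" using fc less.prems(1) by blast
    have inv: "\<phi> (\<phi> x) = x"
      by (rule multiquad_involution[OF _ \<phi>]) (use adjroots_multiquad introots_subset less.prems(1) in blast)
    \<comment> \<open>This is (\<phi> x)^2 / p: replace one factor \<phi> x by x ^ p + p c and use x
      \<phi>(x) = e p m1^2.\<close>
    define c3 where "c3 = of_int (e * m1\<^sup>2) * x ^ (p - 1) + c * \<phi> x"
    have c3: "c3 \<in> introots D" unfolding c3_def
      by (intro introots.add introots.mult introots.int introots_power less.prems(1) c(1) \<phi>x)
    have "(\<phi> x)\<^sup>2 = \<phi> x * x ^ p + ?P * (c * \<phi> x)"
      unfolding power2_eq_square by (subst (2) c(2)) (simp add: algebra_simps)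
    also have "x ^ p = x * x ^ (p - 1)" using p0 by (cases p) auto
    also have "\<phi> x * (x * x ^ (p - 1)) = ?P * (of_int (e * m1\<^sup>2) * x ^ (p - 1))"
      using k unfolding kk by (simp add: mult_ac)
    finally have sq: "(\<phi> x)\<^sup>2 = ?P * c3" by (simp add: c3_def algebra_simps)
    obtain c2 where c2: "c2 \<in> introots D" "\<phi> (\<phi> x) = \<phi> x ^ p + ?P * c2" using fc \<phi>x by blast
    have "\<phi> x ^ p = \<phi> x ^ (p - 2) * (\<phi> x)\<^sup>2"
    proof -
      have e: "(p - 2) + 2 = p" using p(2) by simp
      have "\<phi> x ^ p = \<phi> x ^ ((p - 2) + 2)" unfolding e ..
      also have "\<dots> = \<phi> x ^ (p - 2) * (\<phi> x)\<^sup>2" by (rule power_add)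
      finally show ?thesis .
    qed
    \<comment> \<open>As p is at least 2, \<phi>(x) ^ p contains the factor (\<phi> x)^2 = p
      \<open>c3\<close>. So x = \<phi>(\<phi> x) is p times \<open>x1\<close>, and cancelling p^2
      moves the equation from m to m1 = m / p.\<close>
    define x1 where "x1 = \<phi> x ^ (p - 2) * c3 + c2"
    have x1: "x1 \<in> introots D" unfolding x1_def
      by (intro introots.add introots.mult introots_power c3 c2(1) \<phi>x)
    have xx1: "x = ?P * x1"
      using c2(2) unfolding inv \<open>\<phi> x ^ p = _\<close> sq by (simp add: x1_def algebra_simps)
    have "?P * (?P * (?P * (x1 * \<phi> x1))) = ?P * (?P * of_int (e * m1\<^sup>2))"
      using eq unfolding xx1 m1 by (simp add: autsD[OF \<phi>] aut_of_nat[OF \<phi>] power2_eq_square mult_ac)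
    hence "?P * (x1 * \<phi> x1) = of_int (e * m1\<^sup>2)" using p0 by simp
    moreover have "m1 \<noteq> 0" using m1 less.prems(2) by auto
    moreover have "nat \<bar>m1\<bar> < nat \<bar>m\<bar>"
    proof -
      have "1 * \<bar>m1\<bar> < int p * \<bar>m1\<bar>" using \<open>m1 \<noteq> 0\<close> p(2) by (intro mult_strict_right_mono) auto
      thus ?thesis using m1 \<open>m1 \<noteq> 0\<close> by (simp add: abs_mult)
    qed
    ultimately show False using less.hyps x1 by blast
  qed
qed

end

lemma depends_on_cong:
  assumes "depends_on L g A" "\<And>\<sigma>. \<sigma> \<in> A \<Longrightarrow> f \<sigma> = g \<sigma>" shows "depends_on L f A"
  unfolding depends_on_def
proof (intro ballI impI)
  fix \<sigma> \<tau> assume *: "\<sigma> \<in> A" "\<tau> \<in> A" "\<forall>x\<in>L. \<sigma> x = \<tau> x"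
  have "g \<sigma> = g \<tau>" by (rule depends_onD[OF assms(1) *(1,2)]) (use *(3) in blast)
  thus "f \<sigma> = f \<tau>" using assms(2)[OF *(1)] assms(2)[OF *(2)] by simp
qed

section \<open>The commutator form of a quadratic element\<close>

context algebraic_numbers
begin

text \<open>Apply \<sigma> and then \<tau> to the relation (\<sigma> \<tau>)^2 =
  \<open>qf s (\<sigma> \<circ> \<tau>)\<close>. The squares of \<sigma> and \<tau> that arise act
  by signs, which all automorphisms fix, and what is left compares \<sigma> \<tau> with \<tau>
  \<sigma>.\<close>

lemma qf_commutator:
  assumes s: "s \<in> qelts" and "\<sigma> \<in> auts" "\<tau> \<in> auts" "\<rho> \<in> auts"
  shows "\<sigma> (\<tau> (\<rho> s)) = qf s \<sigma> * qf s \<tau> * qf s (\<sigma> \<circ> \<tau>) * \<tau> (\<sigma> (\<rho> s))"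
proof -
  let ?q = "qf s (\<sigma> \<circ> \<tau>)" and ?y = "\<rho> s"
  have \<sigma>\<tau>: "\<sigma> \<circ> \<tau> \<in> auts" by (rule aut_comp(1)[OF assms(2,3)])
  have sign: "x = c * y" if "c = 1 \<or> c = -1" "c * x = y" for c x y :: 'a using that by auto
  have act: "\<sigma> (\<tau> (\<sigma> (\<tau> ?y))) = ?q * ?y"
    using qf_act(2)[OF s \<sigma>\<tau> assms(4)] by (simp only: o_apply)
  have "\<sigma> (\<sigma> (\<tau> (\<sigma> (\<tau> ?y)))) = ?q * \<sigma> ?y"
    unfolding act using assms(2) qf_fixed[OF s \<sigma>\<tau> assms(2)] by (simp only: autsD)
  moreover have "\<sigma> (\<sigma> (\<tau> (\<sigma> (\<tau> ?y)))) = qf s \<sigma> * \<tau> (\<sigma> (\<tau> ?y))"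
    using qf_act(2)[OF s assms(2) aut_comp(2)[OF assms(3) aut_comp(2)[OF assms(2) aut_comp(2)[OF assms(3,4)]]]] .
  ultimately have "qf s \<sigma> * \<tau> (\<sigma> (\<tau> ?y)) = ?q * \<sigma> ?y" by simp
  hence "\<tau> (\<sigma> (\<tau> ?y)) = qf s \<sigma> * ?q * \<sigma> ?y" using sign[OF qf_act(1)[OF s assms(2)]] by (simp only: mult.assoc)
  hence "\<tau> (\<tau> (\<sigma> (\<tau> ?y))) = qf s \<sigma> * ?q * \<tau> (\<sigma> ?y)"
    using assms(3) qf_fixed[OF s \<sigma>\<tau> assms(3)] qf_fixed[OF s assms(2,3)] by (simp only: autsD)
  moreover have "\<tau> (\<tau> (\<sigma> (\<tau> ?y))) = qf s \<tau> * \<sigma> (\<tau> ?y)"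
    using qf_act(2)[OF s assms(3) aut_comp(2)[OF assms(2) aut_comp(2)[OF assms(3,4)]]] .
  ultimately have "qf s \<tau> * \<sigma> (\<tau> ?y) = qf s \<sigma> * ?q * \<tau> (\<sigma> ?y)" by simp
  hence "\<sigma> (\<tau> ?y) = qf s \<tau> * (qf s \<sigma> * ?q * \<tau> (\<sigma> ?y))" by (rule sign[OF qf_act(1)[OF s assms(3)]])
  thus ?thesis by (simp only: mult_ac)
qed

text \<open>The polar form of \<open>qf s\<close>: the sign by which commutators act on \<open>s\<close>.\<close>

definition qb :: "'a \<Rightarrow> ('a \<Rightarrow> 'a) \<Rightarrow> ('a \<Rightarrow> 'a) \<Rightarrow> 'a" where
  "qb s \<tau> \<sigma> = qf s \<tau> * qf s \<sigma> * qf s (\<tau> \<circ> \<sigma>)"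

lemma qb_act:
  assumes "s \<in> qelts" "\<tau> \<in> auts" "\<sigma> \<in> auts"
  shows "\<rho> \<in> auts \<Longrightarrow> \<tau> (\<sigma> (\<rho> s)) = qb s \<tau> \<sigma> * \<sigma> (\<tau> (\<rho> s))" "\<tau> (\<sigma> s) = qb s \<tau> \<sigma> * \<sigma> (\<tau> s)"
    "qb s \<tau> \<sigma> = 1 \<or> qb s \<tau> \<sigma> = -1" "qf s (\<tau> \<circ> \<sigma>) = qf s \<tau> * qf s \<sigma> * qb s \<tau> \<sigma>"
proof -
  show *: "\<tau> (\<sigma> (\<rho> s)) = qb s \<tau> \<sigma> * \<sigma> (\<tau> (\<rho> s))" if "\<rho> \<in> auts" for \<rho>
    unfolding qb_def by (rule qf_commutator[OF assms that])
  show "\<tau> (\<sigma> s) = qb s \<tau> \<sigma> * \<sigma> (\<tau> s)" by (rule *[OF aut_id(2)])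
  note e = qf_act(1)[OF assms(1,2)] qf_act(1)[OF assms(1,3)] qf_act(1)[OF assms(1) aut_comp(1)[OF assms(2,3)]]
  have "c * d * f = 1 \<or> c * d * f = -1" "f = c * d * (c * d * f)"
    if "c = 1 \<or> c = -1" "d = 1 \<or> d = -1" "f = 1 \<or> f = -1" for c d f :: 'a using that by auto
  from this[OF e] show "qb s \<tau> \<sigma> = 1 \<or> qb s \<tau> \<sigma> = -1" "qf s (\<tau> \<circ> \<sigma>) = qf s \<tau> * qf s \<sigma> * qb s \<tau> \<sigma>"
    unfolding qb_def by blast+
qed

text \<open>Moving \<tau> past \<sigma> and then past \<sigma>' multiplies the two commutator signs,
  since signs are fixed by \<sigma>. This linearity makes \<open>qb s \<tau>\<close> a quadratic
  character.\<close>

lemma qb_comp: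
  assumes s: "s \<in> qelts" and "\<tau> \<in> auts" "\<sigma> \<in> auts" "\<sigma>' \<in> auts"
  shows "qb s \<tau> (\<sigma> \<circ> \<sigma>') = qb s \<tau> \<sigma> * qb s \<tau> \<sigma>'"
proof -
  have fx: "\<sigma> (qb s \<tau> \<sigma>') = qb s \<tau> \<sigma>'"
    using qb_act(3)[OF s assms(2,4)] assms(3) by (auto simp: aut_1 aut_minus)
  have "qb s \<tau> (\<sigma> \<circ> \<sigma>') * \<sigma> (\<sigma>' (\<tau> s)) = \<tau> (\<sigma> (\<sigma>' s))"
    using qb_act(2)[OF s assms(2) aut_comp(1)[OF assms(3,4)]] by (simp only: o_apply)
  also have "\<dots> = qb s \<tau> \<sigma> * \<sigma> (\<tau> (\<sigma>' s))" by (rule qb_act(1)[OF s assms(2,3,4)])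
  also have "\<tau> (\<sigma>' s) = qb s \<tau> \<sigma>' * \<sigma>' (\<tau> s)" by (rule qb_act(2)[OF s assms(2,4)])
  also have "\<sigma> (qb s \<tau> \<sigma>' * \<sigma>' (\<tau> s)) = qb s \<tau> \<sigma>' * \<sigma> (\<sigma>' (\<tau> s))"
    using fx assms(3) by (simp only: autsD)
  finally have "qb s \<tau> (\<sigma> \<circ> \<sigma>') * \<sigma> (\<sigma>' (\<tau> s)) = (qb s \<tau> \<sigma> * qb s \<tau> \<sigma>') * \<sigma> (\<sigma>' (\<tau> s))"
    by (simp only: mult.assoc)
  moreover have "\<sigma> (\<sigma>' (\<tau> s)) \<noteq> 0" using assms qelts_nonzero[OF s] by (simp add: aut_eq_0)
  ultimately show ?thesis by simp
qed

lemma depends_on_qb: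
  assumes "depends_on L (qf s) auts" "stable L" "\<tau> \<in> auts"
  shows "depends_on L (qb s \<tau>) auts"
  unfolding depends_on_def
proof (intro ballI impI)
  fix \<sigma> \<sigma>' :: "'a \<Rightarrow> 'a" assume *: "\<sigma> \<in> auts" "\<sigma>' \<in> auts" "\<forall>x\<in>L. \<sigma> x = \<sigma>' x"
  have "qf s \<sigma> = qf s \<sigma>'" using depends_onD[OF assms(1) *(1,2)] *(3) by blast
  moreover have "qf s (\<tau> \<circ> \<sigma>) = qf s (\<tau> \<circ> \<sigma>')"
    by (rule depends_onD[OF assms(1) aut_comp(1)[OF assms(3) *(1)] aut_comp(1)[OF assms(3) *(2)]]) (use *(3) in simp)
  ultimately show "qb s \<tau> \<sigma> = qb s \<tau> \<sigma>'" by (simp only: qb_def)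
qed

text \<open>At an odd prime \<open>p\<close>, a Frobenius automorphism produces from a ramified quadratic element
  a unit-like element of norm \<open>\<plusminus>1/p\<close> unless the character \<open>qb s \<tau>\<close> belongs to a quadratic residue.\<close>

lemma residue_of_commutator_character:
  assumes p: "prime p" and s: "s \<in> qelts"
    and dep: "depends_on (adjroots (gens (Suc p))) (qf s) auts"
    and \<tau>: "\<tau> \<in> auts" "\<And>x. x \<in> adjroots (gens p) \<Longrightarrow> \<tau> x = x" "\<tau> (rt (of_nat p)) = - rt (of_nat p)"
    and q\<tau>: "qf s \<tau> = 1"
    and I: "I \<subseteq> gens p" "\<And>\<sigma>. \<sigma> \<in> auts \<Longrightarrow> qb s \<tau> \<sigma> = chi (of_int (\<Prod>I)) \<sigma>"
  shows "QuadRes (int p) (\<Prod>I)"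
proof (cases "p = 2")
  case True
  \<comment> \<open>Modulo 2 every integer is congruent to its own square.\<close>
  have "[(\<Prod>I)\<^sup>2 = \<Prod>I] (mod 2)" by (simp add: cong_iff_dvd_diff power2_eq_square)
  thus ?thesis using True by (auto simp: QuadRes_def)
next
  case False
  hence p2: "p > 2" using p prime_ge_2_nat[of p] by linarith
  let ?P = "of_nat p :: 'a" and ?r = "rt (of_nat p) :: 'a"
  have gSuc: "gens (Suc p) = insert (int p) (gens p)" using p by (simp add: gens_Suc)
  show ?thesis
  proof (rule ccontr)
    assume nonres: "\<not> QuadRes (int p) (\<Prod>I)"
    obtain n0 where n0: "\<forall>n\<ge>n0. s\<^sup>2 \<in> adjroots (gens n) \<and> (\<forall>\<tau>\<in>auts. \<tau> s / s \<in> adjroots (gens n))"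
      using qelts_ratio_adjroots[OF s] by (rule exE)
    define n where "n = max n0 (Suc p)"
    have n: "n \<ge> n0" "n \<ge> Suc p" by (auto simp: n_def)
    \<comment> \<open>The ratios of s live at level n. \<open>D\<close> omits p, so that they split
      as a + b sqrt p over a field unramified at p.\<close>
    define D where "D = gens n - {int p}"
    have pn: "int p \<in> gens n" using n(2) p by (auto simp: gens_def)
    have ins: "insert (int p) D = gens n" using pn by (auto simp: D_def)
    have basicI: "basic (insert (int p) D)" unfolding ins by (rule basic_gens)
    have pD: "int p \<notin> D" by (simp add: D_def)
    have basicD': "basic D" by (rule basic_subset[OF basicI]) blast
    have pg: "int p \<notin> gens p" by (auto simp: gens_def)
    have gpD: "gens p \<subseteq> D" using gens_mono[of p n] n(2) pg by (auto simp: D_def)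
    have ID: "I \<subseteq> D" using I(1) gpD by blast
    have finI: "finite I" using ID basic_finite[OF basicD'] finite_subset by blast
    \<comment> \<open>\<tau> is arbitrary on the roots of primes above p. Its replacement \<tau>'
      fixes those in \<open>D\<close> and agrees with \<tau> at level \<open>Suc p\<close>, which
      determines \<open>qf s\<close> and hence the commutator signs.\<close>
    obtain \<tau>' where \<tau>': "\<tau>' \<in> auts" "\<And>x. x \<in> adjroots D \<Longrightarrow> \<tau>' x = x" "\<tau>' ?r = - ?r"
      using aut_flip[OF basicI pD] by auto
    have agree: "\<tau>' x = \<tau> x" if "x \<in> adjroots (gens (Suc p))" for x
    proof (rule agree_adjroots[OF \<tau>'(1) \<tau>(1) _ that])
      fix d assume "d \<in> gens (Suc p)"
      hence "d = int p \<or> d \<in> gens p" using gSuc by blast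
      thus "\<tau>' (rt (of_int d)) = \<tau> (rt (of_int d))"
        using \<tau>(2,3) \<tau>'(2,3) rt_adjroots[of d "gens p"] rt_adjroots[of d D] gpD by auto
    qed
    have q\<tau>': "qf s \<tau>' = 1" using depends_onD[OF dep \<tau>'(1) \<tau>(1) agree] q\<tau> by simp
    have qb': "qb s \<tau>' \<sigma> = qb s \<tau> \<sigma>" if \<sigma>: "\<sigma> \<in> auts" for \<sigma>
    proof -
      have "qf s (\<tau>' \<circ> \<sigma>) = qf s (\<tau> \<circ> \<sigma>)"
        by (rule depends_onD[OF dep aut_comp(1)[OF \<tau>'(1) \<sigma>] aut_comp(1)[OF \<tau>(1) \<sigma>]])
          (simp add: agree stableD[OF stable_adjroots \<sigma>])
      thus ?thesis using q\<tau> q\<tau>' by (simp only: qb_def)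
    qed
    \<comment> \<open>Frobenius signs on \<open>D\<close>; the value 1 at p makes \<phi> fix sqrt
      p.\<close>
    define e where "e d = (if d = int p then 1 else of_int (Legendre d (int p)) :: 'a)" for d
    have Leg: "Legendre d (int p) = 1 \<or> Legendre d (int p) = -1" if "d \<in> D" for d
    proof -
      have "d = -1 \<or> prime d" "d \<noteq> int p" using that basicD[OF basicD'] pD by auto
      moreover have "prime (int p)" using p by simp
      ultimately have "\<not> int p dvd d" using p2 primes_dvd_imp_eq[of "int p" d] by auto
      thus ?thesis by (auto simp: Legendre_def cong_0_iff)
    qed
    obtain \<phi> where \<phi>: "\<phi> \<in> auts" "\<And>d. d \<in> gens n \<Longrightarrow> \<phi> (rt (of_int d)) = e d * rt (of_int d)"
    proof -
      have "e d = 1 \<or> e d = -1" if "d \<in> gens n" for d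
      proof (cases "d = int p")
        case False
        hence "d \<in> D" using that ins by blast
        thus ?thesis using Leg[of d] False by (auto simp: e_def)
      qed (simp add: e_def)
      thus ?thesis using that aut_with_signs[OF basic_gens[of n], of e] by blast
    qed
    have \<phi>r: "\<phi> ?r = ?r" using \<phi>(2)[OF pn] by (simp add: e_def)
    have sgn: "\<phi> (rt (of_int d)) = of_int (Legendre d (int p)) * rt (of_int d)" if "d \<in> D" for d
    proof -
      have "d \<noteq> int p" "d \<in> gens n" using that pD ins by blast+
      thus ?thesis using \<phi>(2)[of d] by (simp add: e_def)
    qed
    have "chi (of_int (\<Prod>I)) \<phi> = of_int (\<Prod>d\<in>I. Legendre d (int p))"
      using finI ID
    proof (induction I)
      case empty
      thus ?case using chi_1[OF \<phi>(1)] by simp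
    next
      case (insert d I)
      have "\<Prod>I \<noteq> 0" "d \<noteq> 0"
        using insert.prems basic_prod_nonzero[OF basic_subset[OF basicD', of I]] basic_nonzero[OF basicD', of d] by auto
      moreover have "chi (of_int d) \<phi> = of_int (Legendre d (int p))"
        by (rule chi_eqI[OF \<phi>(1) _ rt_square]) (use \<open>d \<noteq> 0\<close> sgn[of d] insert.prems in \<open>auto simp: rt_eq_0\<close>)
      ultimately show ?case using chi_mult[OF \<phi>(1) Rats_of_int Rats_of_int, of d "\<Prod>I"] insert by simp
    qed
    moreover have "(\<Prod>d\<in>I. Legendre d (int p)) = -1"
    proof -
      have "(\<Prod>d\<in>I. Legendre d (int p)) = 1 \<or> (\<Prod>d\<in>I. Legendre d (int p)) = -1"
        using finI ID
      proof (induction I)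
        case (insert d I)
        thus ?case using Leg[of d] by auto
      qed simp
      moreover have "[(\<Prod>d\<in>I. Legendre d (int p)) = (\<Prod>d\<in>I. d ^ ((p - 1) div 2))] (mod int p)"
        by (intro cong_prod euler_criterion p) (use p2 in auto)
      moreover have "(\<Prod>d\<in>I. d ^ ((p - 1) div 2)) = (\<Prod>I) ^ ((p - 1) div 2)"
        by (simp add: prod_power_distrib)
      moreover have "[Legendre (\<Prod>I) (int p) = (\<Prod>I) ^ ((p - 1) div 2)] (mod int p)"
        by (intro euler_criterion p) (use p2 in auto)
      moreover have "Legendre (\<Prod>I) (int p) = -1"
      proof -
        have "\<not> [\<Prod>I = 0] (mod int p)"
        proof
          assume "[\<Prod>I = 0] (mod int p)"
          hence "[0\<^sup>2 = \<Prod>I] (mod int p)" by (simp add: cong_sym)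
          thus False using nonres unfolding QuadRes_def by blast
        qed
        thus ?thesis using nonres by (simp add: Legendre_def)
      qed
      ultimately have "[(\<Prod>d\<in>I. Legendre d (int p)) = -1] (mod int p)" by (metis cong_sym cong_trans)
      moreover have "\<not> [1 = -1] (mod int p)" using p2 by (auto simp: cong_iff_dvd_diff dest: zdvd_imp_le)
      ultimately show ?thesis using \<open>_ \<or> (\<Prod>d\<in>I. Legendre d (int p)) = -1\<close> by auto
    qed
    ultimately have "chi (of_int (\<Prod>I)) \<phi> = -1" by simp
    hence qb\<phi>: "qb s \<tau>' \<phi> = -1" using qb'[OF \<phi>(1)] I(2)[OF \<phi>(1)] by simp
    \<comment> \<open>A multiplier as in Hilbert 90, making w s fixed by \<tau>'. The product w s is
      s + \<tau>' s unless this vanishes; in that case \<tau>' s = -s, and the factor sqrt p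
      corrects the sign.\<close>
    define w where "w = (if s + \<tau>' s = 0 then ?r else 1 + \<tau>' s / s)"
    have s0: "s \<noteq> 0" by (rule qelts_nonzero[OF s])
    have r0: "?r \<noteq> 0" using p2 by (simp add: rt_eq_0)
    have ratio: "\<sigma> s / s \<in> adjroots (gens n)" if "\<sigma> \<in> auts" for \<sigma> using n0 n(1) that by simp
    have rG: "?r \<in> adjroots (gens n)" using rt_adjroots[OF pn] by simp
    have w: "w \<in> adjroots (gens n)" "w \<noteq> 0" "\<tau>' (w * s) = w * s"
    proof -
      have "\<tau>' (\<tau>' s) = s" using qf_act(3)[OF s \<tau>'(1)] q\<tau>' by simp
      thus "\<tau>' (w * s) = w * s"
      proof (cases "s + \<tau>' s = 0")
        case True
        hence "\<tau>' s = - s" by (simp add: eq_neg_iff_add_eq_0 add.commute)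
        thus ?thesis using True \<tau>'(1,3) by (simp add: w_def autsD)
      next
        case False
        hence "w * s = s + \<tau>' s" using s0 by (simp add: w_def field_simps)
        thus ?thesis using \<tau>'(1) \<open>\<tau>' (\<tau>' s) = s\<close> by (simp add: autsD add.commute)
      qed
      show "w \<in> adjroots (gens n)"
        using rG ratio[OF \<tau>'(1)] by (auto simp: w_def intro: ratring_add ratring_1 ratring_adjroots)
      show "w \<noteq> 0" using s0 r0 by (auto simp: w_def field_simps)
    qed
    define t where "t = w * s"
    have wq: "w \<in> qelts" "\<And>\<sigma>. \<sigma> \<in> auts \<Longrightarrow> qf w \<sigma> = 1"
      using multiquad_qelts[OF _ w(2)] w(1) adjroots_multiquad by auto
    have t: "t \<in> qelts" "\<And>\<sigma>. \<sigma> \<in> auts \<Longrightarrow> qf t \<sigma> = qf s \<sigma>" "t \<noteq> 0"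
      using qelts_mult[OF wq(1) s] wq(2) w(2) s0 by (auto simp: t_def)
    have tt: "\<tau>' t = t" using w(3) by (simp add: t_def)
    \<comment> \<open>The commutator sign of \<tau>' and \<phi> is -1, so \<tau>' negates g and g =
      b sqrt p with b over \<open>D\<close>. On the other hand \<phi>(g) g =
      \<open>qf s \<phi>\<close> is 1 or -1.\<close>
    define g where "g = \<phi> t / t"
    have "g = (\<phi> w / w) * (\<phi> s / s)" using \<phi>(1) by (simp add: g_def t_def autsD)
    moreover have "\<phi> w / w \<in> adjroots (gens n)"
      by (rule ratring_divide[OF ratring_adjroots stableD[OF stable_adjroots \<phi>(1) w(1)] w(1) alg])
    ultimately have gG: "g \<in> adjroots (gens n)"
      using ratring_mult[OF ratring_adjroots _ ratio[OF \<phi>(1)]] by (simp only:)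
    have "qb t \<tau>' \<phi> = qb s \<tau>' \<phi>"
      unfolding qb_def t(2)[OF \<tau>'(1)] t(2)[OF \<phi>(1)] t(2)[OF aut_comp(1)[OF \<tau>'(1) \<phi>(1)]] ..
    hence "\<tau>' (\<phi> t) = - \<phi> t" using qb_act(2)[OF t(1) \<tau>'(1) \<phi>(1)] qb\<phi> tt by simp
    hence \<tau>g: "\<tau>' g = - g" using tt \<tau>'(1) by (simp add: g_def aut_divide)
    have \<phi>g: "\<phi> g * g = qf s \<phi>"
      using qf_act(3)[OF t(1) \<phi>(1)] t(2)[OF \<phi>(1)] t(3) \<phi>(1) by (simp add: g_def aut_divide aut_eq_0)
    obtain a b where ab: "a \<in> adjroots D" "b \<in> adjroots D" "g = a + b * ?r"
      using adjroots_insert[of g "int p" D] gG ins by auto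
    have "a = 0" using \<tau>g \<tau>'(1,3) \<tau>'(2)[OF ab(1)] \<tau>'(2)[OF ab(2)] unfolding ab(3) by (simp add: autsD)
    hence "?P * (\<phi> b * b) = qf s \<phi>"
      using \<phi>g \<phi>r rt_square[of ?P] \<phi>(1) unfolding ab(3) by (simp add: autsD power2_eq_square mult_ac)
    \<comment> \<open>Clearing the denominator m of b turns p b \<phi>(b) =
      \<open>qf s \<phi>\<close> into an equation excluded by \<open>frobenius_norm\<close>.\<close>
    moreover obtain c m where cm: "c \<in> introots D" "m \<noteq> 0" "b = c / of_int m" using adjroots_fraction[OF ab(2)] by blast
    ultimately have "?P * (c * \<phi> c) = qf s \<phi> * of_int m ^ 2"
      using \<phi>(1) by (simp add: aut_simps field_simps power2_eq_square)
    moreover have "?P * (c * \<phi> c) \<noteq> of_int (e' * m\<^sup>2)" if "e' = 1 \<or> e' = -1" for e'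
      by (rule frobenius_norm[OF p p2 basicD' \<phi>(1) sgn cm(1,2) that])
    from this[of 1] this[of "-1"] have "?P * (c * \<phi> c) \<noteq> of_int m ^ 2" "?P * (c * \<phi> c) \<noteq> - (of_int m ^ 2)" by auto
    ultimately show False using qf_act(1)[OF s \<phi>(1)] by auto
  qed
qed

lemma rt_minus_one_adjroots: "rt (-1) \<in> adjroots (gens n)"
  using rt_adjroots[of "-1" "gens n"] by (simp add: gens_def)

section \<open>Tate's relation at a single prime\<close>

context
  fixes F :: "'a set"
  assumes F: "ratring F" and multiquad_F: "multiquad \<subseteq> F"
    and split_F: "\<And>a b x y. \<lbrakk>a \<in> \<rat>; b \<in> \<rat>; x \<in> \<rat>; y \<in> \<rat>; a \<noteq> 0; b \<noteq> 0; a * x\<^sup>2 + b * y\<^sup>2 = 1\<rbrakk> \<Longrightarrow>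
      \<exists>f\<in>qelts \<inter> F. \<forall>\<sigma>\<in>auts. qf f \<sigma> = hilb a b \<sigma>"
begin

text \<open>The symbol \<open>(p, b)\<close> is split, up to a form in which only \<open>-1\<close> and primes below \<open>p\<close> occur.\<close>

definition tate :: "nat \<Rightarrow> 'a \<Rightarrow> bool" where
  "tate p b \<longleftrightarrow> b \<in> \<rat> \<and> b \<noteq> 0 \<and>
     (\<exists>f\<in>qelts \<inter> F. depends_on (adjroots (gens p)) (\<lambda>\<sigma>. qf f \<sigma> * hilb (of_nat p) b \<sigma>) auts)"

lemma tate_mult:
  assumes "tate p b" "tate p c" shows "tate p (b * c)"
proof -
  obtain f g where fg: "f \<in> qelts \<inter> F" "g \<in> qelts \<inter> F"
    "depends_on (adjroots (gens p)) (\<lambda>\<sigma>. qf f \<sigma> * hilb (of_nat p) b \<sigma>) auts"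
    "depends_on (adjroots (gens p)) (\<lambda>\<sigma>. qf g \<sigma> * hilb (of_nat p) c \<sigma>) auts"
    using assms unfolding tate_def by blast
  have bc: "b \<in> \<rat>" "c \<in> \<rat>" "b \<noteq> 0" "c \<noteq> 0" using assms by (auto simp: tate_def)
  have eq: "qf (f * g) \<sigma> * hilb (of_nat p) (b * c) \<sigma> =
      (qf f \<sigma> * hilb (of_nat p) b \<sigma>) * (qf g \<sigma> * hilb (of_nat p) c \<sigma>)" if "\<sigma> \<in> auts" for \<sigma>
    using qelts_mult(2)[of f g \<sigma>] fg(1,2) hilb_mult_right[OF that bc] that by (simp add: mult_ac)
  have "depends_on (adjroots (gens p)) (\<lambda>\<sigma>. qf (f * g) \<sigma> * hilb (of_nat p) (b * c) \<sigma>) auts"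
    by (rule depends_on_cong[OF depends_on_mult[OF fg(3,4)]]) (rule eq)
  moreover have "f * g \<in> qelts \<inter> F" using fg(1,2) qelts_mult(1) ratring_mult[OF F] by blast
  ultimately show ?thesis using bc unfolding tate_def by (intro conjI bexI[of _ "f * g"]) auto
qed

lemma one_qelts_F: "1 \<in> qelts \<inter> F" "\<sigma> \<in> auts \<Longrightarrow> qf 1 \<sigma> = 1"
  using multiquad_qelts[of 1] ratring_1[OF ratring_multiquad] ratring_1[OF F] by auto

lemma tate_square: "r \<in> \<rat> \<Longrightarrow> r \<noteq> 0 \<Longrightarrow> tate p (r\<^sup>2)"
  unfolding tate_def using one_qelts_F
  by (intro conjI bexI[of _ 1]) (auto simp: depends_on_def hilb_square)

lemma tate_cancel_square:
  assumes "tate p (b * r\<^sup>2)" "b \<in> \<rat>" "r \<in> \<rat>" "r \<noteq> 0" shows "tate p b"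
proof -
  have "tate p ((b * r\<^sup>2) * (inverse r)\<^sup>2)"
    by (rule tate_mult[OF assms(1) tate_square]) (use assms(3,4) in auto)
  moreover have "(b * r\<^sup>2) * (inverse r)\<^sup>2 = b" using assms(4) by (simp add: power_inverse)
  ultimately show ?thesis by (simp only:)
qed

lemma hilb_mult_square:
  assumes "\<sigma> \<in> auts" "b \<in> \<rat>" "r \<in> \<rat>" "b \<noteq> 0" "r \<noteq> 0"
  shows "hilb a (b * r\<^sup>2) \<sigma> = hilb a b \<sigma>" "hilb (b * r\<^sup>2) a \<sigma> = hilb b a \<sigma>"
  using hilb_mult_right[OF assms(1,2) _ assms(4), of "r\<^sup>2" a] hilb_square[OF assms(1,3,5), of a] assms
  by (simp_all add: hilb_commute[of _ a])

text \<open>The relation of Tate's computation of \<open>K\<^sub>2\<close> of the rationals: if \<open>x y = z + p r\<close>, the symbol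
  \<open>(z/xy, p r/xy)\<close> is split, and it equals \<open>(p, xyz)\<close> up to a symbol of integers below \<open>p\<close>.\<close>

lemma tate_product_residue:
  assumes p: "prime p" and x: "0 < x" "x < p" and y: "0 < y" "y < p"
  shows "tate p (of_nat (x * y * ((x * y) mod p)))"
proof -
  define z where "z = (x * y) mod p"
  define r where "r = (x * y) div p"
  have eq: "x * y = z + p * r" by (simp add: z_def r_def)
  have "\<not> p dvd x * y" using p x y by (auto simp: prime_dvd_mult_iff dest: dvd_imp_le)
  hence z0: "z > 0" by (auto simp: z_def dvd_eq_mod_eq_0)
  have zp: "z < p" using x by (simp add: z_def)
  have "tate p (of_nat (x * y * z))"
  proof (cases "r = 0")
    case True
    hence "x * y * z = z\<^sup>2" using eq by (simp add: power2_eq_square)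
    thus ?thesis using tate_square[of "of_nat z" p] z0 by simp
  next
    case False
    have "p * r < p * p"
    proof -
      have "x * y < p * p" using x y by (intro mult_strict_mono) auto
      thus ?thesis using eq by linarith
    qed
    hence rp: "r < p" by simp
    define x1 y1 z1 r1 p1 where "x1 = (of_nat x :: 'a)" and "y1 = (of_nat y :: 'a)" and "z1 = (of_nat z :: 'a)"
      and "r1 = (of_nat r :: 'a)" and "p1 = (of_nat p :: 'a)"
    note defs = x1_def y1_def z1_def r1_def p1_def
    have nz: "x1 \<noteq> 0" "y1 \<noteq> 0" "z1 \<noteq> 0" "r1 \<noteq> 0" "p1 \<noteq> 0" using x y z0 False by (auto simp: defs)
    have rat: "x1 \<in> \<rat>" "y1 \<in> \<rat>" "z1 \<in> \<rat>" "r1 \<in> \<rat>" "p1 \<in> \<rat>" by (auto simp: defs)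
    have e: "x1 * y1 = z1 + p1 * r1" using eq by (metis defs of_nat_add of_nat_mult)
    \<comment> \<open>These are z / (x y) and p r / (x y), with sum 1, written as integers times a
      common square so that their square classes can be read off.\<close>
    let ?a = "(x1 * y1 * z1) * (inverse (x1 * y1))\<^sup>2" and ?b = "(p1 * (r1 * x1 * y1)) * (inverse (x1 * y1))\<^sup>2"
    have "?a * 1\<^sup>2 + ?b * 1\<^sup>2 = (z1 + p1 * r1) / (x1 * y1)" using nz by (simp add: field_simps power2_eq_square)
    also have "\<dots> = 1" unfolding e[symmetric] using nz by simp
    finally obtain f where f: "f \<in> qelts \<inter> F" "\<And>\<sigma>. \<sigma> \<in> auts \<Longrightarrow> qf f \<sigma> = hilb ?a ?b \<sigma>"
      using split_F[of ?a ?b 1 1] nz rat by fastforce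
    \<comment> \<open>(x y z, p r x y) is the product of (x y z, p) and (x y z, r x y); the second
      symbol involves only products of integers below p.\<close>
    have h: "qf f \<sigma> * hilb p1 (x1 * y1 * z1) \<sigma> = hilb (x1 * y1 * z1) (r1 * x1 * y1) \<sigma>" if \<sigma>: "\<sigma> \<in> auts" for \<sigma>
    proof -
      have "hilb ?a ?b \<sigma> = hilb (x1 * y1 * z1) ?b \<sigma>"
        by (rule hilb_mult_square(2)[OF \<sigma>]) (use nz rat in auto)
      also have "\<dots> = hilb (x1 * y1 * z1) (p1 * (r1 * x1 * y1)) \<sigma>"
        by (rule hilb_mult_square(1)[OF \<sigma>]) (use nz rat in auto)
      also have "\<dots> = hilb (x1 * y1 * z1) p1 \<sigma> * hilb (x1 * y1 * z1) (r1 * x1 * y1) \<sigma>"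
        by (rule hilb_mult_right[OF \<sigma>]) (use nz rat in auto)
      finally show ?thesis
        using f(2)[OF \<sigma>] hilb_self_mult[of p1 "x1 * y1 * z1" \<sigma>] by (simp add: hilb_commute[of _ p1] mult_ac)
    qed
    have rts: "rt x1 \<in> adjroots (gens p)" "rt y1 \<in> adjroots (gens p)" "rt z1 \<in> adjroots (gens p)" "rt r1 \<in> adjroots (gens p)"
      using x y z0 zp rp False by (auto simp: defs intro!: rt_of_nat_adjroots)
    have "depends_on (adjroots (gens p)) (hilb (x1 * y1 * z1) (r1 * x1 * y1)) auts"
      using nz rts by (intro depends_on_hilb rt_mult_adjroots) auto
    hence "depends_on (adjroots (gens p)) (\<lambda>\<sigma>. qf f \<sigma> * hilb p1 (x1 * y1 * z1) \<sigma>) auts"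
      by (rule depends_on_cong) (rule h)
    hence "tate p (x1 * y1 * z1)" using f(1) nz rat unfolding tate_def defs by auto
    thus ?thesis by (simp add: defs)
  qed
  thus ?thesis by (simp add: z_def)
qed

text \<open>Replace the generators by residues one at a time. A prime q below p is its own residue,
  giving the square q^2; for -1 the residue is p - 1, and (p, 1 - p) is split because p + (1 - p) =
  1. \<open>tate_product_residue\<close> merges residues z and y into z y mod p, up to the square (z
  y)^2.\<close>

lemma tate_congruent:
  assumes p: "prime p" and I: "I \<subseteq> gens p"
  shows "\<exists>z. 0 < z \<and> z < p \<and> [\<Prod>I = int z] (mod int p) \<and> tate p (of_int (\<Prod>I) * of_nat z)"
proof -
  have p2: "p \<ge> 2" using p by (rule prime_ge_2_nat)
  have gen: "\<exists>y. 0 < y \<and> y < p \<and> [d = int y] (mod int p) \<and> tate p (of_int d * of_nat y)" if d: "d \<in> gens p" for d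
  proof (cases "d = -1")
    case True
    obtain f where f: "f \<in> qelts \<inter> F" "\<And>\<sigma>. \<sigma> \<in> auts \<Longrightarrow> qf f \<sigma> = hilb (of_nat p) (1 - of_nat p) \<sigma>"
      using split_F[of "of_nat p" "1 - of_nat p" 1 1] p2 by fastforce
    have e: "of_int d * of_nat (p - 1) = (1 - of_nat p :: 'a)" using True p2 by (simp add: of_nat_diff)
    have "(1 - of_nat p :: 'a) \<noteq> 0" using p2 of_nat_eq_1_iff[where ?'a = 'a, of p] by auto
    hence "tate p (of_int d * of_nat (p - 1))"
      unfolding e tate_def using f by (auto intro!: bexI[of _ f] simp: depends_on_def hilb_self_mult)
    moreover have "[d = int (p - 1)] (mod int p)"
      using p2 True by (simp add: cong_iff_dvd_diff of_nat_diff)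
    ultimately show ?thesis using p2 by (intro exI[of _ "p - 1"]) auto
  next
    case False
    then obtain q where q: "d = int q" "prime q" "q < p" using d by (auto simp: gens_def)
    have "tate p ((of_nat q)\<^sup>2)" using q(2) by (intro tate_square) (auto simp: prime_gt_0_nat)
    thus ?thesis using q prime_gt_0_nat[OF q(2)] by (intro exI[of _ q]) (auto simp: power2_eq_square)
  qed
  have "finite I" using I finite_gens finite_subset by blast
  thus ?thesis using I
  proof (induction I)
    case empty
    show ?case using tate_square[of 1 p] p2 by (intro exI[of _ 1]) auto
  next
    case (insert d I)
    then obtain z where z: "0 < z" "z < p" "[\<Prod>I = int z] (mod int p)" "tate p (of_int (\<Prod>I) * of_nat z)" by blast
    obtain y where y: "0 < y" "y < p" "[d = int y] (mod int p)" "tate p (of_int d * of_nat y)"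
      using gen[of d] insert.prems by blast
    define z' where "z' = (z * y) mod p"
    have "\<not> p dvd z * y" using p y z by (auto simp: prime_dvd_mult_iff dest: dvd_imp_le)
    hence z'0: "z' > 0" by (auto simp: z'_def dvd_eq_mod_eq_0)
    have "tate p ((of_int (\<Prod>I) * of_nat z) * (of_int d * of_nat y) * of_nat (z * y * z'))"
      unfolding z'_def by (intro tate_mult z(4) y(4) tate_product_residue p z(1,2) y(1,2))
    also have "(of_int (\<Prod>I) * of_nat z) * (of_int d * of_nat y) * of_nat (z * y * z') =
        (of_int (\<Prod>(insert d I)) * of_nat z' :: 'a) * (of_nat (z * y))\<^sup>2"
    proof -
      have "\<Prod>(insert d I) = d * \<Prod>I" using insert.hyps by simp
      hence "of_int (\<Prod>(insert d I)) = (of_int d * of_int (\<Prod>I) :: 'a)" by (simp only: of_int_mult)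
      moreover have "(a * b) * (c * d) * ((b * d) * e) = (c * a * e) * (b * d)\<^sup>2" for a b c d e :: 'a
        by (simp add: power2_eq_square mult_ac)
      ultimately show ?thesis by (simp only: of_nat_mult)
    qed
    finally have "tate p (of_int (\<Prod>(insert d I)) * of_nat z')"
      by (rule tate_cancel_square) (use z(1) y(1) in \<open>auto simp del: of_nat_mult of_int_prod\<close>)
    moreover have "[\<Prod>(insert d I) = int z'] (mod int p)"
    proof -
      have "[d * \<Prod>I = int y * int z] (mod int p)" by (intro cong_mult z y)
      moreover have "[int y * int z = int z'] (mod int p)"
        unfolding z'_def by (simp add: cong_def of_nat_mod mult.commute)
      ultimately show ?thesis using insert.hyps by (auto intro: cong_trans)
    qed
    moreover have "z' < p" using p2 by (simp add: z'_def)
    ultimately show ?case using z'0 by blast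
  qed
qed

text \<open>\<open>tate_congruent\<close> reduces the claim to a residue z between 0 and p. If z =
  x^2 modulo p, the product relation with both factors equal to x yields x^2 z, and squares
  cancel.\<close>

lemma tate_quadratic_residue:
  assumes p: "prime p" and I: "I \<subseteq> gens p" and res: "QuadRes (int p) (\<Prod>I)"
  shows "tate p (of_int (\<Prod>I))"
proof -
  obtain z where z: "0 < z" "z < p" "[\<Prod>I = int z] (mod int p)" "tate p (of_int (\<Prod>I) * of_nat z)"
    using tate_congruent[OF p I] by blast
  obtain w where w: "[w\<^sup>2 = \<Prod>I] (mod int p)" using res by (auto simp: QuadRes_def)
  have p0: "p > 0" using z by simp
  define x where "x = nat (w mod int p)"
  have xw: "int x = w mod int p" using p0 by (simp add: x_def)
  have "[int x * int x = int z] (mod int p)"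
  proof -
    have "[int x = w] (mod int p)" by (simp add: xw cong_def)
    hence "[int x * int x = w * w] (mod int p)" by (intro cong_mult)
    thus ?thesis using w z(3) by (metis cong_trans power2_eq_square)
  qed
  hence "[x * x = z] (mod p)" by (metis cong_int_iff of_nat_mult)
  hence xz: "(x * x) mod p = z" using z(2) by (simp add: cong_def)
  have x0: "x > 0" using xz z(1) by (intro Nat.gr0I) auto
  have xp: "x < p" using xw p0 by (metis of_nat_less_iff pos_mod_bound of_nat_0_less_iff)
  have "tate p (of_nat (x * x * z))" using tate_product_residue[OF p x0 xp x0 xp] by (simp add: xz)
  hence "tate p (of_nat z * (of_nat x)\<^sup>2)" by (simp add: power2_eq_square mult_ac)
  hence "tate p (of_nat z)" by (rule tate_cancel_square) (use x0 in auto)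
  from tate_mult[OF z(4) this] have "tate p (of_int (\<Prod>I) * (of_nat z)\<^sup>2)" by (simp add: power2_eq_square mult_ac)
  thus ?thesis by (rule tate_cancel_square) (use z(1) in auto)
qed

text \<open>The character \<open>qb s \<tau>\<close> equals \<open>chi u\<close> for some u free of
  p. Passing from \<sigma> to \<tau> \<sigma> multiplies both \<open>qf s\<close> and the symbol (p,
  u) by \<open>chi u \<sigma>\<close>, so their product is invariant under \<tau> and descends to
  the level below.\<close>

lemma remove_prime_unramified:
  assumes p: "prime p" and s: "s \<in> qelts"
    and dep: "depends_on (adjroots (gens (Suc p))) (qf s) auts"
    and \<tau>: "\<tau> \<in> auts" "\<And>x. x \<in> adjroots (gens p) \<Longrightarrow> \<tau> x = x" "\<tau> (rt (of_nat p)) = - rt (of_nat p)"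
    and q\<tau>: "qf s \<tau> = 1"
  shows "\<exists>f\<in>qelts \<inter> F. depends_on (adjroots (gens p)) (qf (s * f)) auts"
proof -
  have gSuc: "gens (Suc p) = insert (int p) (gens p)" using p by (simp add: gens_Suc)
  have basicI: "basic (insert (int p) (gens p))" using basic_gens[of "Suc p"] by (simp add: gSuc)
  have pg: "int p \<notin> gens p" by (auto simp: gens_def)
  have p0: "(of_nat p :: 'a) \<noteq> 0" using p by (simp add: prime_gt_0_nat)
  have \<tau>3: "\<tau> (rt (of_int (int p))) = - rt (of_int (int p))" using \<tau>(3) by simp
  have dep': "depends_on (adjroots (insert (int p) (gens p))) (qf s) auts" using dep by (simp add: gSuc)
  \<comment> \<open>\<tau> is an involution at this level, so \<open>qb s \<tau>\<close> is trivial
    on \<tau>; by linearity it descends to level p, which is why u contains no factor p.\<close>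
  have "qb s \<tau> \<tau> = 1"
  proof -
    have "qf s (\<tau> \<circ> \<tau>) = qf s id"
    proof (rule depends_onD[OF dep aut_comp(1)[OF \<tau>(1,1)] aut_id(1)])
      fix x assume "x \<in> adjroots (gens (Suc p))"
      hence "x \<in> multiquad" using adjroots_multiquad by blast
      from multiquad_involution[OF this \<tau>(1)] show "(\<tau> \<circ> \<tau>) x = id x" by simp
    qed
    also have "\<dots> = 1" using qelts_nonzero[OF s] by (simp add: qf_def)
    finally show ?thesis unfolding qb_def using q\<tau> by simp
  qed
  hence "depends_on (adjroots (gens p)) (qb s \<tau>) auts"
    by (intro depends_on_flip[OF basicI pg \<tau>(1,2) \<tau>3] depends_on_qb[OF dep' stable_adjroots \<tau>(1)])
      (use qb_comp[OF s \<tau>(1,1)] in \<open>metis mult_1\<close>)+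
  from quadratic_character[OF basic_gens qb_comp[OF s \<tau>(1)] qb_act(3)[OF s \<tau>(1)] this]
  obtain I where I: "I \<subseteq> gens p" "\<And>\<sigma>. \<sigma> \<in> auts \<Longrightarrow> qb s \<tau> \<sigma> = chi (of_int (\<Prod>I)) \<sigma>" by blast
  define u where "u = (of_int (\<Prod>I) :: 'a)"
  have u0: "u \<noteq> 0" "u \<in> \<rat>" unfolding u_def of_int_eq_0_iff
    by (rule basic_prod_nonzero[OF basic_subset[OF basic_gens I(1)]], rule Rats_of_int)
  have "tate p u" unfolding u_def
    by (intro tate_quadratic_residue p I(1) residue_of_commutator_character[OF p s dep \<tau> q\<tau> I])
  then obtain f where f: "f \<in> qelts" "f \<in> F"
    "depends_on (adjroots (gens p)) (\<lambda>\<sigma>. qf f \<sigma> * hilb (of_nat p) u \<sigma>) auts"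
    unfolding tate_def by blast
  define h where "h = (\<lambda>\<sigma>. qf f \<sigma> * hilb (of_nat p) u \<sigma>)"
  have h_dep: "depends_on (adjroots (gens p)) h auts" unfolding h_def by (rule f(3))
  have sub: "adjroots (gens p) \<subseteq> adjroots (insert (int p) (gens p))" by (rule adjroots_mono) blast
  have ru: "rt u \<in> adjroots (gens p)" unfolding u_def by (rule rt_prod_adjroots[OF I(1) finite_gens])
  have rp: "rt (of_nat p) \<in> adjroots (insert (int p) (gens p))"
    using rt_adjroots[of "int p" "insert (int p) (gens p)"] by simp
  have qf_f: "qf f \<sigma> = h \<sigma> * hilb (of_nat p) u \<sigma>" for \<sigma>
    using hilb_self_mult[of "of_nat p" u \<sigma>] by (simp add: mult.assoc h_def)
  have eq: "qf (s * f) \<sigma> = qf s \<sigma> * (h \<sigma> * hilb (of_nat p) u \<sigma>)" if "\<sigma> \<in> auts" for \<sigma>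
    using qelts_mult(2)[OF s f(1) that] qf_f[of \<sigma>] by simp
  have "depends_on (adjroots (insert (int p) (gens p))) (\<lambda>\<sigma>. qf s \<sigma> * (h \<sigma> * hilb (of_nat p) u \<sigma>)) auts"
    using sub ru rp p0 u0 by (intro depends_on_mult dep' depends_on_mono[OF h_dep] depends_on_hilb) auto
  hence dep2: "depends_on (adjroots (insert (int p) (gens p))) (qf (s * f)) auts"
    by (rule depends_on_cong) (rule eq)
  have inv: "qf (s * f) (\<tau> \<circ> \<sigma>) = qf (s * f) \<sigma>" if \<sigma>: "\<sigma> \<in> auts" for \<sigma>
  proof -
    have \<tau>\<sigma>: "\<tau> \<circ> \<sigma> \<in> auts" by (rule aut_comp(1)[OF \<tau>(1) \<sigma>])
    have h: "h (\<tau> \<circ> \<sigma>) = h \<sigma>"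
      by (rule depends_onD[OF h_dep \<tau>\<sigma> \<sigma>]) (use \<tau>(2) stableD[OF stable_adjroots \<sigma>] in auto)
    have cp: "chi (of_nat p) (\<tau> \<circ> \<sigma>) = - chi (of_nat p) \<sigma>"
    proof -
      have "chi (of_nat p) \<tau> = -1" using \<tau>(3) p0 by (simp add: chi_def rt_eq_0)
      thus ?thesis using chi_comp[OF \<tau>(1) \<sigma> Rats_of_nat p0] by simp
    qed
    have cu: "chi u (\<tau> \<circ> \<sigma>) = chi u \<sigma>"
      using chi_eq_chi_iff[OF u0(1), of "\<tau> \<circ> \<sigma>" \<sigma>] \<tau>(2)[OF stableD[OF stable_adjroots \<sigma> ru]] by simp
    have "hilb (of_nat p) u (\<tau> \<circ> \<sigma>) = chi u \<sigma> * hilb (of_nat p) u \<sigma>"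
      unfolding hilb_def cp cu using chi_act(2)[OF \<sigma> Rats_of_nat p0] chi_act(2)[OF \<sigma> u0(2,1)] by auto
    moreover have "qf s (\<tau> \<circ> \<sigma>) = qf s \<sigma> * chi u \<sigma>"
      using qb_act(4)[OF s \<tau>(1) \<sigma>] q\<tau> I(2)[OF \<sigma>] by (simp add: u_def)
    ultimately have "qf (s * f) (\<tau> \<circ> \<sigma>) = qf (s * f) \<sigma> * (chi u \<sigma> * chi u \<sigma>)"
      unfolding eq[OF \<tau>\<sigma>] eq[OF \<sigma>] h by (simp only: mult_ac)
    thus ?thesis using chi_self[OF \<sigma> u0(2,1)] by (simp only: mult_1_right)
  qed
  have "depends_on (adjroots (gens p)) (qf (s * f)) auts"
    by (rule depends_on_flip[OF basicI pg \<tau>(1) _ \<tau>3 dep2]) (rule \<tau>(2), assumption, rule inv)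
  thus ?thesis using f(1,2) by blast
qed

text \<open>If \<open>qf s \<tau>\<close> is -1, multiply s by a quadratic element for the split
  symbol (p, -p). Its value at \<tau> is -1, because \<tau> flips sqrt p and fixes sqrt -1.\<close>

lemma remove_prime:
  assumes p: "prime p" and s: "s \<in> qelts"
    and dep: "depends_on (adjroots (gens (Suc p))) (qf s) auts"
  shows "\<exists>f\<in>qelts \<inter> F. depends_on (adjroots (gens p)) (qf (s * f)) auts"
proof -
  have gSuc: "gens (Suc p) = insert (int p) (gens p)" using p by (simp add: gens_Suc)
  have basicI: "basic (insert (int p) (gens p))" using basic_gens[of "Suc p"] by (simp add: gSuc)
  have pg: "int p \<notin> gens p" by (auto simp: gens_def)
  define P where "P = (of_nat p :: 'a)"
  have P: "P \<noteq> 0" "P \<in> \<rat>" using p by (auto simp: P_def prime_gt_0_nat)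
  obtain \<tau> where \<tau>: "\<tau> \<in> auts" "\<And>x. x \<in> adjroots (gens p) \<Longrightarrow> \<tau> x = x" "\<tau> (rt (of_nat p)) = - rt (of_nat p)"
    using aut_flip[OF basicI pg] by auto
  show ?thesis
  proof (cases "qf s \<tau> = 1")
    case True
    thus ?thesis using remove_prime_unramified[OF p s dep \<tau>] by blast
  next
    case False
    hence m: "qf s \<tau> = -1" using qf_act(1)[OF s \<tau>(1)] by blast
    \<comment> \<open>The numbers x and y satisfy x + y = 1 and x - y = 1 / P, so P x^2 - P y^2 =
      1.\<close>
    have "P * ((1 + inverse P) / 2)\<^sup>2 + - P * ((1 - inverse P) / 2)\<^sup>2 = 1"
      using P by (simp add: field_simps power2_eq_square)
    then obtain g where g: "g \<in> qelts" "g \<in> F" "\<And>\<sigma>. \<sigma> \<in> auts \<Longrightarrow> qf g \<sigma> = hilb P (- P) \<sigma>"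
      using split_F[of P "- P" "(1 + inverse P) / 2" "(1 - inverse P) / 2"] P by auto
    have "chi P \<tau> = -1" using \<tau>(3) P by (simp add: chi_def rt_eq_0 P_def)
    moreover have "chi (-1) \<tau> = 1" using \<tau>(2)[OF rt_minus_one_adjroots] by (simp add: chi_eq_1_iff)
    hence "chi (- P) \<tau> = chi P \<tau>" using chi_mult[OF \<tau>(1), of "-1" P] P by simp
    ultimately have "qf g \<tau> = -1" using g(3)[OF \<tau>(1)] by (simp add: hilb_def)
    hence one: "qf (s * g) \<tau> = 1" using qelts_mult(2)[OF s g(1) \<tau>(1)] m by simp
    have rP: "rt P \<in> adjroots (gens (Suc p))" using rt_adjroots[of "int p" "gens (Suc p)"] by (simp add: P_def gSuc)
    have "rt (- P) \<in> adjroots (gens (Suc p))"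
      using rt_mult_adjroots[OF rt_minus_one_adjroots rP] by simp
    hence "depends_on (adjroots (gens (Suc p))) (hilb P (- P)) auts"
      using P rP by (intro depends_on_hilb) auto
    from depends_on_mult[OF dep this] have "depends_on (adjroots (gens (Suc p))) (qf (s * g)) auts"
      by (rule depends_on_cong) (simp add: qelts_mult(2)[OF s g(1)] g(3))
    from remove_prime_unramified[OF p qelts_mult(1)[OF s g(1)] this \<tau> one]
    obtain f where f: "f \<in> qelts" "f \<in> F" "depends_on (adjroots (gens p)) (qf (s * g * f)) auts" by blast
    have "g * f \<in> qelts \<inter> F" using f g qelts_mult(1) ratring_mult[OF F] by blast
    thus ?thesis using f(3) by (intro bexI[of _ "g * f"]) (simp_all add: mult.assoc)
  qed
qed

end

end

section \<open>The real place\<close>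

text \<open>The square of a + b sqrt d contributes d b^2 to the smaller field. Positive rational
  weights absorb the factor d and so let an induction over square roots go through.\<close>

definition formally_real :: "'a::field_char_0 set \<Rightarrow> bool" where
  "formally_real L \<longleftrightarrow> (\<forall>xs. (\<forall>(r, x)\<in>set xs. r > 0 \<and> x \<in> L) \<longrightarrow>
     (\<Sum>(r, x)\<leftarrow>xs. of_rat r * x\<^sup>2) = 0 \<longrightarrow> (\<forall>(r, x)\<in>set xs. x = 0))"

lemma formally_real_Rats: "formally_real (\<rat> :: 'a::field_char_0 set)"
  unfolding formally_real_def
proof (intro allI impI)
  fix xs :: "(rat \<times> 'a) list"
  assume xs: "\<forall>(r, x)\<in>set xs. r > 0 \<and> x \<in> \<rat>" and "(\<Sum>(r, x)\<leftarrow>xs. of_rat r * x\<^sup>2) = 0"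
  define ys where "ys = map (\<lambda>(r, x). (r, inv_into UNIV of_rat x :: rat)) xs"
  have xs_ys: "xs = map (\<lambda>(r, y). (r, of_rat y)) ys"
    unfolding ys_def map_map o_def
    by (rule sym, rule map_idI) (use xs in \<open>auto simp: Rats_def f_inv_into_f\<close>)
  have "(\<Sum>(r, x)\<leftarrow>xs. of_rat r * x\<^sup>2) = (of_rat (\<Sum>(r, y)\<leftarrow>ys. r * y\<^sup>2) :: 'a)"
    unfolding xs_ys by (induction ys) (auto simp: of_rat_add of_rat_mult of_rat_power)
  hence "(\<Sum>(r, y)\<leftarrow>ys. r * y\<^sup>2) = 0" using \<open>(\<Sum>(r, x)\<leftarrow>xs. of_rat r * x\<^sup>2) = 0\<close> by simp
  have pos: "r > 0" if "(r, y) \<in> set ys" for r y using xs that by (auto simp: xs_ys)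
  have nonneg: "0 \<le> z" if z: "z \<in> set (map (\<lambda>(r, y). r * y\<^sup>2) ys)" for z
  proof -
    obtain r y where "(r, y) \<in> set ys" "z = r * y\<^sup>2" using z by auto
    thus ?thesis using pos[of r y] by (simp add: mult_nonneg_nonneg)
  qed
  have "\<forall>z\<in>set (map (\<lambda>(r, y). r * y\<^sup>2) ys). z = 0"
    using \<open>(\<Sum>(r, y)\<leftarrow>ys. r * y\<^sup>2) = 0\<close> sum_list_nonneg_eq_0_iff[OF nonneg] by blast
  hence "y = 0" if "(r, y) \<in> set ys" for r y using that pos by fastforce
  thus "\<forall>(r, x)\<in>set xs. x = 0" unfolding xs_ys by auto
qed

context algebraic_numbers
begin

text \<open>Expand each x as a + b sqrt d. The total coefficient C of sqrt d vanishes, for otherwise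
  sqrt d would lie in the smaller field; what remains is a sum of squares there with the weights r
  and r d.\<close>

lemma formally_real_adjroots:
  assumes "finite D" "\<And>d. d \<in> D \<Longrightarrow> d > 0"
  shows "formally_real (adjroots D)"
  using assms
proof (induction D)
  case empty
  have "adjroots {} = \<rat>" using adjroots_empty ratring_rat[OF ratring_adjroots, of _ "{}"] by blast
  thus ?case using formally_real_Rats by simp
next
  case (insert d D)
  hence IH: "formally_real (adjroots D)" by simp
  have d: "d > 0" using insert.prems by simp
  let ?r = "rt (of_int d) :: 'a"
  show ?case
  proof (cases "?r \<in> adjroots D")
    case True
    thus ?thesis using IH adjroots_insert_absorb by simp
  next
    case False
    show ?thesis
      unfolding formally_real_def
    proof (intro allI impI)
      fix xs :: "(rat \<times> 'a) list"
      assume xs: "\<forall>(r, x)\<in>set xs. r > 0 \<and> x \<in> adjroots (insert d D)"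
        and sum: "(\<Sum>(r, x)\<leftarrow>xs. of_rat r * x\<^sup>2) = 0"
      have "\<exists>a b. a \<in> adjroots D \<and> b \<in> adjroots D \<and> x = a + b * ?r" if "x \<in> adjroots (insert d D)" for x
        using adjroots_insert[OF that] by blast
      then obtain a b where ab: "\<And>x. x \<in> adjroots (insert d D) \<Longrightarrow> a x \<in> adjroots D"
        "\<And>x. x \<in> adjroots (insert d D) \<Longrightarrow> b x \<in> adjroots D"
        "\<And>x. x \<in> adjroots (insert d D) \<Longrightarrow> x = a x + b x * ?r" by metis
      define A where "A = (\<lambda>(r :: rat, x). (r, a x))"
      define B where "B = (\<lambda>(r :: rat, x). (r * of_int d, b x))"
      define ys where "ys = map A xs @ map B xs"
      define C where "C = (\<Sum>(r, x)\<leftarrow>xs. 2 * of_rat r * a x * b x)"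
      have "(\<Sum>(r, x)\<leftarrow>xs. of_rat r * x\<^sup>2) = (\<Sum>(r, y)\<leftarrow>ys. of_rat r * y\<^sup>2) + C * ?r \<and> C \<in> adjroots D
          \<and> (\<Sum>(r, y)\<leftarrow>ys. of_rat r * y\<^sup>2) \<in> adjroots D"
        unfolding C_def ys_def using xs
      proof (induction xs)
        case (Cons rx xs)
        obtain r x where rx: "rx = (r, x)" by (cases rx)
        have x: "x \<in> adjroots (insert d D)" using Cons.prems rx by simp
        have rr: "(of_rat r :: 'a) \<in> adjroots D" "(of_rat (r * of_int d) :: 'a) \<in> adjroots D" "(2 :: 'a) \<in> adjroots D"
          by (auto intro!: ratring_rat[OF ratring_adjroots])
        have rd: "(of_rat (r * of_int d) :: 'a) = of_rat r * ?r\<^sup>2"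
          by (simp add: rt_square of_rat_mult)
        have "x\<^sup>2 = (a x + b x * ?r)\<^sup>2" using ab(3)[OF x] by simp
        hence "of_rat r * x\<^sup>2 = of_rat r * (a x)\<^sup>2 + of_rat (r * of_int d) * (b x)\<^sup>2 + (2 * of_rat r * a x * b x) * ?r"
          unfolding rd by (simp add: power2_eq_square algebra_simps)
        moreover have "2 * of_rat r * a x * b x \<in> adjroots D"
          "of_rat r * (a x)\<^sup>2 \<in> adjroots D" "of_rat (r * of_int d) * (b x)\<^sup>2 \<in> adjroots D"
          using rr ab(1)[OF x] ab(2)[OF x]
          by (auto simp del: of_rat_mult intro!: ratring_mult[OF ratring_adjroots] ratring_power[OF ratring_adjroots])
        moreover have xs': "\<forall>(r, x)\<in>set xs. r > 0 \<and> x \<in> adjroots (insert d D)" using Cons.prems by simp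
        note Cons.IH[OF xs']
        ultimately show ?case
          by (simp add: rx A_def B_def algebra_simps ratring_add[OF ratring_adjroots])
      qed (auto intro: ratring_0 ratring_adjroots)
      hence eq: "(\<Sum>(r, y)\<leftarrow>ys. of_rat r * y\<^sup>2) + C * ?r = 0" and C: "C \<in> adjroots D"
        and Y: "(\<Sum>(r, y)\<leftarrow>ys. of_rat r * y\<^sup>2) \<in> adjroots D" using sum by auto
      have "C = 0"
      proof (rule ccontr)
        assume "C \<noteq> 0"
        hence "?r = - (\<Sum>(r, y)\<leftarrow>ys. of_rat r * y\<^sup>2) / C" using eq by (simp add: field_simps add_eq_0_iff)
        moreover have "- (\<Sum>(r, y)\<leftarrow>ys. of_rat r * y\<^sup>2) / C \<in> adjroots D"
          by (intro ratring_divide ratring_minus ratring_adjroots C Y alg)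
        ultimately show False using False by simp
      qed
      hence "(\<Sum>(r, y)\<leftarrow>ys. of_rat r * y\<^sup>2) = 0" using eq by simp
      moreover have "\<forall>(r, y)\<in>set ys. r > 0 \<and> y \<in> adjroots D"
        using xs ab(1,2) d by (fastforce simp: ys_def A_def B_def)
      ultimately have zero: "\<forall>(r, y)\<in>set ys. y = 0" using IH unfolding formally_real_def by blast
      show "\<forall>(r, x)\<in>set xs. x = 0"
      proof safe
        fix r x assume rx: "(r, x) \<in> set xs"
        hence "(r, a x) \<in> set ys" "(r * of_int d, b x) \<in> set ys"
          by (force simp: ys_def A_def B_def)+
        hence "a x = 0" "b x = 0" using zero by auto
        thus "x = 0" using ab(3)[of x] xs rx by auto
      qed
    qed
  qed
qed

text \<open>A value -1 at some \<sigma> is also taken at an automorphism \<tau> that flips sqrt -1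
  and fixes the roots of the primes involved. If \<tau> s / s = x + y sqrt -1 with x and y generated
  by roots of primes, \<tau>^2 s = -s becomes x^2 + y^2 = -1.\<close>

lemma qf_trivial_at_infinity:
  assumes s: "s \<in> qelts" and dep: "depends_on (adjroots (gens 0)) (qf s) auts" and \<sigma>: "\<sigma> \<in> auts"
  shows "qf s \<sigma> = 1"
proof (cases "\<sigma> (rt (-1)) = rt (-1)")
  case True
  have g0: "gens 0 = {-1}" by (simp add: gens_def)
  have "qf s \<sigma> = qf s id"
    by (rule depends_onD[OF dep \<sigma> aut_id(1)], rule agree_adjroots[OF \<sigma> aut_id(1)])
      (use True in \<open>auto simp: g0\<close>)
  thus ?thesis using qelts_nonzero[OF s] by (simp add: qf_def)
next
  case False
  hence \<sigma>i: "\<sigma> (rt (-1)) = - rt (-1)" using aut_sqrt[OF \<sigma>, of "rt (-1)"] by (auto simp: rt_square)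
  have g0: "gens 0 = {-1}" by (simp add: gens_def)
  show ?thesis
  proof (rule ccontr)
    assume "qf s \<sigma> \<noteq> 1"
    hence m: "qf s \<sigma> = -1" using qf_act(1)[OF s \<sigma>] by blast
    obtain n where n: "\<forall>\<tau>\<in>auts. \<tau> s / s \<in> adjroots (gens n)"
      using qelts_ratio_adjroots[OF s] by blast
    define D where "D = gens n - {-1}"
    have ins: "insert (-1) D = gens n" by (auto simp: D_def gens_def)
    have basicI: "basic (insert (-1) D)" unfolding ins by (rule basic_gens)
    obtain \<tau> where \<tau>: "\<tau> \<in> auts" "\<And>x. x \<in> adjroots D \<Longrightarrow> \<tau> x = x" "\<tau> (rt (-1)) = - rt (-1)"
      using aut_flip[OF basicI] by (auto simp: D_def)
    have "qf s \<tau> = qf s \<sigma>"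
      by (rule depends_onD[OF dep \<tau>(1) \<sigma>], rule agree_adjroots[OF \<tau>(1) \<sigma>])
        (use \<tau>(3) \<sigma>i in \<open>auto simp: g0\<close>)
    hence q: "\<tau> (\<tau> s) = - s" using qf_act(3)[OF s \<tau>(1)] m by simp
    have s0: "s \<noteq> 0" by (rule qelts_nonzero[OF s])
    have "\<tau> s / s \<in> adjroots (insert (-1) D)" using n \<tau>(1) unfolding ins by blast
    then obtain x y where xy: "x \<in> adjroots D" "y \<in> adjroots D" "\<tau> s / s = x + y * rt (-1)"
      using adjroots_insert by (metis of_int_1 of_int_minus)
    have "\<tau> (\<tau> s / s) * (\<tau> s / s) = -1"
      using q s0 \<tau>(1) by (simp add: aut_divide aut_eq_0)
    moreover have "\<tau> (\<tau> s / s) = x - y * rt (-1)" unfolding xy(3) using \<tau> xy(1,2) by (simp add: autsD)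
    ultimately have "(x - y * rt (-1)) * (x + y * rt (-1)) = -1" using xy(3) by simp
    hence "x\<^sup>2 - y\<^sup>2 * (rt (-1))\<^sup>2 = -1" by (simp add: algebra_simps power2_eq_square)
    hence "x\<^sup>2 + y\<^sup>2 + 1 = 0" by (simp add: rt_square)
    hence sum: "(\<Sum>(r, x)\<leftarrow>[(1, x), (1, y), (1, 1)]. of_rat r * x\<^sup>2) = 0" by (simp add: add.assoc)
    have "d > 0" if "d \<in> D" for d using that by (auto simp: D_def gens_def prime_gt_0_nat)
    hence "formally_real (adjroots D)" using finite_gens[of n] by (intro formally_real_adjroots) (auto simp: D_def)
    moreover have "\<forall>(r, x)\<in>set [(1 :: rat, x), (1, y), (1, 1)]. r > 0 \<and> x \<in> adjroots D"
      using xy(1,2) ratring_1[OF ratring_adjroots] by simp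
    ultimately have "\<forall>(r, x)\<in>set [(1 :: rat, x), (1, y), (1, 1)]. x = 0"
      using sum unfolding formally_real_def by blast
    thus False by simp
  qed
qed

lemma qelts_subset:
  fixes F :: "'a set"
  assumes F: "ratring F" and multiquad_F: "multiquad \<subseteq> F"
    and split_F: "\<And>a b x y. \<lbrakk>a \<in> \<rat>; b \<in> \<rat>; x \<in> \<rat>; y \<in> \<rat>; a \<noteq> 0; b \<noteq> 0; a * x\<^sup>2 + b * y\<^sup>2 = 1\<rbrakk> \<Longrightarrow>
      \<exists>f\<in>qelts \<inter> F. \<forall>\<sigma>\<in>auts. qf f \<sigma> = hilb a b \<sigma>"
  shows "qelts \<subseteq> F"
proof
  fix s assume s: "s \<in> qelts"
  obtain n where n: "s\<^sup>2 \<in> adjroots (gens n)" "\<forall>\<tau>\<in>auts. \<tau> s / s \<in> adjroots (gens n)"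
    using qelts_ratio_adjroots[OF s] by blast
  have "depends_on (adjroots (gens n)) (qf s) auts" by (rule qf_depends_on[OF s]) (use n in auto)
  thus "s \<in> F" using s
  proof (induction n arbitrary: s)
    case 0
    thus ?case using qf_trivial_at_infinity qf_trivial_multiquad multiquad_F by blast
  next
    case (Suc n)
    show ?case
    proof (cases "prime n")
      case True
      obtain f where f: "f \<in> qelts" "f \<in> F" "depends_on (adjroots (gens n)) (qf (s * f)) auts"
      proof -
        have "\<exists>f\<in>qelts \<inter> F. depends_on (adjroots (gens n)) (qf (s * f)) auts"
          by (rule remove_prime[OF F multiquad_F _ True Suc.prems(2,1)]) (rule split_F)
        thus ?thesis using that by blast
      qed
      have "s * f \<in> F" using Suc.IH[OF f(3)] qelts_mult(1)[OF Suc.prems(2) f(1)] by blast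
      hence "s * f / f \<in> F" using ratring_divide[OF F _ f(2) alg] by blast
      thus ?thesis using qelts_nonzero[OF f(1)] by simp
    next
      case False
      thus ?thesis using Suc by (simp add: gens_Suc)
    qed
  qed
qed

end

section \<open>Groups of generalized dihedral type\<close>

abbreviation D4_rot :: "nat \<Rightarrow> nat" where "D4_rot \<equiv> cycle_of_list [1, 2, 3, 4]"
abbreviation D4_refl :: "nat \<Rightarrow> nat" where "D4_refl \<equiv> cycle_of_list [1, 3]"

definition opp :: "nat \<Rightarrow> nat" where
  "opp i = (if i = 1 then 3 else if i = 2 then 4 else if i = 3 then 1 else if i = 4 then 2 else i)"

text \<open>A symmetry of the square preserves opposite vertices, so the images a and b of 1 and 2
  determine it.\<close>

definition D4_map :: "nat \<Rightarrow> nat \<Rightarrow> nat \<Rightarrow> nat" where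
  "D4_map a b i = (if i = 1 then a else if i = 2 then b else if i = 3 then opp a else if i = 4 then opp b else i)"

lemma rot_eq: "D4_rot = D4_map 2 3" and refl_eq: "D4_refl = D4_map 3 2" and id_eq: "id = D4_map 1 2"
  by (rule ext, simp add: D4_map_def opp_def transpose_def)+

text \<open>Ordered pairs of adjacent vertices: the possible images of (1, 2), one for each of the
  eight symmetries.\<close>

definition D4_pairs :: "(nat \<times> nat) set" where
  "D4_pairs = {(1, 2), (2, 3), (3, 4), (4, 1), (3, 2), (2, 1), (1, 4), (4, 3)}"

lemma opp_opp: "opp (opp i) = i"
  by (simp add: opp_def)

lemma D4_map_opp: "D4_map a b (opp i) = opp (D4_map a b i)"
proof -
  have o: "opp 1 = 3" "opp 2 = 4" "opp 3 = 1" "opp 4 = 2" by (simp_all add: opp_def)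
  consider "i = 1" | "i = 2" | "i = 3" | "i = 4" | "i \<notin> {1, 2, 3, 4}" by blast
  thus ?thesis
  proof cases
    case 5
    hence "opp i = i" "D4_map a b i = i" by (auto simp: opp_def D4_map_def)
    thus ?thesis by simp
  qed (simp_all only: o D4_map_def, simp_all add: opp_opp)
qed

lemma D4_map_comp_eq: "D4_map a b \<circ> D4_map c d = D4_map (D4_map a b c) (D4_map a b d)"
proof
  fix i :: nat
  consider "i = 1" | "i = 2" | "i = 3" | "i = 4" | "i \<notin> {1, 2, 3, 4}" by blast
  thus "(D4_map a b \<circ> D4_map c d) i = D4_map (D4_map a b c) (D4_map a b d) i"
  proof cases
    case 3
    hence "D4_map c d i = opp c" "D4_map (D4_map a b c) (D4_map a b d) i = opp (D4_map a b c)" by (simp_all add: D4_map_def)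
    thus ?thesis by (simp add: D4_map_opp)
  next
    case 4
    hence "D4_map c d i = opp d" "D4_map (D4_map a b c) (D4_map a b d) i = opp (D4_map a b d)" by (simp_all add: D4_map_def)
    thus ?thesis by (simp add: D4_map_opp)
  qed (simp_all add: D4_map_def)
qed

lemma D4_map_eqI: "a = c \<Longrightarrow> b = d \<Longrightarrow> D4_map a b = D4_map c d"
  by simp

lemma D4_map_words:
  "D4_map 3 4 = D4_rot \<circ> D4_rot" "D4_map 4 1 = D4_rot \<circ> (D4_rot \<circ> D4_rot)" "D4_map 2 1 = D4_refl \<circ> D4_rot"
  "D4_map 1 4 = D4_refl \<circ> (D4_rot \<circ> D4_rot)" "D4_map 4 3 = D4_refl \<circ> (D4_rot \<circ> (D4_rot \<circ> D4_rot))"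
  unfolding rot_eq refl_eq D4_map_comp_eq by (rule D4_map_eqI; simp add: D4_map_def opp_def)+

text \<open>M is arbitrary because the lemma serves both for \<open>D4\<close> and for the image of
  a Galois group in \<open>D4_field\<close>.\<close>

lemma D4_map_closed:
  assumes "D4_rot \<in> M" "D4_refl \<in> M" "id \<in> M" "\<And>p q. p \<in> M \<Longrightarrow> q \<in> M \<Longrightarrow> p \<circ> q \<in> M" "(a, b) \<in> D4_pairs"
  shows "D4_map a b \<in> M"
proof -
  have "D4_map 1 2 \<in> M" "D4_map 2 3 \<in> M" "D4_map 3 2 \<in> M" using assms(1-3) by (simp_all only: rot_eq refl_eq id_eq)
  moreover have "D4_rot \<circ> D4_rot \<in> M" "D4_rot \<circ> (D4_rot \<circ> D4_rot) \<in> M" "D4_refl \<circ> D4_rot \<in> M" "D4_refl \<circ> (D4_rot \<circ> D4_rot) \<in> M"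
    "D4_refl \<circ> (D4_rot \<circ> (D4_rot \<circ> D4_rot)) \<in> M"
    by (intro assms(1,2,4))+
  hence "D4_map 3 4 \<in> M" "D4_map 4 1 \<in> M" "D4_map 2 1 \<in> M" "D4_map 1 4 \<in> M" "D4_map 4 3 \<in> M"
    by (simp_all only: D4_map_words)
  ultimately show ?thesis using assms(5) unfolding D4_pairs_def by blast
qed

lemma D4_map_permutes:
  assumes "(a, b) \<in> D4_pairs" shows "D4_map a b permutes {1..4}"
proof (rule bij_imp_permutes)
  have s: "{1..4::nat} = {1, 2, 3, 4}" by auto
  show "bij_betw (D4_map a b) {1..4} {1..4}"
    unfolding s bij_betw_def using assms by (auto simp: D4_pairs_def D4_map_def opp_def inj_on_def)
qed (auto simp: D4_map_def)

lemma D4_pairs_iff: "(a, b) \<in> D4_pairs \<longleftrightarrow> a \<in> {1, 2, 3, 4} \<and> b \<in> {1, 2, 3, 4} - {a, opp a}"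
  by (auto simp: D4_pairs_def opp_def)

lemma D4_pairs_closed:
  assumes ab: "(a, b) \<in> D4_pairs" and cd: "(c, d) \<in> D4_pairs"
  shows "(D4_map a b c, D4_map a b d) \<in> D4_pairs"
proof -
  have s: "{1..4::nat} = {1, 2, 3, 4}" by auto
  note p = D4_map_permutes[OF ab, unfolded s]
  have "D4_map a b d \<noteq> D4_map a b (opp c)" "D4_map a b d \<noteq> D4_map a b c"
    using permutes_inj[OF p] cd by (auto simp: D4_pairs_iff inj_eq)
  thus ?thesis using cd permutes_in_image[OF p] by (simp only: D4_pairs_iff D4_map_opp) blast
qed

lemma D4_map_inverse:
  assumes "(a, b) \<in> D4_pairs" shows "\<exists>c d. (c, d) \<in> D4_pairs \<and> D4_map c d \<circ> D4_map a b = id"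
proof -
  have "\<forall>(a, b)\<in>D4_pairs. \<exists>(c, d)\<in>D4_pairs. D4_map c d a = 1 \<and> D4_map c d b = 2"
    by (simp add: D4_pairs_def D4_map_def opp_def)
  then obtain c d where "(c, d) \<in> D4_pairs" "D4_map c d a = 1" "D4_map c d b = 2" using assms by blast
  hence "(c, d) \<in> D4_pairs \<and> D4_map (D4_map c d a) (D4_map c d b) = D4_map 1 2" by simp
  thus ?thesis unfolding id_eq D4_map_comp_eq by blast
qed

lemma D4_eq: "D4 = (\<lambda>(a, b). D4_map a b) ` D4_pairs"
proof
  interpret S: group "sym_group 4" by (rule sym_group_is_group)
  have gens: "D4_rot \<in> (\<lambda>(a, b). D4_map a b) ` D4_pairs" "D4_refl \<in> (\<lambda>(a, b). D4_map a b) ` D4_pairs"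
    unfolding rot_eq refl_eq by (auto simp: D4_pairs_def)
  have carr: "D4_map a b \<in> carrier (sym_group 4)" if "(a, b) \<in> D4_pairs" for a b
    using D4_map_permutes[OF that] by (simp add: sym_group_carrier)
  show "D4 \<subseteq> (\<lambda>(a, b). D4_map a b) ` D4_pairs"
  proof
    fix p assume "p \<in> D4"
    thus "p \<in> (\<lambda>(a, b). D4_map a b) ` D4_pairs"
      unfolding D4_def
    proof induction
      case one
      show ?case unfolding sym_group_one id_eq by (auto simp: D4_pairs_def)
    next
      case (incl h)
      thus ?case using gens by auto
    next
      case (inv h)
      then obtain a b where ab: "h = D4_map a b" "(a, b) \<in> D4_pairs" using gens by auto
      obtain c d where cd: "(c, d) \<in> D4_pairs" "D4_map c d \<circ> D4_map a b = id" using D4_map_inverse[OF ab(2)] by blast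
      have "inv\<^bsub>sym_group 4\<^esub> h = D4_map c d"
        by (rule S.inv_equality) (simp_all only: ab(1) carr[OF ab(2)] carr[OF cd(1)] sym_group_mult sym_group_one cd(2))
      thus ?case using cd(1) by force
    next
      case (eng h1 h2)
      thus ?case unfolding sym_group_mult using D4_map_comp_eq D4_pairs_closed by force
    qed
  qed
  have "D4_map a b \<in> D4" if "(a, b) \<in> D4_pairs" for a b
  proof (rule D4_map_closed[OF _ _ _ _ that])
    show "D4_rot \<in> D4" "D4_refl \<in> D4" unfolding D4_def by (auto intro: generate.incl)
    show "id \<in> D4" unfolding D4_def using generate.one[of "sym_group 4"] by (simp add: sym_group_one)
    show "p \<circ> q \<in> D4" if "p \<in> D4" "q \<in> D4" for p q
      using that generate.eng[of p "sym_group 4" _ q] unfolding D4_def by (simp add: sym_group_mult)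
  qed
  thus "(\<lambda>(a, b). D4_map a b) ` D4_pairs \<subseteq> D4" by auto
qed

text \<open>The square of a symmetry is the identity or the half turn \<open>D4_map 3 4\<close>, a
  central involution.\<close>

lemma D4_laws:
  assumes "p \<in> D4" "q \<in> D4"
  shows "p \<circ> p \<circ> p \<circ> p = id" "p \<circ> p \<circ> q = q \<circ> (p \<circ> p)"
proof -
  obtain a b where ab: "(a, b) \<in> D4_pairs" "p = D4_map a b" using assms(1) unfolding D4_eq by auto
  obtain c d where cd: "(c, d) \<in> D4_pairs" "q = D4_map c d" using assms(2) unfolding D4_eq by auto
  have "p \<circ> p = D4_map (D4_map a b a) (D4_map a b b)" unfolding ab(2) by (rule D4_map_comp_eq)
  moreover have "(D4_map a b a, D4_map a b b) = (1, 2) \<or> (D4_map a b a, D4_map a b b) = (3, 4)"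
    using ab(1) by (auto simp: D4_pairs_def D4_map_def opp_def)
  ultimately have "p \<circ> p = id \<or> p \<circ> p = D4_map 3 4" by (auto simp only: id_eq prod.inject)
  moreover have "D4_map 3 4 \<circ> D4_map 3 4 = id"
    unfolding id_eq D4_map_comp_eq by (rule D4_map_eqI; simp add: D4_map_def opp_def)
  moreover have "D4_map 3 4 \<circ> q = q \<circ> D4_map 3 4"
    unfolding cd(2) D4_map_comp_eq
    by (rule D4_map_eqI; use cd(1) in \<open>auto simp: D4_map_def opp_def D4_pairs_def\<close>)
  ultimately have "(p \<circ> p) \<circ> (p \<circ> p) = id" "(p \<circ> p) \<circ> q = q \<circ> (p \<circ> p)" by (metis id_comp comp_id)+
  thus "p \<circ> p \<circ> p \<circ> p = id" "p \<circ> p \<circ> q = q \<circ> (p \<circ> p)" by (simp_all only: comp_assoc)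
qed

lemma group_D4_group: "group D4_group"
proof -
  interpret S: group "sym_group 4" by (rule sym_group_is_group)
  have "{D4_rot, D4_refl} \<subseteq> carrier (sym_group 4)"
    using D4_map_permutes[of 2 3] D4_map_permutes[of 3 2] unfolding rot_eq refl_eq
    by (auto simp: sym_group_carrier D4_pairs_def)
  from S.generate_is_subgroup[OF this] show ?thesis
    unfolding D4_group_def D4_def using S.subgroup_imp_group by blast
qed

text \<open>Identities pass from \<open>D4\<close> to subgroups, products and quotients. They are
  checked componentwise on coset representatives and pulled back along the injective h.\<close>

lemma generalized_D4_type_group_laws:
  assumes "generalized_D4_type_group H" "x \<in> carrier H" "y \<in> carrier H"
  shows "x \<otimes>\<^bsub>H\<^esub> x \<otimes>\<^bsub>H\<^esub> x \<otimes>\<^bsub>H\<^esub> x = \<one>\<^bsub>H\<^esub>" "x \<otimes>\<^bsub>H\<^esub> x \<otimes>\<^bsub>H\<^esub> y = y \<otimes>\<^bsub>H\<^esub> (x \<otimes>\<^bsub>H\<^esub> x)"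
proof -
  interpret H: group H using assms(1) by (simp add: generalized_D4_type_group_def)
  obtain n :: nat and T S N where
    T: "\<And>i. i < n \<Longrightarrow> transitive_subgroup_of_D4 (T i)" and
    S: "subdirect_product {..<n} (\<lambda>i. sym_group 4 \<lparr>carrier := T i\<rparr>) S" and
    N: "N \<lhd> product_group {..<n} (\<lambda>i. sym_group 4 \<lparr>carrier := T i\<rparr>) \<lparr>carrier := S\<rparr>" and
    iso: "H \<cong> (product_group {..<n} (\<lambda>i. sym_group 4 \<lparr>carrier := T i\<rparr>) \<lparr>carrier := S\<rparr>) Mod N"
    using assms(1) unfolding generalized_D4_type_group_def Let_def by blast
  define P where "P = product_group {..<n} (\<lambda>i. sym_group 4 \<lparr>carrier := T i\<rparr>) \<lparr>carrier := S\<rparr>"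
  interpret N: normal N P using N by (simp add: P_def)
  obtain h where h: "h \<in> Group.iso H (P Mod N)" using iso unfolding P_def is_iso_def by blast
  hence hom: "h \<in> hom H (P Mod N)" and inj: "inj_on h (carrier H)"
    by (auto simp: Group.iso_def bij_betw_def)
  have carrS: "carrier P = S" and multP: "\<And>s t. s \<otimes>\<^bsub>P\<^esub> t = (\<lambda>i\<in>{..<n}. s i \<circ> t i)"
    and oneP: "\<one>\<^bsub>P\<^esub> = (\<lambda>i\<in>{..<n}. id)"
    by (simp_all add: P_def sym_group_mult sym_group_one)
  have D4: "s i \<in> D4" if "s \<in> S" "i < n" for s i
  proof -
    have "S \<subseteq> carrier (product_group {..<n} (\<lambda>i. sym_group 4 \<lparr>carrier := T i\<rparr>))"
      using S subgroup.subset unfolding subdirect_product_def by blast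
    hence "s i \<in> T i" using that by auto
    moreover have "T i \<subseteq> carrier D4_group" using T[OF that(2)] subgroup.subset
      unfolding transitive_subgroup_of_D4_def by blast
    ultimately show ?thesis by (auto simp: D4_group_def)
  qed
  have coset: "\<exists>s\<in>S. h z = N #>\<^bsub>P\<^esub> s" if "z \<in> carrier H" for z
    using hom_in_carrier[OF hom that] by (auto simp: FactGroup_def RCOSETS_def carrS)
  have mult: "h (z \<otimes>\<^bsub>H\<^esub> w) = N #>\<^bsub>P\<^esub> (s \<otimes>\<^bsub>P\<^esub> t)"
    if "z \<in> carrier H" "w \<in> carrier H" "s \<in> S" "t \<in> S" "h z = N #>\<^bsub>P\<^esub> s" "h w = N #>\<^bsub>P\<^esub> t" for z w s t
    using hom_mult[OF hom that(1,2)] N.rcos_sum[of s t] that(3-6) by (simp add: FactGroup_def carrS)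
  have cl: "s \<otimes>\<^bsub>P\<^esub> t \<in> S" if "s \<in> S" "t \<in> S" for s t using N.m_closed[of s t] that by (simp add: carrS)
  obtain s where s: "s \<in> S" "h x = N #>\<^bsub>P\<^esub> s" using coset assms(2) by blast
  obtain t where t: "t \<in> S" "h y = N #>\<^bsub>P\<^esub> t" using coset assms(3) by blast
  have xx: "h (x \<otimes>\<^bsub>H\<^esub> x) = N #>\<^bsub>P\<^esub> (s \<otimes>\<^bsub>P\<^esub> s)" by (intro mult assms(2) s)
  have x3: "h (x \<otimes>\<^bsub>H\<^esub> x \<otimes>\<^bsub>H\<^esub> x) = N #>\<^bsub>P\<^esub> (s \<otimes>\<^bsub>P\<^esub> s \<otimes>\<^bsub>P\<^esub> s)"
    by (intro mult assms(2) s xx cl H.m_closed)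
  have x4: "h (x \<otimes>\<^bsub>H\<^esub> x \<otimes>\<^bsub>H\<^esub> x \<otimes>\<^bsub>H\<^esub> x) = N #>\<^bsub>P\<^esub> (s \<otimes>\<^bsub>P\<^esub> s \<otimes>\<^bsub>P\<^esub> s \<otimes>\<^bsub>P\<^esub> s)"
    by (intro mult assms(2) s x3 cl H.m_closed)
  have "s \<otimes>\<^bsub>P\<^esub> s \<otimes>\<^bsub>P\<^esub> s \<otimes>\<^bsub>P\<^esub> s = \<one>\<^bsub>P\<^esub>"
    unfolding multP oneP
  proof (rule restrict_ext)
    fix i assume i: "i \<in> {..<n}"
    hence "s i \<circ> s i \<circ> s i \<circ> s i = id" using D4[OF s(1), of i] by (intro D4_laws) auto
    thus "(\<lambda>i\<in>{..<n}. (\<lambda>i\<in>{..<n}. s i \<circ> s i) i \<circ> s i) i \<circ> s i = id" using i by (simp only: restrict_apply')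
  qed
  hence "h (x \<otimes>\<^bsub>H\<^esub> x \<otimes>\<^bsub>H\<^esub> x \<otimes>\<^bsub>H\<^esub> x) = \<one>\<^bsub>P Mod N\<^esub>"
    using x4 N.coset_mult_one[OF N.subset] by (simp add: FactGroup_def)
  also have "\<dots> = h \<one>\<^bsub>H\<^esub>" using hom_one[OF hom H.is_group N.factorgroup_is_group] by simp
  finally show "x \<otimes>\<^bsub>H\<^esub> x \<otimes>\<^bsub>H\<^esub> x \<otimes>\<^bsub>H\<^esub> x = \<one>\<^bsub>H\<^esub>"
    using inj assms(2) by (auto dest: inj_onD)
  have l: "h (x \<otimes>\<^bsub>H\<^esub> x \<otimes>\<^bsub>H\<^esub> y) = N #>\<^bsub>P\<^esub> (s \<otimes>\<^bsub>P\<^esub> s \<otimes>\<^bsub>P\<^esub> t)"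
    by (intro mult assms(2,3) s t xx cl H.m_closed)
  have r: "h (y \<otimes>\<^bsub>H\<^esub> (x \<otimes>\<^bsub>H\<^esub> x)) = N #>\<^bsub>P\<^esub> (t \<otimes>\<^bsub>P\<^esub> (s \<otimes>\<^bsub>P\<^esub> s))"
    by (intro mult assms(2,3) s t xx cl H.m_closed)
  have "s \<otimes>\<^bsub>P\<^esub> s \<otimes>\<^bsub>P\<^esub> t = t \<otimes>\<^bsub>P\<^esub> (s \<otimes>\<^bsub>P\<^esub> s)"
    unfolding multP
  proof (rule restrict_ext)
    fix i assume i: "i \<in> {..<n}"
    hence "s i \<circ> s i \<circ> t i = t i \<circ> (s i \<circ> s i)" using D4[OF s(1), of i] D4[OF t(1), of i] by (intro D4_laws) auto
    thus "(\<lambda>i\<in>{..<n}. s i \<circ> s i) i \<circ> t i = t i \<circ> (\<lambda>i\<in>{..<n}. s i \<circ> s i) i" using i by (simp only: restrict_apply')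
  qed
  hence "h (x \<otimes>\<^bsub>H\<^esub> x \<otimes>\<^bsub>H\<^esub> y) = h (y \<otimes>\<^bsub>H\<^esub> (x \<otimes>\<^bsub>H\<^esub> x))" using l r by simp
  thus "x \<otimes>\<^bsub>H\<^esub> x \<otimes>\<^bsub>H\<^esub> y = y \<otimes>\<^bsub>H\<^esub> (x \<otimes>\<^bsub>H\<^esub> x)"
    using inj assms(2,3) by (auto dest: inj_onD)
qed

lemma transitive_D4: "transitive_subgroup_of_D4 D4"
  unfolding transitive_subgroup_of_D4_def
proof (intro conjI ballI)
  show "subgroup D4 D4_group"
    using group.subgroup_self[OF group_D4_group] by (simp add: D4_group_def)
  fix x y :: nat assume "x \<in> {1..4}" "y \<in> {1..4}"
  hence xy: "x \<in> {1, 2, 3, 4}" "y \<in> {1, 2, 3, 4}" by auto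
  have "\<exists>(a, b)\<in>D4_pairs. D4_map a b x = y"
    using xy by (auto simp: D4_pairs_def D4_map_def opp_def)
  thus "\<exists>p\<in>D4. p x = y" unfolding D4_eq by blast
qed

text \<open>H is presented with a single factor \<open>D4\<close>; N is the kernel of evaluation at
  the index 0 followed by the isomorphism k onto H.\<close>

lemma generalized_D4_type_groupI:
  assumes "group H" "H \<cong> D4_group"
  shows "generalized_D4_type_group H"
proof -
  interpret D: group D4_group by (rule group_D4_group)
  define P where "P = product_group {..<1::nat} (\<lambda>i. D4_group)"
  interpret P: group P unfolding P_def using group_D4_group by simp
  obtain k where k: "k \<in> Group.iso D4_group H"
    using group.iso_sym[OF assms] by (auto simp: is_iso_def)
  hence k_hom: "k \<in> hom D4_group H" and k_bij: "bij_betw k (carrier D4_group) (carrier H)"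
    by (auto simp: Group.iso_def)
  define h where "h x = k (x 0)" for x :: "nat \<Rightarrow> nat \<Rightarrow> nat"
  have "h \<in> hom P H"
  proof (rule homI)
    have c: "x 0 \<in> carrier D4_group" if "x \<in> carrier P" for x
      using that unfolding P_def by (auto simp only: carrier_product_group dest: PiE_mem)
    fix x y assume xy: "x \<in> carrier P" "y \<in> carrier P"
    show "h x \<in> carrier H" unfolding h_def by (rule hom_in_carrier[OF k_hom c[OF xy(1)]])
    have "(x \<otimes>\<^bsub>P\<^esub> y) 0 = x 0 \<otimes>\<^bsub>D4_group\<^esub> y 0" by (simp add: P_def)
    thus "h (x \<otimes>\<^bsub>P\<^esub> y) = h x \<otimes>\<^bsub>H\<^esub> h y"
      unfolding h_def using hom_mult[OF k_hom c[OF xy(1)] c[OF xy(2)]] by (simp only:)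
  qed
  then interpret h: group_hom P H h
    using assms(1) by (simp add: group_hom_def group_hom_axioms_def P.is_group)
  have "h ` carrier P = carrier H"
  proof
    show "carrier H \<subseteq> h ` carrier P"
    proof
      fix z assume "z \<in> carrier H"
      then obtain d where "d \<in> carrier D4_group" "z = k d" using k_bij by (auto simp: bij_betw_def)
      thus "z \<in> h ` carrier P"
        by (intro image_eqI[of _ _ "\<lambda>i\<in>{..<1}. d"]) (auto simp: h_def P_def)
    qed
  qed (use h.hom_closed in auto)
  hence iso: "P Mod (kernel P H h) \<cong> H" by (rule h.FactGroup_iso)
  have fin: "finite (carrier H)"
    using bij_betw_finite[OF k_bij] by (simp add: D4_group_def D4_eq D4_pairs_def)
  have sub: "subdirect_product {..<1} (\<lambda>i. D4_group) (carrier P)"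
    unfolding subdirect_product_def
  proof (intro conjI ballI)
    show "subgroup (carrier P) (product_group {..<1} (\<lambda>i. D4_group))"
      using P.subgroup_self by (simp add: P_def)
    fix i :: nat assume i: "i \<in> {..<1}"
    have "d \<in> (\<lambda>x. x i) ` carrier P" if "d \<in> carrier D4_group" for d
      using that i by (intro image_eqI[of _ _ "\<lambda>i\<in>{..<1}. d"]) (auto simp: P_def)
    thus "(\<lambda>x. x i) ` carrier P = carrier D4_group" using i by (auto simp: P_def)
  qed
  have G: "(\<lambda>i::nat. sym_group 4 \<lparr>carrier := D4\<rparr>) = (\<lambda>i. D4_group)" by (simp add: D4_group_def)
  have PP: "product_group {..<1::nat} (\<lambda>i. D4_group) \<lparr>carrier := carrier P\<rparr> = P" by (simp add: P_def)
  have "H \<cong> P Mod (kernel P H h)"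
    using iso group.iso_sym[OF h.normal_kernel[THEN normal.factorgroup_is_group]] by blast
  hence E: "(\<forall>i<1. transitive_subgroup_of_D4 ((\<lambda>_. D4) i)) \<and>
      subdirect_product {..<1::nat} (\<lambda>i. sym_group 4 \<lparr>carrier := (\<lambda>_. D4) i\<rparr>) (carrier P) \<and>
      kernel P H h \<lhd> product_group {..<1} (\<lambda>i. sym_group 4 \<lparr>carrier := (\<lambda>_. D4) i\<rparr>) \<lparr>carrier := carrier P\<rparr> \<and>
      H \<cong> product_group {..<1} (\<lambda>i. sym_group 4 \<lparr>carrier := (\<lambda>_. D4) i\<rparr>) \<lparr>carrier := carrier P\<rparr> Mod kernel P H h"
    unfolding G PP using sub transitive_D4 h.normal_kernel by blast
  show ?thesis
    unfolding generalized_D4_type_group_def Let_def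
    by (intro conjI[OF assms(1)] conjI[OF fin], rule exI[of _ 1], rule exI[of _ "\<lambda>_. D4"],
        rule exI[of _ "carrier P"], rule exI[of _ "kernel P H h"], rule E)
qed

section \<open>Dihedral extensions\<close>

context algebraic_numbers
begin

lemma rat_squares_plus_one_nonzero:
  assumes "p \<in> \<rat>" "q \<in> \<rat>" shows "p\<^sup>2 + q\<^sup>2 + 1 \<noteq> (0 :: 'a)"
proof
  assume "p\<^sup>2 + q\<^sup>2 + 1 = 0"
  hence "(\<Sum>(r, x)\<leftarrow>[(1, p), (1, q), (1, 1)]. of_rat r * x\<^sup>2) = 0" by (simp add: add.assoc)
  moreover have "\<forall>(r, x)\<in>set [(1 :: rat, p), (1, q), (1, 1)]. r > 0 \<and> x \<in> \<rat>" using assms by simp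
  ultimately have "\<forall>(r, x)\<in>set [(1 :: rat, p), (1, q), (1, 1)]. x = 0"
    using formally_real_Rats[where ?'a = 'a] unfolding formally_real_def by blast
  thus False by simp
qed

text \<open>If sqrt b = u + v sqrt a with rational u and v, then u v = 0 as sqrt a is irrational,
  and b or a b would be a square. So some automorphism fixes sqrt a and moves sqrt b.\<close>

lemma exists_aut_flipping_second:
  assumes "a \<in> \<rat>" "b \<in> \<rat>" "\<And>r. r \<in> \<rat> \<Longrightarrow> a \<noteq> r\<^sup>2" "\<And>r. r \<in> \<rat> \<Longrightarrow> b \<noteq> r\<^sup>2"
    "\<And>r. r \<in> \<rat> \<Longrightarrow> a * b \<noteq> r\<^sup>2"
  shows "\<exists>\<sigma>\<in>auts. chi a \<sigma> = 1 \<and> chi b \<sigma> = -1"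
proof -
  have nz: "a \<noteq> 0" "b \<noteq> 0" using assms(3)[of 0] assms(4)[of 0] by auto
  have "rt b \<notin> adj {rt a}"
  proof
    assume "rt b \<in> adj {rt a}"
    then obtain u v where uv: "u \<in> adj {}" "v \<in> adj {}" "rt b = u + v * rt a"
      using adj_insert_sqrt[of "rt a" "rt b" "{}"] assms(1) by (auto simp: rt_square)
    have rat: "u \<in> \<rat>" "v \<in> \<rat>" using uv(1,2) adjroots_empty by (auto simp: adjroots_def)
    have "b = (u + v * rt a)\<^sup>2" using rt_square[of b] uv(3) by simp
    also have "\<dots> = u\<^sup>2 + v\<^sup>2 * (rt a)\<^sup>2 + 2 * u * v * rt a" by (simp add: power2_eq_square algebra_simps)
    finally have eq: "b = u\<^sup>2 + v\<^sup>2 * a + 2 * u * v * rt a" by (simp only: rt_square)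
    have "u = 0 \<or> v = 0"
    proof (rule ccontr)
      assume "\<not> (u = 0 \<or> v = 0)"
      hence "rt a = (b - u\<^sup>2 - v\<^sup>2 * a) / (2 * u * v)" using eq by (simp add: field_simps)
      also have "\<dots> \<in> \<rat>" using rat assms(1,2) by simp
      finally show False using assms(3)[of "rt a"] by (simp add: rt_square)
    qed
    thus False
    proof
      assume "v = 0"
      thus False using eq assms(4)[OF rat(1)] by simp
    next
      assume "u = 0"
      hence "a * b = (v * a)\<^sup>2" using eq by (simp add: power2_eq_square)
      thus False using assms(5)[of "v * a"] rat(2) assms(1) by simp
    qed
  qed
  from exists_automorphism_moving[OF ratring_adj alg this]
  obtain \<sigma> where \<sigma>: "\<sigma> \<in> auts" "\<And>y. y \<in> adj {rt a} \<Longrightarrow> \<sigma> y = y" "\<sigma> (rt b) \<noteq> rt b" by blast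
  have "chi a \<sigma> = 1" using \<sigma>(2)[OF adj.base] nz(1) by (simp add: chi_eq_1_iff)
  moreover have "chi b \<sigma> = -1" using chi_act(2)[OF \<sigma>(1) assms(2) nz(2)] \<sigma>(3) nz(2) by (auto simp: chi_eq_1_iff)
  ultimately show ?thesis using \<sigma>(1) by blast
qed

text \<open>The conjugates of s = sqrt(1 + x sqrt a) are s, s', -s, -s', where s s' = y sqrt b.
  Placed in this order on a square they are permuted by symmetries, since negation is the map to the
  opposite vertex. An automorphism flipping both sqrt a and sqrt b gives a quarter turn, one
  flipping only sqrt b a reflection through vertices.\<close>

lemma D4_field:
  assumes rat: "a \<in> \<rat>" "b \<in> \<rat>" "x \<in> \<rat>" "y \<in> \<rat>" and norm: "a * x\<^sup>2 + b * y\<^sup>2 = 1"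
    and na: "\<And>r. r \<in> \<rat> \<Longrightarrow> a \<noteq> r\<^sup>2" and nb: "\<And>r. r \<in> \<rat> \<Longrightarrow> b \<noteq> r\<^sup>2"
    and nab: "\<And>r. r \<in> \<rat> \<Longrightarrow> a * b \<noteq> r\<^sup>2"
  shows "\<exists>K s. D4_extension K \<and> rt a \<in> K \<and> s \<in> K \<and> s \<in> qelts \<and> (\<forall>\<sigma>\<in>auts. qf s \<sigma> = hilb a b \<sigma>)"
proof -
  have nz: "a \<noteq> 0" "b \<noteq> 0" using na[of 0] nb[of 0] by auto
  have x0: "x \<noteq> 0"
  proof
    assume "x = 0"
    hence "b * y\<^sup>2 = 1" using norm by simp
    hence "b = (inverse y)\<^sup>2" by (simp add: power_inverse inverse_unique mult.commute)
    thus False using nb[of "inverse y"] rat by simp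
  qed
  have y0: "y \<noteq> 0"
  proof
    assume "y = 0"
    hence "a * x\<^sup>2 = 1" using norm by simp
    hence "a = (inverse x)\<^sup>2" by (simp add: power_inverse inverse_unique mult.commute)
    thus False using na[of "inverse x"] rat by simp
  qed
  define w where "w = y * rt b"
  define s where "s = rt (1 + x * rt a)"
  \<comment> \<open>Defined by division rather than as a second square root, so that s s' = y sqrt b
    holds with the right sign.\<close>
  define s' where "s' = w / s"
  have w0: "w \<noteq> 0" using y0 nz by (simp add: w_def rt_eq_0)
  have w2: "w\<^sup>2 = b * y\<^sup>2" by (simp add: w_def power_mult_distrib rt_square)
  have fac: "(1 + x * rt a) * (1 - x * rt a) = w\<^sup>2"
  proof -
    have "(1 + x * rt a) * (1 - x * rt a) = 1 - x\<^sup>2 * (rt a)\<^sup>2" by (simp add: power2_eq_square algebra_simps)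
    also have "\<dots> = b * y\<^sup>2" using norm by (simp add: rt_square algebra_simps)
    finally show ?thesis using w2 by simp
  qed
  have s2: "s\<^sup>2 = 1 + x * rt a" by (simp add: s_def rt_square)
  have s0: "s \<noteq> 0"
  proof
    assume "s = 0"
    hence "1 + x * rt a = 0" using s2 by simp
    thus False using fac w0 by simp
  qed
  have ss': "s * s' = w" using s0 by (simp add: s'_def)
  have s'0: "s' \<noteq> 0" using ss' w0 by auto
  have s'2: "s'\<^sup>2 = 1 - x * rt a"
  proof -
    have "s\<^sup>2 * s'\<^sup>2 = s\<^sup>2 * (1 - x * rt a)" using fac ss' s2 by (metis power_mult_distrib)
    thus ?thesis using s0 by simp
  qed
  have neq: "s \<noteq> s'" "s \<noteq> - s'"
  proof -
    have "s\<^sup>2 - s'\<^sup>2 = 2 * (x * rt a)" unfolding s2 s'2 by simp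
    moreover have "2 * (x * rt a) \<noteq> 0" using x0 nz(1) by (simp add: rt_eq_0)
    ultimately have "s\<^sup>2 \<noteq> s'\<^sup>2" by (metis diff_self)
    thus "s \<noteq> s'" "s \<noteq> - s'" by auto
  qed
  have act: "\<exists>e. (e = 1 \<or> e = -1) \<and>
      (chi a \<sigma> = 1 \<and> \<sigma> s = e * s \<and> \<sigma> s' = chi b \<sigma> * e * s' \<or>
       chi a \<sigma> = -1 \<and> \<sigma> s = e * s' \<and> \<sigma> s' = chi b \<sigma> * e * s)" if \<sigma>: "\<sigma> \<in> auts" for \<sigma>
  proof -
    have sw: "\<sigma> s * \<sigma> s' = chi b \<sigma> * (s * s')"
    proof -
      have "\<sigma> s * \<sigma> s' = \<sigma> w" using autsD(2)[OF \<sigma>, of s s'] ss' by simp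
      also have "\<dots> = y * (chi b \<sigma> * rt b)"
        unfolding w_def autsD(2)[OF \<sigma>] aut_rat[OF \<sigma> rat(4)] chi_act(1)[OF \<sigma> rat(2) nz(2)] ..
      finally show ?thesis unfolding ss' w_def by (simp add: mult_ac)
    qed
    have flip: "z = c * e * u" if "e = 1 \<or> e = -1" "e * z = c * u" for c e u z :: 'a
    proof -
      have "z = e * (e * z)" using that(1) by auto
      thus ?thesis unfolding that(2) by (simp only: mult_ac)
    qed
    have sq: "(\<sigma> s)\<^sup>2 = 1 + x * (chi a \<sigma> * rt a)"
      using \<sigma> s2 rat nz by (metis aut_1 aut_power aut_rat autsD(1,2) chi_act(1))
    show ?thesis
    proof (cases "chi a \<sigma> = 1")
      case True
      hence "(\<sigma> s)\<^sup>2 = s\<^sup>2" using sq s2 by simp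
      hence "\<sigma> s = 1 * s \<or> \<sigma> s = -1 * s" by (simp add: power2_eq_iff)
      then obtain e where e: "e = 1 \<or> e = -1" "\<sigma> s = e * s" by blast
      have "s * (e * \<sigma> s') = s * (chi b \<sigma> * s')" using sw unfolding e(2) by (simp add: mult_ac)
      hence "\<sigma> s' = chi b \<sigma> * e * s'" using s0 by (intro flip[OF e(1)]) simp
      thus ?thesis using e True by blast
    next
      case False
      hence m: "chi a \<sigma> = -1" using chi_act(2)[OF \<sigma> rat(1) nz(1)] by blast
      hence "(\<sigma> s)\<^sup>2 = s'\<^sup>2" using sq s'2 by simp
      hence "\<sigma> s = 1 * s' \<or> \<sigma> s = -1 * s'" by (simp add: power2_eq_iff)
      then obtain e where e: "e = 1 \<or> e = -1" "\<sigma> s = e * s'" by blast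
      have "s' * (e * \<sigma> s') = s' * (chi b \<sigma> * s)" using sw unfolding e(2) by (simp add: mult_ac)
      hence "\<sigma> s' = chi b \<sigma> * e * s" using s'0 by (intro flip[OF e(1)]) simp
      thus ?thesis using e m by blast
    qed
  qed
  \<comment> \<open>If sqrt a is fixed, \<sigma>^2 s = e^2 s = s. If it is flipped, \<sigma>
    exchanges s and s' up to signs and \<sigma>^2 s = \<open>chi b \<sigma> * s\<close>.\<close>
  have sq_act: "\<sigma> (\<sigma> s) = hilb a b \<sigma> * s" "\<sigma> (\<sigma> s') = hilb a b \<sigma> * s'" if \<sigma>: "\<sigma> \<in> auts" for \<sigma>
    using act[OF \<sigma>] chi_act(2)[OF \<sigma> rat(2) nz(2)] \<sigma>
    by (auto simp: hilb_def aut_minus)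
  have conj: "\<tau> s \<in> {s, s', - s, - s'}" "\<tau> s' \<in> {s, s', - s, - s'}" if \<tau>: "\<tau> \<in> auts" for \<tau>
    using act[OF \<tau>] chi_act(2)[OF \<tau> rat(2) nz(2)] by auto
  have "\<sigma> (\<sigma> (\<tau> s)) = hilb a b \<sigma> * \<tau> s" if "\<sigma> \<in> auts" "\<tau> \<in> auts" for \<sigma> \<tau>
    using conj(1)[OF that(2)] sq_act[OF that(1)] that(1) by (auto simp: aut_minus)
  moreover have "hilb a b \<sigma> = 1 \<or> hilb a b \<sigma> = -1" for \<sigma> by (simp add: hilb_def)
  ultimately have q: "s \<in> qelts" "\<And>\<sigma>. \<sigma> \<in> auts \<Longrightarrow> qf s \<sigma> = hilb a b \<sigma>"
    using qeltsI[of s "hilb a b"] s0 by blast+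
  define K where "K = adj {s, s'}"
  have K: "ratring K" "s \<in> K" "s' \<in> K" by (auto simp: K_def ratring_adj intro: adj.base)
  have stab: "stable K"
    unfolding K_def
  proof (rule stable_adj)
    fix \<sigma> :: "'a \<Rightarrow> 'a" and z assume "\<sigma> \<in> auts" "z \<in> {s, s'}"
    hence "\<sigma> z \<in> {s, s', - s, - s'}" using conj[of \<sigma>] by blast
    moreover have "{s, s', - s, - s'} \<subseteq> K" using K(2,3) ratring_minus[OF K(1)] by simp
    ultimately show "\<sigma> z \<in> adj {s, s'}" unfolding K_def by (rule subsetD[rotated])
  qed
  have "rt a = (s\<^sup>2 - 1) / x" using s2 x0 by simp
  also have "\<dots> \<in> K"
    using K rat(3) by (intro ratring_divide ratring_diff ratring_power ratring_1 alg) (auto intro: ratring_rat)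
  finally have aK: "rt a \<in> K" .
  define root where "root i = (if i = 1 then s else if i = 2 then s' else if i = 3 then - s else - s')" for i :: nat
  define idx where "idx = inv_into {1, 2, 3, 4} root"
  define perm where "perm \<phi> = D4_map (idx (\<phi> s)) (idx (\<phi> s'))" for \<phi>
  have inj: "inj_on root {1, 2, 3, 4}"
    using neq s0 s'0 by (auto simp: inj_on_def root_def equation_minus_iff)
  have idx: "idx (root i) = i" if "i \<in> {1, 2, 3, 4}" for i
    unfolding idx_def by (rule inv_into_f_f[OF inj that])
  have root_opp: "root (opp i) = - root i" if "i \<in> {1, 2, 3, 4}" for i
    using that by (auto simp: root_def opp_def)
  have perm_root: "\<exists>c d. (c, d) \<in> D4_pairs \<and> \<sigma> s = root c \<and> \<sigma> s' = root d \<and> perm \<sigma> = D4_map c d \<and>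
      (chi a \<sigma> = 1 \<and> chi b \<sigma> = -1 \<longrightarrow> (c, d) = (1, 4) \<or> (c, d) = (3, 2)) \<and>
      (chi a \<sigma> = -1 \<and> chi b \<sigma> = -1 \<longrightarrow> (c, d) = (2, 3) \<or> (c, d) = (4, 1))" if \<sigma>: "\<sigma> \<in> auts" for \<sigma>
  proof -
    have "\<exists>c d. (c, d) \<in> D4_pairs \<and> \<sigma> s = root c \<and> \<sigma> s' = root d \<and>
      (chi a \<sigma> = 1 \<and> chi b \<sigma> = -1 \<longrightarrow> (c, d) = (1, 4) \<or> (c, d) = (3, 2)) \<and>
      (chi a \<sigma> = -1 \<and> chi b \<sigma> = -1 \<longrightarrow> (c, d) = (2, 3) \<or> (c, d) = (4, 1))"
    proof -
      have r: "root 1 = s" "root 2 = s'" "root 3 = - s" "root 4 = - s'" by (simp_all add: root_def)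
      have pr: "(1, 2) \<in> D4_pairs" "(1, 4) \<in> D4_pairs" "(3, 4) \<in> D4_pairs" "(3, 2) \<in> D4_pairs"
        "(2, 1) \<in> D4_pairs" "(2, 3) \<in> D4_pairs" "(4, 3) \<in> D4_pairs" "(4, 1) \<in> D4_pairs"
        by (simp_all add: D4_pairs_def)
      have one: "(1 :: 'a) \<noteq> -1" by simp
      consider "chi b \<sigma> = 1" "chi a \<sigma> = 1" "\<sigma> s = s" "\<sigma> s' = s'" | "chi b \<sigma> = -1" "chi a \<sigma> = 1" "\<sigma> s = s" "\<sigma> s' = - s'"
        | "chi b \<sigma> = 1" "chi a \<sigma> = 1" "\<sigma> s = - s" "\<sigma> s' = - s'" | "chi b \<sigma> = -1" "chi a \<sigma> = 1" "\<sigma> s = - s" "\<sigma> s' = s'"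
        | "chi b \<sigma> = 1" "chi a \<sigma> = -1" "\<sigma> s = s'" "\<sigma> s' = s" | "chi b \<sigma> = -1" "chi a \<sigma> = -1" "\<sigma> s = s'" "\<sigma> s' = - s"
        | "chi b \<sigma> = 1" "chi a \<sigma> = -1" "\<sigma> s = - s'" "\<sigma> s' = - s" | "chi b \<sigma> = -1" "chi a \<sigma> = -1" "\<sigma> s = - s'" "\<sigma> s' = s"
        using act[OF \<sigma>] chi_act(2)[OF \<sigma> rat(2) nz(2)] by auto
      thus ?thesis
        by cases (use r pr one in metis)+
    qed
    then obtain c d where cd: "(c, d) \<in> D4_pairs" "\<sigma> s = root c" "\<sigma> s' = root d"
      and imp: "chi a \<sigma> = 1 \<and> chi b \<sigma> = -1 \<longrightarrow> (c, d) = (1, 4) \<or> (c, d) = (3, 2)"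
        "chi a \<sigma> = -1 \<and> chi b \<sigma> = -1 \<longrightarrow> (c, d) = (2, 3) \<or> (c, d) = (4, 1)" by blast
    have "c \<in> {1, 2, 3, 4}" "d \<in> {1, 2, 3, 4}" using cd(1) by (auto simp: D4_pairs_iff)
    hence "perm \<sigma> = D4_map c d" unfolding perm_def cd(2,3) by (simp only: idx)
    thus ?thesis by (intro exI[of _ c] exI[of _ d] conjI cd imp)
  qed
  have act_root: "\<sigma> (root i) = root (D4_map c d i)"
    if "\<sigma> \<in> auts" "(c, d) \<in> D4_pairs" "\<sigma> s = root c" "\<sigma> s' = root d" "i \<in> {1, 2, 3, 4}" for \<sigma> c d i
  proof -
    have "c \<in> {1, 2, 3, 4}" "d \<in> {1, 2, 3, 4}" using that(2) by (auto simp: D4_pairs_iff)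
    hence o: "root (opp c) = - \<sigma> s" "root (opp d) = - \<sigma> s'" using that(3,4) root_opp by simp_all
    consider "i = 1" | "i = 2" | "i = 3" | "i = 4" using \<open>i \<in> {1, 2, 3, 4}\<close> by blast
    thus ?thesis
    proof cases
      case 3
      hence "D4_map c d i = opp c" "root i = - s" by (simp_all add: D4_map_def root_def)
      thus ?thesis using o(1) aut_minus[OF that(1)] by simp
    next
      case 4
      hence "D4_map c d i = opp d" "root i = - s'" by (simp_all add: D4_map_def root_def)
      thus ?thesis using o(2) aut_minus[OF that(1)] by simp
    next
      case 1
      hence "D4_map c d i = c" "root i = s" by (simp_all add: D4_map_def root_def)
      thus ?thesis using that(3) by simp
    next
      case 2
      hence "D4_map c d i = d" "root i = s'" by (simp_all add: D4_map_def root_def)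
      thus ?thesis using that(4) by simp
    qed
  qed
  have perm_comp: "perm (\<sigma> \<circ> \<tau>) = perm \<sigma> \<circ> perm \<tau>" if \<sigma>: "\<sigma> \<in> auts" and \<tau>: "\<tau> \<in> auts" for \<sigma> \<tau>
  proof -
    obtain c d where cd: "(c, d) \<in> D4_pairs" "\<sigma> s = root c" "\<sigma> s' = root d" "perm \<sigma> = D4_map c d"
      using perm_root[OF \<sigma>] by blast
    obtain c' d' where cd': "(c', d') \<in> D4_pairs" "\<tau> s = root c'" "\<tau> s' = root d'" "perm \<tau> = D4_map c' d'"
      using perm_root[OF \<tau>] by blast
    have i: "c' \<in> {1, 2, 3, 4}" "d' \<in> {1, 2, 3, 4}" using cd'(1) by (auto simp: D4_pairs_iff)
    have j: "D4_map c d c' \<in> {1, 2, 3, 4}" "D4_map c d d' \<in> {1, 2, 3, 4}"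
      using D4_pairs_closed[OF cd(1) cd'(1)] by (auto simp: D4_pairs_iff)
    have "perm (\<sigma> \<circ> \<tau>) = D4_map (D4_map c d c') (D4_map c d d')"
      unfolding perm_def o_apply cd'(2,3) act_root[OF \<sigma> cd(1-3) i(1)] act_root[OF \<sigma> cd(1-3) i(2)] idx[OF j(1)] idx[OF j(2)] ..
    thus ?thesis unfolding cd(4) cd'(4) D4_map_comp_eq .
  qed
  define H where "H = perm ` auts"
  have H_D4: "H \<subseteq> D4"
  proof
    fix p assume "p \<in> H"
    then obtain \<sigma> where \<sigma>: "\<sigma> \<in> auts" "p = perm \<sigma>" unfolding H_def by blast
    obtain c d where "(c, d) \<in> D4_pairs" "perm \<sigma> = D4_map c d" using perm_root[OF \<sigma>(1)] by blast
    thus "p \<in> D4" unfolding D4_eq \<sigma>(2) by force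
  qed
  have H_comp: "p \<circ> p' \<in> H" if "p \<in> H" "p' \<in> H" for p p'
  proof -
    obtain \<sigma> \<tau> where "\<sigma> \<in> auts" "\<tau> \<in> auts" "p = perm \<sigma>" "p' = perm \<tau>"
      using \<open>p \<in> H\<close> \<open>p' \<in> H\<close> unfolding H_def by (elim imageE)
    thus ?thesis unfolding H_def using perm_comp aut_comp(1) by (intro image_eqI[of _ _ "\<sigma> \<circ> \<tau>"]) simp_all
  qed
  have H_id: "id \<in> H"
  proof -
    have "perm id = D4_map 1 2"
      using idx[of 1] idx[of 2] by (simp add: perm_def root_def)
    thus ?thesis unfolding H_def id_eq using aut_id(1) by (metis image_eqI)
  qed
  obtain \<sigma>2 where \<sigma>2: "\<sigma>2 \<in> auts" "chi a \<sigma>2 = 1" "chi b \<sigma>2 = -1"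
    using exists_aut_flipping_second[OF rat(1,2) na nb nab] by blast
  have "\<exists>\<sigma>\<in>auts. chi b \<sigma> = 1 \<and> chi a \<sigma> = -1"
    by (rule exists_aut_flipping_second) (use rat na nb nab in \<open>auto simp: mult.commute\<close>)
  then obtain \<sigma>1 where \<sigma>1: "\<sigma>1 \<in> auts" "chi b \<sigma>1 = 1" "chi a \<sigma>1 = -1" by blast
  have \<sigma>3: "\<sigma>1 \<circ> \<sigma>2 \<in> auts" "chi a (\<sigma>1 \<circ> \<sigma>2) = -1" "chi b (\<sigma>1 \<circ> \<sigma>2) = -1"
    using chi_comp[OF \<sigma>1(1) \<sigma>2(1) rat(1) nz(1)] chi_comp[OF \<sigma>1(1) \<sigma>2(1) rat(2) nz(2)] \<sigma>1(2,3) \<sigma>2(2,3)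
      aut_comp(1)[OF \<sigma>1(1) \<sigma>2(1)] by (simp_all only: mult_1 mult_1_right)
  \<comment> \<open>Both candidates are quarter turns, and each is the cube of the other.\<close>
  have "D4_map 2 3 \<in> H \<or> D4_map 4 1 \<in> H"
  proof -
    obtain c d where "perm (\<sigma>1 \<circ> \<sigma>2) = D4_map c d" "(c, d) = (2, 3) \<or> (c, d) = (4, 1)"
      using perm_root[OF \<sigma>3(1)] \<sigma>3(2,3) by blast
    moreover have "perm (\<sigma>1 \<circ> \<sigma>2) \<in> H" unfolding H_def using \<sigma>3(1) by (rule imageI)
    ultimately show ?thesis by auto
  qed
  hence rot: "D4_rot \<in> H"
  proof
    assume *: "D4_map 4 1 \<in> H"
    have "D4_map 4 1 \<circ> (D4_map 4 1 \<circ> D4_map 4 1) = D4_rot"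
      unfolding rot_eq D4_map_comp_eq by (rule D4_map_eqI; simp add: D4_map_def opp_def)
    thus ?thesis using H_comp[OF * H_comp[OF * *]] by simp
  qed (simp only: rot_eq)
  have "D4_map 1 4 \<in> H \<or> D4_map 3 2 \<in> H"
  proof -
    obtain c d where "perm \<sigma>2 = D4_map c d" "(c, d) = (1, 4) \<or> (c, d) = (3, 2)"
      using perm_root[OF \<sigma>2(1)] \<sigma>2(2,3) by blast
    moreover have "perm \<sigma>2 \<in> H" unfolding H_def using \<sigma>2(1) by (rule imageI)
    ultimately show ?thesis by auto
  qed
  hence refl: "D4_refl \<in> H"
  proof
    assume *: "D4_map 1 4 \<in> H"
    have "D4_map 1 4 \<circ> (D4_rot \<circ> D4_rot) = D4_refl"
      unfolding rot_eq refl_eq D4_map_comp_eq by (rule D4_map_eqI; simp add: D4_map_def opp_def)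
    thus ?thesis using H_comp[OF * H_comp[OF rot rot]] by simp
  qed (simp only: refl_eq)
  have HD: "H = D4"
    using H_D4 D4_map_closed[OF rot refl H_id H_comp] unfolding D4_eq by auto
  \<comment> \<open>\<open>perm\<close> looks only at the values on s and s', so it applies to
    automorphisms and to their restrictions alike.\<close>
  have perm_restrict: "perm (restrict \<sigma> K) = perm \<sigma>" for \<sigma> using K(2,3) by (simp add: perm_def)
  have perm_inj: "restrict \<sigma> K = restrict \<tau> K" if \<sigma>\<tau>: "\<sigma> \<in> auts" "\<tau> \<in> auts" "perm \<sigma> = perm \<tau>" for \<sigma> \<tau>
  proof -
    obtain c d where cd: "\<sigma> s = root c" "\<sigma> s' = root d" "perm \<sigma> = D4_map c d"
      using perm_root[OF \<sigma>\<tau>(1)] by blast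
    obtain c' d' where cd': "\<tau> s = root c'" "\<tau> s' = root d'" "perm \<tau> = D4_map c' d'"
      using perm_root[OF \<sigma>\<tau>(2)] by blast
    have "D4_map c d 1 = D4_map c' d' 1" "D4_map c d 2 = D4_map c' d' 2" using \<sigma>\<tau>(3) cd(3) cd'(3) by simp_all
    hence "c = c'" "d = d'" by (simp_all add: D4_map_def)
    hence base: "\<sigma> u = \<tau> u" if "u \<in> {s, s'}" for u
      using that cd(1,2) cd'(1,2) by (elim insertE emptyE) (simp_all only:)
    have "\<sigma> z = \<tau> z" if "z \<in> K" for z
      by (rule aut_adj_eq[OF \<sigma>\<tau>(1,2) base that[unfolded K_def]])
    thus ?thesis by (rule restrict_ext)
  qed
  have carr: "carrier (galois_group Qbar \<rat> K) = (\<lambda>\<sigma>. restrict \<sigma> K) ` auts"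
    by (rule galois_group_stable[OF K(1) stab])
  have "perm \<in> Group.iso (galois_group Qbar \<rat> K) D4_group"
  proof (rule isoI)
    show "perm \<in> hom (galois_group Qbar \<rat> K) D4_group"
    proof (rule homI)
      fix \<phi> assume "\<phi> \<in> carrier (galois_group Qbar \<rat> K)"
      then obtain \<sigma> where \<sigma>: "\<sigma> \<in> auts" "\<phi> = restrict \<sigma> K" unfolding carr by blast
      have "perm \<sigma> \<in> D4" using \<sigma>(1) unfolding HD[symmetric] H_def by blast
      thus "perm \<phi> \<in> carrier D4_group" unfolding \<sigma>(2) perm_restrict by (simp add: D4_group_def)
      fix \<psi> assume "\<psi> \<in> carrier (galois_group Qbar \<rat> K)"
      then obtain \<tau> where \<tau>: "\<tau> \<in> auts" "\<psi> = restrict \<tau> K" unfolding carr by blast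
      show "perm (\<phi> \<otimes>\<^bsub>galois_group Qbar \<rat> K\<^esub> \<psi>) = perm \<phi> \<otimes>\<^bsub>D4_group\<^esub> perm \<psi>"
        unfolding \<sigma>(2) \<tau>(2) galois_group_mult[OF K(1) stab \<sigma>(1) \<tau>(1)] perm_restrict perm_comp[OF \<sigma>(1) \<tau>(1)]
        by (simp add: D4_group_def sym_group_mult)
    qed
    show "bij_betw perm (carrier (galois_group Qbar \<rat> K)) (carrier D4_group)"
      unfolding bij_betw_def
    proof
      show "inj_on perm (carrier (galois_group Qbar \<rat> K))"
      proof (rule inj_onI)
        fix \<phi> \<psi> assume "\<phi> \<in> carrier (galois_group Qbar \<rat> K)" "\<psi> \<in> carrier (galois_group Qbar \<rat> K)" "perm \<phi> = perm \<psi>"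
        then obtain \<sigma> \<tau> where "\<sigma> \<in> auts" "\<tau> \<in> auts" "\<phi> = restrict \<sigma> K" "\<psi> = restrict \<tau> K" "perm \<sigma> = perm \<tau>"
          unfolding carr by (auto simp only: perm_restrict)
        thus "\<phi> = \<psi>" using perm_inj by blast
      qed
      have "perm ` (carrier (galois_group Qbar \<rat> K)) = H"
        unfolding carr H_def image_image perm_restrict ..
      thus "perm ` carrier (galois_group Qbar \<rat> K) = carrier D4_group" by (simp add: HD D4_group_def)
    qed
  qed
  hence "D4_extension K"
    unfolding D4_extension_def using galois_extension_iff[of K] K(1) stab by (auto simp: is_iso_def)
  thus ?thesis using aK K(2) q by blast
qed

section \<open>Rational squares, and number fields from finite Galois groups\<close>

lemma integer_rational_square:
  assumes "of_int m = (r :: 'a)\<^sup>2" "r \<in> \<rat>" obtains k where "m = k\<^sup>2"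
proof -
  obtain a b where ab: "b > 0" "coprime a b" "r = of_int a / of_int b" using assms(2) by (rule Rats_cases')
  have "(of_int (m * b\<^sup>2) :: 'a) = of_int (a\<^sup>2)" using assms(1) ab by (simp add: field_simps)
  hence "m * b\<^sup>2 = a\<^sup>2" by (simp only: of_int_eq_iff)
  hence "b\<^sup>2 dvd a\<^sup>2" by (metis dvd_triv_right)
  hence "b dvd a" by simp
  hence "is_unit b" using ab(2) by (metis coprime_absorb_right coprime_commute)
  hence "b = 1" using ab(1) by simp
  thus ?thesis using that[of a] \<open>m * b\<^sup>2 = a\<^sup>2\<close> by simp
qed

lemma negative_not_square: "m < 0 \<Longrightarrow> r \<in> \<rat> \<Longrightarrow> of_int m \<noteq> (r :: 'a)\<^sup>2"
  by (metis integer_rational_square linorder_not_less zero_le_power2)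

lemma finite_dimension_adj:
  assumes "finite (A :: 'a set)" shows "ring.finite_dimension Qbar \<rat> (adj A)"
proof -
  interpret Qbar: field "Qbar :: 'a ring" by (rule field_from_type_algebra)
  obtain xs where xs: "set xs = A" using finite_list[OF assms] by blast
  have Q: "subfield (\<rat> :: 'a set) Qbar" by (rule ratring_subfield) (simp add: ratring_def)
  have carr: "set xs \<subseteq> carrier Qbar" "(\<rat> :: 'a set) \<subseteq> carrier Qbar" by (simp_all add: Qbar_simps)
  let ?E = "Qbar.finite_extension \<rat> xs"
  have sub: "subring ?E Qbar" by (rule Qbar.finite_extension_is_subring[OF subfieldE(1)[OF Q] carr(1)])
  have "ratring ?E"
    using Qbar.finite_extension_incl[OF carr(2,1)] subringE(6,7)[OF sub] by (auto simp: ratring_def Qbar_simps)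
  moreover have "A \<subseteq> ?E" using Qbar.finite_extension_mem[OF subfieldE(1)[OF Q] carr(1)] xs by blast
  ultimately have "adj A \<subseteq> ?E" by (rule adj_least)
  moreover have "?E \<subseteq> adj A"
  proof (rule Qbar.finite_extension_subring_incl)
    show "subring (adj A) Qbar" by (rule subfieldE(1)[OF ratring_subfield[OF ratring_adj]])
  qed (use xs in \<open>auto intro: adj.rat adj.base\<close>)
  ultimately have "adj A = ?E" by blast
  moreover have "Qbar.finite_dimension \<rat> ?E"
    by (rule Qbar.finite_extension_finite_dimension(1)[OF Q carr(1)]) (simp add: over_def algebraic_over_Rats)
  ultimately show ?thesis by simp
qed

text \<open>For each of finitely many representatives that moves some element of K, pick one such
  element. An automorphism fixing all of these acts trivially on K, so they generate K.\<close>

lemma finite_galois_group_number_field: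
  fixes K :: "'a set"
  assumes K: "ratring K" "stable K" and fin: "finite (carrier (galois_group Qbar \<rat> K))"
  shows "number_field K"
proof -
  have "finite ((\<lambda>\<sigma>. restrict \<sigma> K) ` auts)" using fin by (simp add: galois_group_stable[OF K])
  then obtain Z where Z: "finite Z" "Z \<subseteq> auts" "\<And>\<sigma>. \<sigma> \<in> auts \<Longrightarrow> \<exists>z\<in>Z. \<forall>x\<in>K. \<sigma> x = z x"
    using finite_representatives by blast
  define pick where "pick z = (SOME x. x \<in> K \<and> z x \<noteq> x)" for z :: "'a \<Rightarrow> 'a"
  define A where "A = pick ` {z\<in>Z. \<exists>x\<in>K. z x \<noteq> x}"
  have pick: "pick z \<in> K \<and> z (pick z) \<noteq> pick z" if "\<exists>x\<in>K. z x \<noteq> x" for z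
    unfolding pick_def by (rule someI_ex) (use that in blast)
  have "A \<subseteq> K" unfolding A_def using pick by blast
  hence "adj A \<subseteq> K" by (rule adj_least[OF K(1)])
  moreover have "K \<subseteq> adj A"
  proof
    fix y assume y: "y \<in> K"
    show "y \<in> adj A"
    proof (rule fixed_by_stabilizer[OF ratring_adj])
      fix \<sigma> :: "'a \<Rightarrow> 'a" assume \<sigma>: "\<sigma> \<in> auts" "\<And>x. x \<in> adj A \<Longrightarrow> \<sigma> x = x"
      obtain z where z: "z \<in> Z" "\<forall>x\<in>K. \<sigma> x = z x" using Z(3)[OF \<sigma>(1)] by blast
      show "\<sigma> y = y"
      proof (rule ccontr)
        assume "\<sigma> y \<noteq> y"
        hence ex: "\<exists>x\<in>K. z x \<noteq> x" using z(2) y by auto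
        hence "pick z \<in> A" using z(1) by (auto simp: A_def)
        hence "\<sigma> (pick z) = pick z" using \<sigma>(2) adj.base by blast
        thus False using pick[OF ex] z(2) by auto
      qed
    qed
  qed
  ultimately have "K = adj A" by blast
  moreover have "finite A" using Z(1) by (simp add: A_def)
  ultimately show ?thesis
    using finite_dimension_adj[of A] ratring_subfield[OF K(1)] by (simp add: number_field_def)
qed

lemma D4_extension_generalized:
  fixes K :: "'a set"
  assumes "D4_extension K" shows "generalized_D4_type_field K"
proof -
  have gal: "galois_extension Qbar \<rat> K" and iso: "galois_group Qbar \<rat> K \<cong> D4_group"
    using assms by (auto simp: D4_extension_def)
  have K: "ratring K" "stable K" using gal by (auto simp: galois_extension_iff)
  have gen: "generalized_D4_type_group (galois_group Qbar \<rat> K)"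
    by (rule generalized_D4_type_groupI[OF group_galois_group[OF K] iso])
  hence "finite (carrier (galois_group Qbar \<rat> K))" by (simp add: generalized_D4_type_group_def)
  thus ?thesis
    using gen finite_galois_group_number_field[OF K] galois_closure_props(4)[OF gal]
    by (simp add: generalized_D4_type_field_def)
qed

section \<open>The compositum of the dihedral extensions\<close>

definition D4_compositum :: "'a set" where
  "D4_compositum = compositum Qbar {K. D4_extension K}"

lemma D4_compositum_adj: "D4_compositum = adj (\<Union>{K. D4_extension K})"
  by (simp add: D4_compositum_def compositum_def generate_field_adj)

lemma ratring_D4_compositum: "ratring D4_compositum"
  by (simp add: D4_compositum_adj ratring_adj)

lemma D4_extension_subset: "D4_extension K \<Longrightarrow> K \<subseteq> D4_compositum"
  by (auto simp: D4_compositum_adj intro: adj.base)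

lemma split_nondegenerate:
  assumes "a \<in> \<rat>" "b \<in> \<rat>" "x \<in> \<rat>" "y \<in> \<rat>" "a * x\<^sup>2 + b * y\<^sup>2 = 1"
    "\<And>r. r \<in> \<rat> \<Longrightarrow> a \<noteq> r\<^sup>2" "\<And>r. r \<in> \<rat> \<Longrightarrow> b \<noteq> r\<^sup>2" "\<And>r. r \<in> \<rat> \<Longrightarrow> a * b \<noteq> r\<^sup>2"
  shows "rt a \<in> D4_compositum" "\<exists>f\<in>qelts \<inter> D4_compositum. \<forall>\<sigma>\<in>auts. qf f \<sigma> = hilb a b \<sigma>"
proof -
  obtain K s where "D4_extension K" "rt a \<in> K" "s \<in> K" "s \<in> qelts" "\<forall>\<sigma>\<in>auts. qf s \<sigma> = hilb a b \<sigma>"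
    using D4_field[OF assms] by blast
  thus "rt a \<in> D4_compositum" "\<exists>f\<in>qelts \<inter> D4_compositum. \<forall>\<sigma>\<in>auts. qf f \<sigma> = hilb a b \<sigma>"
    using D4_extension_subset by blast+
qed

text \<open>With u + v = 1 and u - v = 1 / a one gets a (u^2 - v^2) = 1, so the symbol (a, -a) is
  split.\<close>

lemma one_split:
  assumes "a \<noteq> (0 :: 'a)" shows "a * ((1 + inverse a) / 2)\<^sup>2 + - a * ((1 - inverse a) / 2)\<^sup>2 = 1"
  using assms by (simp add: field_simps power2_eq_square)

text \<open>A nonsquare m is given a partner c with (m, c) split and nondegenerate. For m > 0 it is
  -m, as -m and -m^2 are negative; for m = -k it is k^2 + k, since m + c = k^2.\<close>

lemma rt_int_D4_compositum: "rt (of_int m) \<in> D4_compositum"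
proof (cases "\<exists>r\<in>\<rat>. of_int m = (r :: 'a)\<^sup>2")
  case True
  then obtain r where "r \<in> \<rat>" "of_int m = (r :: 'a)\<^sup>2" by blast
  hence "rt (of_int m) \<in> \<rat>" by (metis Rats_minus_iff power2_eq_iff rt_square)
  thus ?thesis by (rule ratring_rat[OF ratring_D4_compositum])
next
  case False
  hence na: "of_int m \<noteq> (r :: 'a)\<^sup>2" if "r \<in> \<rat>" for r using that by blast
  have m0: "m \<noteq> 0" using na[of 0] by auto
  show ?thesis
  proof (cases "m > 0")
    case True
    let ?a = "of_int m :: 'a"
    have "(of_int (- m) :: 'a) \<noteq> r\<^sup>2" "(of_int (- (m * m)) :: 'a) \<noteq> r\<^sup>2" if "r \<in> \<rat>" for r
      using True that by (intro negative_not_square; simp)+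
    hence "- ?a \<noteq> r\<^sup>2" "?a * - ?a \<noteq> r\<^sup>2" if "r \<in> \<rat>" for r using that by simp_all
    thus ?thesis
      using m0 na by (intro split_nondegenerate(1)[OF _ _ _ _ one_split[of ?a]]) simp_all
  next
    case neg: False
    define k where "k = - m"
    have k: "k > 0" "m = - k" using neg m0 by (auto simp: k_def)
    define c where "c = k * k + k"
    have "(of_int c :: 'a) \<noteq> r\<^sup>2" if "r \<in> \<rat>" for r
    proof
      assume "of_int c = r\<^sup>2"
      then obtain j where j: "c = j\<^sup>2" using integer_rational_square \<open>r \<in> \<rat>\<close> by blast
      \<comment> \<open>k^2 + k lies strictly between consecutive squares.\<close>
      hence *: "k\<^sup>2 < \<bar>j\<bar>\<^sup>2" "\<bar>j\<bar>\<^sup>2 < (k + 1)\<^sup>2" using k(1) by (auto simp: c_def power2_eq_square algebra_simps)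
      have "k < \<bar>j\<bar>" "\<bar>j\<bar> < k + 1"
        using power2_less_imp_less[OF *(1)] power2_less_imp_less[OF *(2)] k(1) by simp_all
      thus False by linarith
    qed
    moreover have "(of_int m :: 'a) * of_int c \<noteq> r\<^sup>2" if "r \<in> \<rat>" for r
    proof -
      have "c > 0" using k(1) by (simp add: c_def add_pos_pos)
      hence "m * c < 0" using k by (intro mult_neg_pos) simp_all
      from negative_not_square[OF this that] show ?thesis by simp
    qed
    moreover have "of_int m * (inverse (of_int k))\<^sup>2 + of_int c * (inverse (of_int k))\<^sup>2 = (1 :: 'a)"
      using k by (simp add: c_def field_simps power2_eq_square)
    ultimately show ?thesis
      using na by (intro split_nondegenerate(1)[of "of_int m" "of_int c" "inverse (of_int k)" "inverse (of_int k)"]) auto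
  qed
qed

lemma multiquad_D4_compositum: "multiquad \<subseteq> D4_compositum"
  unfolding multiquad_def
proof (rule adj_least[OF ratring_D4_compositum], rule subsetI)
  fix t :: 'a assume "t \<in> {t. t\<^sup>2 \<in> \<rat>}"
  hence "t\<^sup>2 \<in> \<rat>" by simp
  then obtain a b where ab: "b > 0" "t\<^sup>2 = of_int a / of_int b" by (rule Rats_cases')
  have "(t * of_int b)\<^sup>2 = t\<^sup>2 * of_int b * of_int b" by (simp add: power2_eq_square mult_ac)
  also have "\<dots> = of_int (a * b)" using ab by simp
  finally have "t * of_int b = rt (of_int (a * b)) \<or> t * of_int b = - rt (of_int (a * b))"
    by (metis power2_eq_iff rt_square)
  hence "t * of_int b \<in> D4_compositum"
    using rt_int_D4_compositum[of "a * b"] ratring_minus[OF ratring_D4_compositum] by metis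
  hence "t * of_int b / of_int b \<in> D4_compositum"
    by (intro ratring_divide[OF ratring_D4_compositum _ _ alg]) (auto intro: ratring_rat[OF ratring_D4_compositum])
  thus "t \<in> D4_compositum" using ab(1) by simp
qed

text \<open>If a or b is a square, the symbol is trivial and f = 1 works. If a, b and a b are all
  nonsquares, a dihedral extension provides f. There remains the case in which only a b is a
  square.\<close>

lemma split_D4_compositum:
  assumes rat: "a \<in> \<rat>" "b \<in> \<rat>" "x \<in> \<rat>" "y \<in> \<rat>" and nz: "a \<noteq> 0" "b \<noteq> 0" and norm: "a * x\<^sup>2 + b * y\<^sup>2 = 1"
  shows "\<exists>f\<in>qelts \<inter> D4_compositum. \<forall>\<sigma>\<in>auts. qf f \<sigma> = hilb a b \<sigma>"
proof (cases "(\<exists>r\<in>\<rat>. a = r\<^sup>2) \<or> (\<exists>r\<in>\<rat>. b = r\<^sup>2)")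
  case True
  have "hilb a b \<sigma> = 1" if "\<sigma> \<in> auts" for \<sigma>
  proof -
    have "chi a \<sigma> = 1 \<or> chi b \<sigma> = 1" using True nz chi_square[OF that] by auto
    thus ?thesis by (auto simp: hilb_def)
  qed
  moreover have "1 \<in> qelts \<inter> D4_compositum" "\<And>\<sigma>. \<sigma> \<in> auts \<Longrightarrow> qf 1 \<sigma> = 1"
    using multiquad_qelts[of 1] ratring_1[OF ratring_multiquad] ratring_1[OF ratring_D4_compositum] by auto
  ultimately show ?thesis by (intro bexI[of _ 1]) auto
next
  case False
  hence na: "a \<noteq> r\<^sup>2" and nb: "b \<noteq> r\<^sup>2" if "r \<in> \<rat>" for r using that by blast+
  show ?thesis
  proof (cases "\<exists>r\<in>\<rat>. a * b = r\<^sup>2")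
    case False
    hence nab: "a * b \<noteq> r\<^sup>2" if "r \<in> \<rat>" for r using that by blast
    show ?thesis by (rule split_nondegenerate(2)[OF rat norm na nb nab])
  next
    case True
    then obtain r where r: "r \<in> \<rat>" "a * b = r\<^sup>2" by blast
    \<comment> \<open>Here \<open>a\<close> is a sum of two squares, and the cyclic case reduces to the symbols \<open>(a, -a)\<close> and \<open>(a, -1)\<close>.\<close>
    define z where "z = r * y / a"
    have z: "z \<in> \<rat>" "a * x\<^sup>2 + a * z\<^sup>2 = 1"
    proof -
      have "a * z\<^sup>2 = b * y\<^sup>2" using r(2)[symmetric] nz by (simp add: z_def field_simps power2_eq_square)
      thus "a * x\<^sup>2 + a * z\<^sup>2 = 1" using norm by simp
    qed (use rat r in \<open>simp add: z_def\<close>)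
    have minus_one: "-1 \<noteq> (p :: 'a)\<^sup>2" if "p \<in> \<rat>" for p
      using rat_squares_plus_one_nonzero[OF that Rats_0] by (metis add.right_neutral neg_eq_iff_add_eq_0 zero_power2 add.commute)
    \<comment> \<open>-a = p^2 would turn a x^2 + a z^2 = 1 into (p x)^2 + (p z)^2 = -1.\<close>
    have neg_a: "- a \<noteq> p\<^sup>2" if "p \<in> \<rat>" for p
    proof
      assume p: "- a = p\<^sup>2"
      have "(p * x)\<^sup>2 + (p * z)\<^sup>2 + 1 = - (a * x\<^sup>2 + a * z\<^sup>2) + 1"
        unfolding power_mult_distrib p[symmetric] by simp
      also have "\<dots> = 0" using z(2) by simp
      finally show False using rat_squares_plus_one_nonzero[of "p * x" "p * z"] that rat(3) z(1) by simp
    qed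
    have aa: "a * - a \<noteq> p\<^sup>2" if "p \<in> \<rat>" for p
    proof
      assume "a * - a = p\<^sup>2"
      hence "-1 = (p / a)\<^sup>2" using nz by (simp add: field_simps power2_eq_square)
      thus False using minus_one[of "p / a"] that rat(1) by simp
    qed
    have "\<exists>u v. u \<in> \<rat> \<and> v \<in> \<rat> \<and> a * u\<^sup>2 + - 1 * v\<^sup>2 = 1"
    proof -
      have *: "\<exists>u v. u \<in> \<rat> \<and> v \<in> \<rat> \<and> a * u\<^sup>2 + - 1 * v\<^sup>2 = 1"
        if "p \<in> \<rat>" "q \<in> \<rat>" "a * p\<^sup>2 + a * q\<^sup>2 = 1" "p \<noteq> 0" for p q
      proof -
        \<comment> \<open>As a (p^2 + q^2) = 1, the factor a cancels one p^2 + q^2 and leaves (p^2 +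
          q^2) / p^2.\<close>
        have "a * ((p\<^sup>2 + q\<^sup>2) / p)\<^sup>2 = (a * p\<^sup>2 + a * q\<^sup>2) * (p\<^sup>2 + q\<^sup>2) / p\<^sup>2"
          using that(4) by (simp add: field_simps power2_eq_square)
        also have "\<dots> = 1 + (q / p)\<^sup>2" unfolding that(3) using that(4) by (simp add: field_simps)
        finally show ?thesis
          using that(1,2) by (intro exI[of _ "(p\<^sup>2 + q\<^sup>2) / p"] exI[of _ "q / p"]) simp
      qed
      show ?thesis
      proof (cases "x = 0")
        case True
        hence "z \<noteq> 0" using z(2) by auto
        thus ?thesis using *[OF z(1) rat(3)] z(2) by (simp add: add.commute)
      next
        case False
        thus ?thesis using *[OF rat(3) z(1) z(2)] by blast
      qed
    qed
    then obtain u v where uv: "u \<in> \<rat>" "v \<in> \<rat>" "a * u\<^sup>2 + - 1 * v\<^sup>2 = 1" by blast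
    have "\<exists>f\<in>qelts \<inter> D4_compositum. \<forall>\<sigma>\<in>auts. qf f \<sigma> = hilb a (-1) \<sigma>"
      by (rule split_nondegenerate(2)[OF rat(1) _ uv na minus_one]) (use neg_a in simp_all)
    then obtain f where f: "f \<in> qelts" "f \<in> D4_compositum" "\<And>\<sigma>. \<sigma> \<in> auts \<Longrightarrow> qf f \<sigma> = hilb a (-1) \<sigma>" by blast
    have "\<exists>f\<in>qelts \<inter> D4_compositum. \<forall>\<sigma>\<in>auts. qf f \<sigma> = hilb a (- a) \<sigma>"
      by (rule split_nondegenerate(2)[OF rat(1) _ _ _ one_split[OF nz(1)] na neg_a aa]) (use rat(1) in simp_all)
    then obtain g where g: "g \<in> qelts" "g \<in> D4_compositum" "\<And>\<sigma>. \<sigma> \<in> auts \<Longrightarrow> qf g \<sigma> = hilb a (- a) \<sigma>" by blast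
    \<comment> \<open>(a, -1) (a, -a) = (a, a), and \<open>chi a\<close> agrees with
      \<open>chi b\<close> because a b is a square.\<close>
    have "qf (f * g) \<sigma> = hilb a b \<sigma>" if \<sigma>: "\<sigma> \<in> auts" for \<sigma>
    proof -
      have "qf (f * g) \<sigma> = hilb a ((-1) * (- a)) \<sigma>"
        using qelts_mult(2)[OF f(1) g(1) \<sigma>] f(3)[OF \<sigma>] g(3)[OF \<sigma>] hilb_mult_right[OF \<sigma>, of "-1" "- a" a] rat(1) nz(1) by simp
      moreover have "chi a \<sigma> * chi b \<sigma> = 1"
      proof -
        have "r \<noteq> 0" using r(2) nz by auto
        thus ?thesis using chi_square[OF \<sigma> r(1)] chi_mult[OF \<sigma> rat(1,2) nz] r(2) by simp
      qed
      hence "chi b \<sigma> = chi a \<sigma>" using chi_act(2)[OF \<sigma> rat(1) nz(1)] chi_act(2)[OF \<sigma> rat(2) nz(2)] by auto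
      ultimately show ?thesis by (simp add: hilb_def)
    qed
    moreover have "f * g \<in> qelts \<inter> D4_compositum"
      using f g qelts_mult(1) ratring_mult[OF ratring_D4_compositum] by blast
    ultimately show ?thesis by blast
  qed
qed

lemma generalized_D4_type_field_subset:
  fixes K :: "'a set"
  assumes "generalized_D4_type_field K" shows "K \<subseteq> D4_compositum"
proof -
  define M where "M = galois_closure Qbar \<rat> K"
  have M: "ratring M" "stable M" "K \<subseteq> M" unfolding M_def by (rule galois_closure_props)+
  let ?G = "galois_group Qbar \<rat> M"
  have gen: "generalized_D4_type_group ?G" using assms by (simp add: generalized_D4_type_field_def M_def)
  hence "finite (carrier ?G)" by (simp add: generalized_D4_type_group_def)
  hence fin: "finite ((\<lambda>\<sigma>. restrict \<sigma> M) ` auts)" by (simp add: galois_group_stable[OF M(1,2)])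
  have carr: "restrict \<sigma> M \<in> carrier ?G" if "\<sigma> \<in> auts" for \<sigma>
    using that by (auto simp: galois_group_stable[OF M(1,2)])
  note mult = galois_group_mult[OF M(1,2)]
  have one: "\<one>\<^bsub>?G\<^esub> = restrict id M" by (simp add: galois_group_simps BijGroup_def id_def)
  have four: "\<sigma> (\<sigma> (\<sigma> (\<sigma> x))) = x" if \<sigma>: "\<sigma> \<in> auts" and x: "x \<in> M" for \<sigma> x
  proof -
    have "restrict (\<sigma> \<circ> \<sigma> \<circ> \<sigma> \<circ> \<sigma>) M = restrict id M"
      using generalized_D4_type_group_laws(1)[OF gen carr[OF \<sigma>] carr[OF \<sigma>]]
      unfolding one mult[OF \<sigma> \<sigma>] mult[OF aut_comp(1)[OF \<sigma> \<sigma>] \<sigma>] mult[OF aut_comp(1)[OF aut_comp(1)[OF \<sigma> \<sigma>] \<sigma>] \<sigma>] .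
    hence "restrict (\<sigma> \<circ> \<sigma> \<circ> \<sigma> \<circ> \<sigma>) M x = restrict id M x" by (rule fun_cong)
    thus ?thesis using x by simp
  qed
  have central: "\<sigma> (\<sigma> (\<tau> x)) = \<tau> (\<sigma> (\<sigma> x))" if \<sigma>: "\<sigma> \<in> auts" and \<tau>: "\<tau> \<in> auts" and x: "x \<in> M" for \<sigma> \<tau> x
  proof -
    have "restrict (\<sigma> \<circ> \<sigma> \<circ> \<tau>) M = restrict (\<tau> \<circ> (\<sigma> \<circ> \<sigma>)) M"
      using generalized_D4_type_group_laws(2)[OF gen carr[OF \<sigma>] carr[OF \<tau>]]
      unfolding mult[OF \<sigma> \<sigma>] mult[OF aut_comp(1)[OF \<sigma> \<sigma>] \<tau>] mult[OF \<tau> aut_comp(1)[OF \<sigma> \<sigma>]] .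
    hence "restrict (\<sigma> \<circ> \<sigma> \<circ> \<tau>) M x = restrict (\<tau> \<circ> (\<sigma> \<circ> \<sigma>)) M x" by (rule fun_cong)
    thus ?thesis using x by simp
  qed
  have "qelts \<subseteq> D4_compositum"
    by (rule qelts_subset[OF ratring_D4_compositum multiquad_D4_compositum]) (rule split_D4_compositum)
  hence "adj (qelts \<inter> M) \<subseteq> D4_compositum" by (intro adj_least[OF ratring_D4_compositum]) blast
  moreover have "M \<subseteq> adj (qelts \<inter> M)" by (rule generated_by_qelts[OF M(1,2) fin]) (rule four central; assumption)+
  ultimately show ?thesis using M(3) by blast
qed

lemma D4_compositum_eq: "D4_compositum = Q_D4_infinity"
proof
  have Q: "Q_D4_infinity = adj (\<Union>{K :: 'a set. generalized_D4_type_field K})"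
    by (simp add: Q_D4_infinity_def compositum_def generate_field_adj)
  show "D4_compositum \<subseteq> Q_D4_infinity"
    unfolding Q D4_compositum_adj using D4_extension_generalized by (intro adj_mono) blast
  show "Q_D4_infinity \<subseteq> D4_compositum"
    unfolding Q using generalized_D4_type_field_subset by (intro adj_least[OF ratring_D4_compositum]) blast
qed

end

theorem theorem1p11:
  assumes "\<forall>x :: 'a :: {alg_closed_field, field_char_0}. algebraic x"
  shows "compositum Qbar {K. D4_extension K} = (Q_D4_infinity :: 'a set)"
proof -
  interpret algebraic_numbers "TYPE('a)" by unfold_locales (use assms in blast)
  show ?thesis using D4_compositum_eq by (simp add: D4_compositum_def)
qed

end
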